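(* Let $C_\psi>0$ and $\gamma>1$. There exist constants $C,C',c_0>0$ depending only on $C_\psi$ and $\gamma$ such that the following holds. Let $\xi=\xi_1+\xi_2\mathrm{i}$ be a complex sub-Gaussian random variable, where $\xi_1,\xi_2$ are independent copies of a real sub-Gaussian random variable, with $\|\xi\|_{\psi_2}\le C_\psi$, $\mathbb{E}\xi=0$, $\mathbb{E}\xi^2=0$, $\mathbb{E}|\xi|^2=1$ and $\mathbb{E}|\xi|^4=\gamma$. Let $a_1,\dots,a_m\in\mathbb{C}^d$ be i.i.d. random vectors whose entries are independent copies of $\xi$. Let $1\le k\le d$ be an integer and $\epsilon\ge0$. If $m\ge Ck\log(ed/k)$, then with probability at least $1-2\exp(-c_0m/4)$ the following is true: for all $k$-sparse $x_0\in\mathbb{C}^d$ and all $\eta=(\eta_1,\dots,\eta_m)\in\mathbb{R}^m$ with $\|\eta\|_2\le\epsilon$, putting $b_j:=|\langle a_j,x_0\rangle|+\eta_j$, $j=1,\dots,m$, every solution $\widehat{x}$ of $$\operatorname*{argmin}_{x\in\mathbb{C}^d}\ \|x\|_1\qquad\text{s.t.}\qquad\Bigl(\sum_{j=1}^m\bigl(|\langle a_j,x\rangle|-b_j\bigr)^2\Bigr)^{1/2}\le\epsilon$$ satisfies $$\min_{\theta\in[0,2\pi)}\|\widehat{x}-\exp(\mathrm{i}\theta)x_0\|_2\le C'\,\frac{\epsilon}{\sqrt m}.$$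
   Context: A (real or complex) random variable $\xi$ is sub-Gaussian if there are constants $\alpha,\kappa>0$ with $\mathbb{P}(|\xi|\ge t)\le\alpha\exp(-\kappa t^2)$ for all $t>0$; its sub-Gaussian norm is $\|\xi\|_{\psi_2}=\sup_{p\ge1}p^{-1/2}(\mathbb{E}|\xi|^p)^{1/p}$. For $u,v\in\mathbb{C}^d$, $\langle u,v\rangle=u^*v$. A vector is $k$-sparse if it has at most $k$ nonzero entries; $\|x\|_1=\sum_l|x_l|$ is the sum of complex moduli. *)

theory Defs
  imports "HOL-Probability.Probability"
begin

text \<open>
  A vector of \<open>\<complex>\<^sup>n\<close> or \<open>\<real>\<^sup>n\<close> is a function on \<open>nat\<close> of which only the entries with index \<open>< n\<close>
  are ever read. The dimension is a number and not a type because the constants of the theorem are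
  chosen before it.
\<close>

definition cip :: "nat \<Rightarrow> (nat \<Rightarrow> complex) \<Rightarrow> (nat \<Rightarrow> complex) \<Rightarrow> complex" where
  "cip d u v = (\<Sum>l<d. cnj (u l) * v l)"

definition norm_1 :: "nat \<Rightarrow> (nat \<Rightarrow> complex) \<Rightarrow> real" where
  "norm_1 d x = (\<Sum>l<d. cmod (x l))"

definition norm_2 :: "nat \<Rightarrow> (nat \<Rightarrow> 'b::real_normed_vector) \<Rightarrow> real" where
  "norm_2 n x = L2_set (\<lambda>l. norm (x l)) {..<n}"

definition sparse :: "nat \<Rightarrow> nat \<Rightarrow> (nat \<Rightarrow> complex) \<Rightarrow> bool" where
  "sparse d k x \<longleftrightarrow> card {l. l < d \<and> x l \<noteq> 0} \<le> k"

text \<open>The infimum below is a minimum, since the distance is continuous and \<open>2 * pi\<close>-periodic in \<open>\<theta>\<close>.\<close>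

definition phase_dist :: "nat \<Rightarrow> (nat \<Rightarrow> complex) \<Rightarrow> (nat \<Rightarrow> complex) \<Rightarrow> real" where
  "phase_dist d x y =
     (INF \<theta>\<in>{0..<2 * pi}. norm_2 d (\<lambda>l. x l - exp (\<i> * complex_of_real \<theta>) * y l))"

definition l1_solution ::
  "nat \<Rightarrow> nat \<Rightarrow> (nat \<Rightarrow> nat \<Rightarrow> complex) \<Rightarrow> (nat \<Rightarrow> real) \<Rightarrow> real \<Rightarrow> (nat \<Rightarrow> complex) \<Rightarrow> bool" where
  "l1_solution m d a b \<epsilon> x \<longleftrightarrow>
     is_arg_min (norm_1 d) (\<lambda>y. norm_2 m (\<lambda>j. cmod (cip d (a j) y) - b j) \<le> \<epsilon>) x"

definition sub_gaussian :: "'a measure \<Rightarrow> ('a \<Rightarrow> 'b::real_normed_vector) \<Rightarrow> bool" where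
  "sub_gaussian M X \<longleftrightarrow> X \<in> borel_measurable M \<and>
     (\<exists>\<alpha>>0. \<exists>\<kappa>>0. \<forall>t>0. measure M {\<omega> \<in> space M. t \<le> norm (X \<omega>)} \<le> \<alpha> * exp (- \<kappa> * t\<^sup>2))"

text \<open>
  The integrals and the supremum are taken in \<open>real\<close>. This is the intended value only for
  sub-Gaussian \<open>X\<close>, where all moments exist and the set is bounded above.
\<close>

definition psi2_norm :: "'a measure \<Rightarrow> ('a \<Rightarrow> 'b::real_normed_vector) \<Rightarrow> real" where
  "psi2_norm M X =
     (SUP p\<in>{1..}. p powr (- 1 / 2) * (\<integral>\<omega>. norm (X \<omega>) powr p \<partial>M) powr (1 / p))"

definition entry_variable :: "real \<Rightarrow> real \<Rightarrow> 'a measure \<Rightarrow> ('a \<Rightarrow> complex) \<Rightarrow> bool" where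
  "entry_variable C\<psi> \<gamma> M \<xi> \<longleftrightarrow>
     (\<exists>\<xi>1 \<xi>2. \<xi> = (\<lambda>\<omega>. Complex (\<xi>1 \<omega>) (\<xi>2 \<omega>)) \<and>
        sub_gaussian M \<xi>1 \<and> sub_gaussian M \<xi>2 \<and>
        distr M borel \<xi>1 = distr M borel \<xi>2 \<and>
        prob_space.indep_var M borel \<xi>1 borel \<xi>2) \<and>
     sub_gaussian M \<xi> \<and> psi2_norm M \<xi> \<le> C\<psi> \<and>
     (\<integral>\<omega>. \<xi> \<omega> \<partial>M) = 0 \<and> (\<integral>\<omega>. (\<xi> \<omega>)\<^sup>2 \<partial>M) = 0 \<and>
     (\<integral>\<omega>. (cmod (\<xi> \<omega>))\<^sup>2 \<partial>M) = 1 \<and> (\<integral>\<omega>. cmod (\<xi> \<omega>) ^ 4 \<partial>M) = \<gamma>"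

definition iid_entries ::
  "'a measure \<Rightarrow> nat \<Rightarrow> nat \<Rightarrow> ('a \<Rightarrow> complex) \<Rightarrow> (nat \<Rightarrow> nat \<Rightarrow> 'a \<Rightarrow> complex) \<Rightarrow> bool" where
  "iid_entries M m d \<xi> a \<longleftrightarrow>
     prob_space.indep_vars M (\<lambda>_. borel) (\<lambda>(j, l). a j l) ({..<m} \<times> {..<d}) \<and>
     (\<forall>j<m. \<forall>l<d. distr M borel (a j l) = distr M borel \<xi>)"

text \<open>
  The constants are admissible for all probability spaces over the type \<open>'a\<close>. The set of good
  outcomes is an uncountable intersection, so ``with probability at least \<open>p\<close>'' is expressed by a
  measurable event of probability at least \<open>p\<close> contained in it.
\<close>

definition recovery_constants ::
  "'a itself \<Rightarrow> real \<Rightarrow> real \<Rightarrow> real \<Rightarrow> real \<Rightarrow> real \<Rightarrow> bool" where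
  "recovery_constants (_ :: 'a itself) C\<psi> \<gamma> C C' c\<^sub>0 \<longleftrightarrow> C > 0 \<and> C' > 0 \<and> c\<^sub>0 > 0 \<and>
     (\<forall>(M :: 'a measure) \<xi> a (m::nat) (d::nat) (k::nat) (\<epsilon>::real).
        prob_space M \<longrightarrow> entry_variable C\<psi> \<gamma> M \<xi> \<longrightarrow> iid_entries M m d \<xi> a \<longrightarrow>
        1 \<le> k \<longrightarrow> k \<le> d \<longrightarrow> 0 \<le> \<epsilon> \<longrightarrow>
        real m \<ge> C * real k * ln (exp 1 * real d / real k) \<longrightarrow>
        (\<exists>E\<in>sets M. measure M E \<ge> 1 - 2 * exp (- c\<^sub>0 * real m / 4) \<and>
           (\<forall>\<omega>\<in>E. \<forall>x\<^sub>0 \<eta> b x'.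
              sparse d k x\<^sub>0 \<longrightarrow> norm_2 m \<eta> \<le> \<epsilon> \<longrightarrow>
              b = (\<lambda>j. cmod (cip d (\<lambda>l. a j l \<omega>) x\<^sub>0) + \<eta> j) \<longrightarrow>
              l1_solution m d (\<lambda>j l. a j l \<omega>) b \<epsilon> x' \<longrightarrow>
              phase_dist d x' x\<^sub>0 \<le> C' * (\<epsilon> / sqrt (real m)))))"

text \<open>
  HOL cannot quantify over types below an existential quantifier, so constants that serve the sample
  spaces of \<^emph>\<open>every\<close> type are expressed in two steps: constants exist for the sample spaces over
  \<^typ>\<open>nat \<times> nat \<Rightarrow> complex\<close>, a type that carries every joint law of countably many complex random
  variables, and any such constants are also valid over an arbitrary type \<open>'a\<close>. In particular they
  depend on neither the sample space nor its type.
\<close>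

end

theory Submission
  imports Defs
begin

text \<open>
  The proof is a small-ball argument for pairs of directions. Let \<open>x\<close> be a minimiser, rotate the
  signal to \<open>u = exp (i \<theta>) x0\<close> so that \<open>\<langle>u, x\<rangle>\<close> is real and nonnegative, and put \<open>h = x - u\<close>,
  \<open>w = x + u\<close>. For every row \<open>a\<close>,
    \<open>|\<langle>a, x\<rangle>|\<^sup>2 - |\<langle>a, u\<rangle>|\<^sup>2 = Re (cnj \<langle>a, h\<rangle> * \<langle>a, w\<rangle>)\<close>,
  and the sum of the two moduli is at most \<open>|\<langle>a, h\<rangle>| + |\<langle>a, w\<rangle>|\<close>. The choice of the phase gives
  \<open>\<parallel>h\<parallel> \<le> \<parallel>w\<parallel>\<close>, so a row at which the normalised product is bounded below and the normalised factors
  are bounded above contributes at least a constant times \<open>\<parallel>h\<parallel>\<close> to the difference of the phaseless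
  measurements (\<open>abs_cmod_diff_lower_bound\<close>). Since both \<open>x\<close> and \<open>x0\<close> fit the data, the whole
  difference has norm at most \<open>2 \<epsilon>\<close>, and \<open>\<parallel>h\<parallel> \<le> C' \<epsilon> / sqrt m\<close> follows if a fixed proportion of the
  rows is good in this sense (\<open>stable_recovery\<close>). Minimality in the \<open>\<ell>\<^sub>1\<close> norm and sparsity of \<open>x0\<close> place
  \<open>h\<close> and \<open>w\<close> among the vectors \<open>v\<close> with \<open>\<parallel>v\<parallel>\<^sub>1 \<le> 4 sqrt k \<parallel>v\<parallel>\<^sub>2\<close>, and the choice of the phase makes
  \<open>\<langle>h, w\<rangle>\<close> real. What has to be shown is thus that the good rows are many simultaneously for all such
  pairs.

  For one pair \<open>f, g\<close> of unit vectors with \<open>\<langle>f, g\<rangle>\<close> real, let \<open>Y = Re (cnj \<langle>a, f\<rangle> * \<langle>a, g\<rangle>)\<close>. With the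
  Hermitian matrix \<open>X = (f g* + g f*) / 2\<close>, the second moment of \<open>Y\<close> is
  \<open>\<parallel>X\<parallel>\<^sub>F\<^sup>2 + (tr X)\<^sup>2 + (\<gamma> - 2) \<Sum>\<^sub>l X\<^sub>l\<^sub>l\<^sup>2\<close>, which \<open>\<gamma> > 1\<close> keeps away from zero. The eighth moments of
  \<open>\<langle>a, f\<rangle>\<close> and \<open>\<langle>a, g\<rangle>\<close> are bounded independently of the dimension, because the moment generating
  function of a sub-Gaussian sum is a product. The Paley--Zygmund inequality turns this into a lower
  bound for the probability that a row is good (\<open>row_small_ball\<close>), and Hoeffding's inequality into
  the statement that all but exponentially few outcomes have many good rows.

  The step to all pairs rests on Maurey's empirical method. A vector with \<open>\<parallel>v\<parallel>\<^sub>1 \<le> 4 sqrt k\<close> is a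
  convex combination of multiples of the \<open>4 d + 1\<close> vectors \<open>0\<close>, \<open>i\<^sup>q e\<^sub>l\<close>, and an average of \<open>L k\<close> of
  them approximates it both in the \<open>\<ell>\<^sub>2\<close> norm and in the norm \<open>\<parallel>A v\<parallel>\<^sub>2\<close>; the error in the latter is
  governed by the longest column of the matrix, whose length Chernoff's bound controls. An error that is
  small in \<open>\<ell>\<^sub>2\<close> over the rows can spoil only a small proportion of the good rows. There are at most
  \<open>exp (L (L + 1) k ln (e d / k))\<close> such averages, so the union bound over pairs of them is affordable for
  \<open>m \<ge> C k ln (e d / k)\<close>.

  Finally, constants that are valid on the sample space of all families of complex numbers are
  valid on every sample space, by passing to the joint law of the entries and of \<open>\<xi>\<close>.
\<close>

section \<open>Exponential moments of sub-Gaussian variables\<close>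

lemma power_div_fact_le_exp:
  fixes x :: real
  assumes "0 \<le> x"
  shows "x ^ n / fact n \<le> exp x"
proof -
  have "(\<Sum>k\<in>{n}. x ^ k /\<^sub>R fact k) \<le> (\<Sum>k. x ^ k /\<^sub>R fact k)"
    by (rule sum_le_suminf) (use assms exp_converges[of x] in \<open>auto simp: sums_iff\<close>)
  then show ?thesis
    using exp_converges[of x] by (simp add: sums_iff field_simps)
qed

text \<open>
  The exponent has to be smaller than the decay rate of the tail: on the event \<open>n \<le> \<parallel>X\<parallel> < n + 1\<close>
  with \<open>n \<ge> 1\<close> the integrand is at most \<open>exp (\<kappa> (n + 1)\<^sup>2 / 8) \<le> exp (\<kappa> n\<^sup>2 / 2)\<close>, and the probability of
  this event is of order \<open>exp (- \<kappa> n\<^sup>2)\<close>.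
\<close>
lemma sub_gaussian_exp_square_integrable:
  fixes X :: "'a \<Rightarrow> 'b::{real_normed_vector, second_countable_topology}"
  assumes "prob_space M" and "sub_gaussian M X"
  shows "\<exists>\<kappa>>0. integrable M (\<lambda>\<omega>. exp (\<kappa> * (norm (X \<omega>))\<^sup>2))"
proof -
  interpret prob_space M by fact
  from assms(2) obtain \<alpha> \<kappa> where X[measurable]: "X \<in> borel_measurable M"
    and pos: "\<alpha> > 0" "\<kappa> > 0"
    and tail: "\<And>t. t > 0 \<Longrightarrow> prob {\<omega> \<in> space M. t \<le> norm (X \<omega>)} \<le> \<alpha> * exp (- \<kappa> * t\<^sup>2)"
    unfolding sub_gaussian_def by auto
  define c where "c k = (if k = 0 then exp (\<kappa> / 8) else \<alpha> * exp (- \<kappa> / 2) ^ k)" for k :: nat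
  have c_nonneg: "c k \<ge> 0" for k
    using pos by (simp add: c_def)
  have "summable c"
  proof (rule summable_comparison_test')
    show "summable (\<lambda>k. (exp (\<kappa> / 8) + \<alpha>) * exp (- \<kappa> / 2) ^ k)"
      using pos by (intro summable_mult summable_geometric) auto
    show "norm (c k) \<le> (exp (\<kappa> / 8) + \<alpha>) * exp (- \<kappa> / 2) ^ k" if "k \<ge> 0" for k
      using pos by (auto simp: c_def abs_mult intro!: mult_right_mono)
  qed
  define A where "A k = {\<omega> \<in> space M. real k \<le> norm (X \<omega>)}" for k :: nat
  have A[measurable]: "A k \<in> sets M" for k
    unfolding A_def by measurable
  have le: "ennreal (exp (\<kappa> / 8 * (norm (X \<omega>))\<^sup>2))
      \<le> (\<Sum>k. ennreal (exp (\<kappa> / 8 * (real k + 1)\<^sup>2)) * indicator (A k) \<omega>)"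
    if "\<omega> \<in> space M" for \<omega>
  proof -
    define n where "n = nat \<lfloor>norm (X \<omega>)\<rfloor>"
    have n: "real n \<le> norm (X \<omega>)" "norm (X \<omega>) \<le> real n + 1"
      unfolding n_def by (simp_all add: of_nat_floor)
    have "(norm (X \<omega>))\<^sup>2 \<le> (real n + 1)\<^sup>2"
      using n by (intro power_mono) auto
    then have "ennreal (exp (\<kappa> / 8 * (norm (X \<omega>))\<^sup>2))
        \<le> ennreal (exp (\<kappa> / 8 * (real n + 1)\<^sup>2)) * indicator (A n) \<omega>"
      using pos n that by (simp add: A_def)
    also have "\<dots> = (\<Sum>k\<in>{n}. ennreal (exp (\<kappa> / 8 * (real k + 1)\<^sup>2)) * indicator (A k) \<omega>)"
      by (simp only: sum.insert finite.emptyI empty_iff not_False_eq_True sum.empty add_0_right)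
    also have "\<dots> \<le> (\<Sum>k. ennreal (exp (\<kappa> / 8 * (real k + 1)\<^sup>2)) * indicator (A k) \<omega>)"
      by (rule sum_le_suminf) auto
    finally show ?thesis .
  qed
  have term_le: "exp (\<kappa> / 8 * (real k + 1)\<^sup>2) * prob (A k) \<le> c k" for k
  proof (cases "k = 0")
    case True
    then show ?thesis by (simp add: c_def A_def prob_space)
  next
    case False
    then have k1: "real k \<ge> 1" by simp
    have kk: "real k \<le> (real k)\<^sup>2"
      using k1 by (simp add: power2_eq_square)
    have "(real k + 1)\<^sup>2 \<le> (2 * real k)\<^sup>2"
      using k1 by (intro power_mono) auto
    then have "\<kappa> / 8 * (real k + 1)\<^sup>2 \<le> \<kappa> / 8 * (4 * (real k)\<^sup>2)"
      using pos by (intro mult_left_mono) (auto simp: power_mult_distrib)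
    moreover have "\<kappa> * (real k) \<le> \<kappa> * (real k)\<^sup>2"
      using kk pos by (intro mult_left_mono) auto
    ultimately have e: "\<kappa> / 8 * (real k + 1)\<^sup>2 - \<kappa> * (real k)\<^sup>2 \<le> real k * (- \<kappa> / 2)"
      by (simp add: algebra_simps)
    have "exp (\<kappa> / 8 * (real k + 1)\<^sup>2) * prob (A k)
        \<le> exp (\<kappa> / 8 * (real k + 1)\<^sup>2) * (\<alpha> * exp (- \<kappa> * (real k)\<^sup>2))"
      unfolding A_def using False by (intro mult_left_mono tail) auto
    also have "\<dots> = \<alpha> * exp (\<kappa> / 8 * (real k + 1)\<^sup>2 - \<kappa> * (real k)\<^sup>2)"
      by (simp only: diff_conv_add_uminus exp_add mult_minus_left mult_ac)
    also have "\<dots> \<le> \<alpha> * exp (real k * (- \<kappa> / 2))"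
      using e pos by simp
    also have "\<dots> = c k"
      by (simp only: c_def False if_False exp_of_nat_mult)
    finally show ?thesis .
  qed
  have "(\<integral>\<^sup>+\<omega>. ennreal (exp (\<kappa> / 8 * (norm (X \<omega>))\<^sup>2)) \<partial>M)
      \<le> (\<integral>\<^sup>+\<omega>. (\<Sum>k. ennreal (exp (\<kappa> / 8 * (real k + 1)\<^sup>2)) * indicator (A k) \<omega>) \<partial>M)"
    by (rule nn_integral_mono) (rule le)
  also have "\<dots> = (\<Sum>k. \<integral>\<^sup>+\<omega>. ennreal (exp (\<kappa> / 8 * (real k + 1)\<^sup>2)) * indicator (A k) \<omega> \<partial>M)"
    by (rule nn_integral_suminf) auto
  also have "\<dots> = (\<Sum>k. ennreal (exp (\<kappa> / 8 * (real k + 1)\<^sup>2) * prob (A k)))"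
    by (intro suminf_cong)
       (simp add: nn_integral_cmult_indicator emeasure_eq_measure ennreal_mult)
  also have "\<dots> \<le> (\<Sum>k. ennreal (c k))"
    using term_le by (intro suminf_le) (auto intro!: ennreal_leI)
  also have "\<dots> = ennreal (\<Sum>k. c k)"
    using c_nonneg \<open>summable c\<close> by (rule suminf_ennreal2)
  also have "\<dots> < \<infinity>" by simp
  finally have "integrable M (\<lambda>\<omega>. exp (\<kappa> / 8 * (norm (X \<omega>))\<^sup>2))"
    by (intro integrableI_nonneg) auto
  then show ?thesis
    using pos by (intro exI[of _ "\<kappa> / 8"]) auto
qed

text \<open>
  The inequality \<open>s \<le> exp s\<close> for \<open>s = 2 \<kappa> x\<^sup>2 / p\<close>, raised to the power \<open>p / 2\<close>.
\<close>
lemma powr_le_exp_square: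
  fixes x \<kappa> p :: real
  assumes "0 \<le> x" "0 < \<kappa>" "0 < p"
  shows "x powr p \<le> (p / (2 * \<kappa>)) powr (p / 2) * exp (\<kappa> * x\<^sup>2)"
proof (cases "x = 0")
  case False
  then have x: "x > 0" using assms by simp
  define s where "s = 2 * \<kappa> * x\<^sup>2 / p"
  have s: "s > 0" using x assms by (simp add: s_def)
  have "x powr p = (x\<^sup>2) powr (p / 2)"
    using x by (simp add: powr_powr flip: powr_numeral)
  also have "x\<^sup>2 = (p / (2 * \<kappa>)) * s"
    using assms by (simp add: s_def)
  also have "\<dots> powr (p / 2) = (p / (2 * \<kappa>)) powr (p / 2) * s powr (p / 2)"
    by (rule powr_mult)
  also have "s powr (p / 2) \<le> exp s powr (p / 2)"
    using s assms order.trans[OF _ exp_ge_add_one_self[of s]] by (intro powr_mono2) auto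
  also have "exp s powr (p / 2) = exp (\<kappa> * x\<^sup>2)"
    using assms by (simp add: powr_def s_def)
  finally show ?thesis
    by (simp add: mult_left_mono)
qed (use assms in auto)

text \<open>
  A supremum of reals bounds its members only when the set is bounded above. The qualitative tail
  bound in the definition of a sub-Gaussian variable is what guarantees this.
\<close>
lemma psi2_norm_set_bdd_above:
  fixes X :: "'a \<Rightarrow> 'b::{real_normed_vector, second_countable_topology}"
  assumes "prob_space M" and "sub_gaussian M X"
  shows "bdd_above ((\<lambda>p. p powr (- 1 / 2) * (\<integral>\<omega>. norm (X \<omega>) powr p \<partial>M) powr (1 / p)) ` {1..})"
proof -
  interpret prob_space M by fact
  have X[measurable]: "X \<in> borel_measurable M"
    using assms(2) by (simp add: sub_gaussian_def)
  obtain \<kappa> where \<kappa>: "\<kappa> > 0" and int: "integrable M (\<lambda>\<omega>. exp (\<kappa> * (norm (X \<omega>))\<^sup>2))"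
    using sub_gaussian_exp_square_integrable[OF assms] by auto
  define K where "K = (\<integral>\<omega>. exp (\<kappa> * (norm (X \<omega>))\<^sup>2) \<partial>M)"
  have "(\<integral>\<omega>. 1 \<partial>M) \<le> K"
    unfolding K_def using \<kappa> by (intro integral_mono int) auto
  then have K: "K \<ge> 1" by (simp add: prob_space)
  have "p powr (- 1 / 2) * (\<integral>\<omega>. norm (X \<omega>) powr p \<partial>M) powr (1 / p) \<le> (1 / (2 * \<kappa>)) powr (1 / 2) * K"
    if p: "p \<ge> 1" for p
  proof -
    have "(\<integral>\<omega>. norm (X \<omega>) powr p \<partial>M)
        \<le> (\<integral>\<omega>. (p / (2 * \<kappa>)) powr (p / 2) * exp (\<kappa> * (norm (X \<omega>))\<^sup>2) \<partial>M)"
      by (rule integral_mono_AE')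
         (use \<kappa> p int in \<open>auto intro!: powr_le_exp_square AE_I2\<close>)
    also have "\<dots> = (p / (2 * \<kappa>)) powr (p / 2) * K"
      by (simp add: K_def)
    finally have "(\<integral>\<omega>. norm (X \<omega>) powr p \<partial>M) powr (1 / p) \<le> ((p / (2 * \<kappa>)) powr (p / 2) * K) powr (1 / p)"
      using p by (intro powr_mono2) auto
    also have "\<dots> = (p / (2 * \<kappa>)) powr (1 / 2) * K powr (1 / p)"
      using p \<kappa> K by (simp add: powr_mult powr_powr)
    also have "\<dots> \<le> (p / (2 * \<kappa>)) powr (1 / 2) * K"
      using K p powr_mono[of "1 / p" 1 K] by (intro mult_left_mono) auto
    finally have "p powr (- 1 / 2) * (\<integral>\<omega>. norm (X \<omega>) powr p \<partial>M) powr (1 / p)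
        \<le> p powr (- 1 / 2) * ((p / (2 * \<kappa>)) powr (1 / 2) * K)"
      by (intro mult_left_mono) auto
    also have "\<dots> = (1 / (2 * \<kappa>)) powr (1 / 2) * K"
    proof -
      have "(p / (2 * \<kappa>)) powr (1 / 2) = p powr (1 / 2) * (1 / (2 * \<kappa>)) powr (1 / 2)"
        by (simp flip: powr_mult)
      moreover have "p powr (- 1 / 2) * p powr (1 / 2) = 1"
        using p by (simp flip: powr_add)
      ultimately show ?thesis
        by (metis (no_types, opaque_lifting) mult.assoc mult_1)
    qed
    finally show ?thesis .
  qed
  then show ?thesis
    by (intro bdd_aboveI2) auto
qed

lemma psi2_norm_even_moment_le:
  fixes X :: "'a \<Rightarrow> 'b::{real_normed_vector, second_countable_topology}"
  assumes "prob_space M" and "sub_gaussian M X" and "psi2_norm M X \<le> C" and "n \<ge> 1"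
  shows "integrable M (\<lambda>\<omega>. norm (X \<omega>) ^ (2 * n))"
    and "(\<integral>\<omega>. norm (X \<omega>) ^ (2 * n) \<partial>M) \<le> (2 * C\<^sup>2 * real n) ^ n"
proof -
  interpret prob_space M by fact
  have X[measurable]: "X \<in> borel_measurable M"
    using assms(2) by (simp add: sub_gaussian_def)
  obtain \<kappa> where \<kappa>: "\<kappa> > 0" and int: "integrable M (\<lambda>\<omega>. exp (\<kappa> * (norm (X \<omega>))\<^sup>2))"
    using sub_gaussian_exp_square_integrable[OF assms(1,2)] by auto
  define p where "p = real (2 * n)"
  have p: "p \<ge> 1" "p > 0" using assms(4) by (auto simp: p_def)
  have pw: "norm (X \<omega>) powr p = norm (X \<omega>) ^ (2 * n)" for \<omega>
    unfolding p_def using assms(4) by (intro powr_realpow') auto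
  show "integrable M (\<lambda>\<omega>. norm (X \<omega>) ^ (2 * n))"
  proof (rule Bochner_Integration.integrable_bound)
    show "integrable M (\<lambda>\<omega>. (p / (2 * \<kappa>)) powr (p / 2) * exp (\<kappa> * (norm (X \<omega>))\<^sup>2))"
      using int by simp
    show "AE \<omega> in M. norm (norm (X \<omega>) ^ (2 * n)) \<le> norm ((p / (2 * \<kappa>)) powr (p / 2) * exp (\<kappa> * (norm (X \<omega>))\<^sup>2))"
      using powr_le_exp_square[OF norm_ge_zero \<kappa> p(2)] by (auto simp flip: pw)
  qed auto
  define I where "I = (\<integral>\<omega>. norm (X \<omega>) ^ (2 * n) \<partial>M)"
  have I: "I \<ge> 0" unfolding I_def by simp
  have "p powr (- 1 / 2) * (\<integral>\<omega>. norm (X \<omega>) powr p \<partial>M) powr (1 / p) \<le> psi2_norm M X"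
    unfolding psi2_norm_def using p by (intro cSUP_upper psi2_norm_set_bdd_above assms(1,2)) auto
  then have "p powr (- 1 / 2) * I powr (1 / p) \<le> C"
    using assms(3) by (simp add: I_def pw)
  then have *: "I powr (1 / p) \<le> C * sqrt p"
    using p by (simp add: powr_minus powr_half_sqrt field_simps)
  have "I = (I powr (1 / p)) ^ (2 * n)"
  proof (cases "I = 0")
    case False
    then have "(I powr (1 / p)) ^ (2 * n) = I powr (1 / p * p)"
      using I p by (simp add: p_def powr_powr flip: powr_realpow)
    then show ?thesis using I p by simp
  qed (use assms(4) in simp)
  also have "\<dots> \<le> (C * sqrt p) ^ (2 * n)"
    using * by (intro power_mono) auto
  also have "\<dots> = (C\<^sup>2 * p) ^ n"
    using p by (simp add: power_mult power_mult_distrib)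
  also have "\<dots> = (2 * C\<^sup>2 * real n) ^ n"
    by (simp add: p_def mult_ac)
  finally show "I \<le> (2 * C\<^sup>2 * real n) ^ n" .
qed

text \<open>
  Here the tail constants, on which nothing may depend, give way to the sub-Gaussian norm. In the
  series of the exponential function the \<open>n\<close>-th term has expectation at most
  \<open>\<beta>\<^sup>n (2 C\<^sup>2 n)\<^sup>n / n! \<le> (2 e \<beta> C\<^sup>2)\<^sup>n = 2\<^sup>-\<^sup>n\<close>, which explains the value of \<open>\<beta>\<close>.
\<close>
lemma psi2_norm_exp_square_moment:
  fixes X :: "'a \<Rightarrow> 'b::{real_normed_vector, second_countable_topology}"
  assumes "prob_space M" and "sub_gaussian M X" and "psi2_norm M X \<le> C" and "C > 0"
  defines "\<beta> \<equiv> 1 / (4 * exp 1 * C\<^sup>2)"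
  shows "integrable M (\<lambda>\<omega>. exp (\<beta> * (norm (X \<omega>))\<^sup>2))"
    and "(\<integral>\<omega>. exp (\<beta> * (norm (X \<omega>))\<^sup>2) \<partial>M) \<le> 2"
proof -
  interpret prob_space M by fact
  have X[measurable]: "X \<in> borel_measurable M"
    using assms(2) by (simp add: sub_gaussian_def)
  have \<beta>: "\<beta> > 0" using assms(4) by (simp add: \<beta>_def)
  define t where "t n \<omega> = \<beta> ^ n / fact n * norm (X \<omega>) ^ (2 * n)" for n \<omega>
  have t_nonneg: "t n \<omega> \<ge> 0" for n \<omega>
    using \<beta> by (simp add: t_def)
  have int_t: "integrable M (t n)" for n
    unfolding t_def[abs_def]
    by (cases "n = 0") (use psi2_norm_even_moment_le(1)[OF assms(1-3), of n] in auto)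
  have int_le: "(\<integral>\<omega>. t n \<omega> \<partial>M) \<le> (1 / 2) ^ n" for n
  proof (cases "n = 0")
    case True
    then show ?thesis by (simp add: t_def prob_space)
  next
    case False
    then have n: "n \<ge> 1" by simp
    have "(\<integral>\<omega>. t n \<omega> \<partial>M) = \<beta> ^ n / fact n * (\<integral>\<omega>. norm (X \<omega>) ^ (2 * n) \<partial>M)"
      by (simp add: t_def)
    also have "\<dots> \<le> \<beta> ^ n / fact n * (2 * C\<^sup>2 * real n) ^ n"
      using \<beta> psi2_norm_even_moment_le(2)[OF assms(1-3) n] by (intro mult_left_mono) auto
    also have "\<dots> = (2 * \<beta> * C\<^sup>2) ^ n * (real n ^ n / fact n)"
      by (simp add: power_mult_distrib)
    also have "\<dots> \<le> (2 * \<beta> * C\<^sup>2) ^ n * exp (real n)"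
      using \<beta> power_div_fact_le_exp[of "real n" n] by (intro mult_left_mono) auto
    also have "\<dots> = (2 * \<beta> * C\<^sup>2 * exp 1) ^ n"
      by (simp add: power_mult_distrib flip: exp_of_nat_mult)
    also have "2 * \<beta> * C\<^sup>2 * exp 1 = 1 / 2"
      using assms(4) by (simp add: \<beta>_def)
    finally show ?thesis .
  qed
  have exp_eq: "ennreal (exp (\<beta> * (norm (X \<omega>))\<^sup>2)) = (\<Sum>n. ennreal (t n \<omega>))" for \<omega>
  proof -
    have "t n \<omega> = (\<beta> * (norm (X \<omega>))\<^sup>2) ^ n /\<^sub>R fact n" for n
      unfolding t_def power_mult power_mult_distrib by (simp add: divide_inverse)
    then have "(\<lambda>n. t n \<omega>) sums exp (\<beta> * (norm (X \<omega>))\<^sup>2)"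
      using exp_converges[of "\<beta> * (norm (X \<omega>))\<^sup>2"] by simp
    then have "summable (\<lambda>n. t n \<omega>)" and "(\<Sum>n. t n \<omega>) = exp (\<beta> * (norm (X \<omega>))\<^sup>2)"
      by (simp_all only: sums_iff)
    then show ?thesis
      using suminf_ennreal2[of "\<lambda>n. t n \<omega>", OF t_nonneg] by metis
  qed
  have "(\<integral>\<^sup>+\<omega>. ennreal (exp (\<beta> * (norm (X \<omega>))\<^sup>2)) \<partial>M) = (\<Sum>n. \<integral>\<^sup>+\<omega>. ennreal (t n \<omega>) \<partial>M)"
    unfolding exp_eq by (rule nn_integral_suminf) (use int_t in auto)
  also have "\<dots> = (\<Sum>n. ennreal (\<integral>\<omega>. t n \<omega> \<partial>M))"
    by (intro suminf_cong nn_integral_eq_integral int_t) (use t_nonneg in auto)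
  also have "\<dots> \<le> (\<Sum>n. ennreal ((1 / 2) ^ n))"
    by (intro suminf_le ennreal_leI int_le) auto
  also have "\<dots> = ennreal (\<Sum>n. (1 / 2) ^ n)"
    by (rule suminf_ennreal2) (auto intro: summable_geometric)
  also have "\<dots> = ennreal 2"
    by (simp add: suminf_geometric)
  finally have le2: "(\<integral>\<^sup>+\<omega>. ennreal (exp (\<beta> * (norm (X \<omega>))\<^sup>2)) \<partial>M) \<le> ennreal 2" .
  show int: "integrable M (\<lambda>\<omega>. exp (\<beta> * (norm (X \<omega>))\<^sup>2))"
    using le_less_trans[OF le2] by (intro integrableI_nonneg) auto
  show "(\<integral>\<omega>. exp (\<beta> * (norm (X \<omega>))\<^sup>2) \<partial>M) \<le> 2"
    using le2 nn_integral_eq_integral[OF int] by (simp add: ennreal_le_iff del: ennreal_numeral flip: ennreal_numeral)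
qed

section \<open>Random variables with all moments\<close>

text \<open>
  Integrability of products of entries and of partial inner products is needed in many places.
  The variables with finite moments of all orders form an algebra, so it is enough to know
  membership of the entries in this class.
\<close>
definition all_moments :: "'a measure \<Rightarrow> ('a \<Rightarrow> 'b::{real_normed_field, banach, second_countable_topology}) \<Rightarrow> bool" where
  "all_moments M X \<longleftrightarrow> X \<in> borel_measurable M \<and> (\<forall>p::nat. integrable M (\<lambda>\<omega>. norm (X \<omega>) ^ p))"

lemma all_moments_measurable[measurable_dest]: "all_moments M X \<Longrightarrow> X \<in> borel_measurable M"
  by (simp add: all_moments_def)

lemma all_moments_integrable: "all_moments M X \<Longrightarrow> integrable M X"
  using integrable_norm_iff[of X M] unfolding all_moments_def
  by (metis (no_types, lifting) Bochner_Integration.integrable_cong power_one_right)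

lemma all_moments_norm_le:
  assumes "all_moments M X" and [measurable]: "Y \<in> borel_measurable M"
    and le: "\<And>\<omega>. norm (Y \<omega>) \<le> norm (X \<omega>)"
  shows "all_moments M Y"
  unfolding all_moments_def
proof (intro conjI allI)
  fix p :: nat
  show "integrable M (\<lambda>\<omega>. norm (Y \<omega>) ^ p)"
  proof (rule Bochner_Integration.integrable_bound)
    show "integrable M (\<lambda>\<omega>. norm (X \<omega>) ^ p)"
      using assms(1) by (simp add: all_moments_def)
    show "AE \<omega> in M. norm (norm (Y \<omega>) ^ p) \<le> norm (norm (X \<omega>) ^ p)"
      by (rule AE_I2) (simp add: power_mono le)
  qed simp
qed fact

lemma (in prob_space) all_moments_const: "all_moments M (\<lambda>_. c)"
  by (simp add: all_moments_def)

lemma all_moments_mult: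
  assumes X: "all_moments M X" and Y: "all_moments M Y"
  shows "all_moments M (\<lambda>\<omega>. X \<omega> * Y \<omega>)"
  unfolding all_moments_def
proof (intro conjI allI)
  note [measurable] = all_moments_measurable[OF X] all_moments_measurable[OF Y]
  show "(\<lambda>\<omega>. X \<omega> * Y \<omega>) \<in> borel_measurable M" by measurable
  fix p :: nat
  show "integrable M (\<lambda>\<omega>. norm (X \<omega> * Y \<omega>) ^ p)"
  proof (rule Bochner_Integration.integrable_bound)
    show "integrable M (\<lambda>\<omega>. norm (X \<omega>) ^ (2 * p) + norm (Y \<omega>) ^ (2 * p))"
      using X Y by (auto simp: all_moments_def)
    have "norm (norm (X \<omega> * Y \<omega>) ^ p) \<le> norm (norm (X \<omega>) ^ (2 * p) + norm (Y \<omega>) ^ (2 * p))" for \<omega>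
    proof -
      define x y where "x = norm (X \<omega>) ^ p" and "y = norm (Y \<omega>) ^ p"
      have "0 \<le> x" "0 \<le> y" by (simp_all add: x_def y_def)
      moreover have "2 * (x * y) \<le> x\<^sup>2 + y\<^sup>2"
        using sum_squares_bound[of x y] by (simp add: mult.assoc)
      ultimately have "x * y \<le> x\<^sup>2 + y\<^sup>2"
        using mult_nonneg_nonneg[of x y] by linarith
      then show ?thesis
        unfolding x_def y_def power_even_eq norm_mult power_mult_distrib
        by (smt (verit) norm_ge_zero power_mult_distrib real_norm_def zero_le_power)
    qed
    then show "AE \<omega> in M. norm (norm (X \<omega> * Y \<omega>) ^ p) \<le> norm (norm (X \<omega>) ^ (2 * p) + norm (Y \<omega>) ^ (2 * p))"
      by simp
  qed simp
qed

lemma all_moments_add: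
  assumes X: "all_moments M X" and Y: "all_moments M Y"
  shows "all_moments M (\<lambda>\<omega>. X \<omega> + Y \<omega>)"
  unfolding all_moments_def
proof (intro conjI allI)
  note [measurable] = all_moments_measurable[OF X] all_moments_measurable[OF Y]
  show "(\<lambda>\<omega>. X \<omega> + Y \<omega>) \<in> borel_measurable M" by measurable
  fix p :: nat
  show "integrable M (\<lambda>\<omega>. norm (X \<omega> + Y \<omega>) ^ p)"
  proof (rule Bochner_Integration.integrable_bound)
    show "integrable M (\<lambda>\<omega>. 2 ^ p * (norm (X \<omega>) ^ p + norm (Y \<omega>) ^ p))"
      using X Y by (auto simp: all_moments_def)
    have "norm (norm (X \<omega> + Y \<omega>) ^ p) \<le> norm (2 ^ p * (norm (X \<omega>) ^ p + norm (Y \<omega>) ^ p))" for \<omega>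
    proof -
      have "norm (X \<omega> + Y \<omega>) ^ p \<le> (2 * max (norm (X \<omega>)) (norm (Y \<omega>))) ^ p"
        using norm_triangle_ineq[of "X \<omega>" "Y \<omega>"] by (intro power_mono) auto
      also have "\<dots> \<le> 2 ^ p * (norm (X \<omega>) ^ p + norm (Y \<omega>) ^ p)"
        by (auto simp: power_mult_distrib max_def)
      finally show ?thesis by simp
    qed
    then show "AE \<omega> in M. norm (norm (X \<omega> + Y \<omega>) ^ p) \<le> norm (2 ^ p * (norm (X \<omega>) ^ p + norm (Y \<omega>) ^ p))"
      by simp
  qed simp
qed

lemma (in prob_space) all_moments_power:
  "all_moments M X \<Longrightarrow> all_moments M (\<lambda>\<omega>. X \<omega> ^ n)"
  by (induction n) (auto intro: all_moments_mult all_moments_const)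

lemma (in prob_space) all_moments_sum:
  "(\<And>i. i \<in> I \<Longrightarrow> all_moments M (X i)) \<Longrightarrow> all_moments M (\<lambda>\<omega>. \<Sum>i\<in>I. X i \<omega>)"
  by (induction I rule: infinite_finite_induct) (auto intro: all_moments_add all_moments_const)

lemma cnj_measurable[measurable]: "cnj \<in> borel_measurable borel"
  by (intro borel_measurable_continuous_onI continuous_on_cnj continuous_on_id)

lemma all_moments_complex:
  assumes X: "all_moments M (X :: 'a \<Rightarrow> complex)"
  shows "all_moments M (\<lambda>\<omega>. cnj (X \<omega>))" "all_moments M (\<lambda>\<omega>. Re (X \<omega>))"
    "all_moments M (\<lambda>\<omega>. cmod (X \<omega>))"
proof -
  note [measurable] = all_moments_measurable[OF X]
  show "all_moments M (\<lambda>\<omega>. cnj (X \<omega>))"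
    by (rule all_moments_norm_le[OF X]) auto
  show "all_moments M (\<lambda>\<omega>. cmod (X \<omega>))"
    using X by (simp add: all_moments_def)
  show "all_moments M (\<lambda>\<omega>. Re (X \<omega>))"
    unfolding all_moments_def
  proof (intro conjI allI)
    fix p :: nat
    show "integrable M (\<lambda>\<omega>. norm (Re (X \<omega>)) ^ p)"
    proof (rule Bochner_Integration.integrable_bound)
      show "integrable M (\<lambda>\<omega>. cmod (X \<omega>) ^ p)"
        using X by (simp add: all_moments_def)
      show "AE \<omega> in M. norm (norm (Re (X \<omega>)) ^ p) \<le> norm (cmod (X \<omega>) ^ p)"
        by (rule AE_I2) (simp add: power_mono abs_Re_le_cmod)
    qed simp
  qed simp
qed

lemma all_moments_of_real:
  assumes X: "all_moments M X"
  shows "all_moments M (\<lambda>\<omega>. complex_of_real (X \<omega>))"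
  using X by (auto simp: all_moments_def)

lemmas (in prob_space) all_moments_intros =
  all_moments_const all_moments_add all_moments_mult all_moments_power all_moments_sum
  all_moments_complex all_moments_of_real

lemma (in prob_space) all_moments_if_exp_square_integrable:
  fixes X :: "'a \<Rightarrow> complex"
  assumes [measurable]: "X \<in> borel_measurable M" and \<beta>: "\<beta> > 0"
    and int: "integrable M (\<lambda>\<omega>. exp (\<beta> * (cmod (X \<omega>))\<^sup>2))"
  shows "all_moments M X"
  unfolding all_moments_def
proof (intro conjI allI)
  fix p :: nat
  show "integrable M (\<lambda>\<omega>. cmod (X \<omega>) ^ p)"
  proof (rule Bochner_Integration.integrable_bound)
    show "integrable M (\<lambda>\<omega>. 1 + fact p / \<beta> ^ p * exp (\<beta> * (cmod (X \<omega>))\<^sup>2))"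
      using int by simp
    have "cmod (X \<omega>) ^ p \<le> 1 + fact p / \<beta> ^ p * exp (\<beta> * (cmod (X \<omega>))\<^sup>2)" for \<omega>
    proof -
      define y where "y = cmod (X \<omega>) ^ p"
      have "(\<beta> * (cmod (X \<omega>))\<^sup>2) ^ p / fact p \<le> exp (\<beta> * (cmod (X \<omega>))\<^sup>2)"
        using \<beta> by (intro power_div_fact_le_exp) auto
      moreover have "(\<beta> * (cmod (X \<omega>))\<^sup>2) ^ p = \<beta> ^ p * y\<^sup>2"
        unfolding y_def power_mult_distrib by (simp add: power_even_eq mult.commute flip: power_mult)
      ultimately have "y\<^sup>2 \<le> fact p / \<beta> ^ p * exp (\<beta> * (cmod (X \<omega>))\<^sup>2)"
        using \<beta> by (simp add: field_simps)
      moreover have "y \<le> 1 + y\<^sup>2"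
        using sum_squares_bound[of y 1] zero_le_power[of "cmod (X \<omega>)" p] by (simp flip: y_def)
      ultimately show ?thesis by (simp add: y_def)
    qed
    then show "AE \<omega> in M. norm (cmod (X \<omega>) ^ p) \<le> norm (1 + fact p / \<beta> ^ p * exp (\<beta> * (cmod (X \<omega>))\<^sup>2))"
      by (auto intro!: AE_I2 order_trans[OF _ abs_ge_self])
  qed simp
qed fact

section \<open>A row of independent entries\<close>

text \<open>
  The normalisation of the entries, together with an exponential moment that carries the dependence on
  the sub-Gaussian norm.
\<close>
definition standard_entry :: "'a measure \<Rightarrow> real \<Rightarrow> real \<Rightarrow> ('a \<Rightarrow> complex) \<Rightarrow> bool" where
  "standard_entry M \<beta> \<gamma> X \<longleftrightarrow> X \<in> borel_measurable M \<and>
     integrable M (\<lambda>\<omega>. exp (\<beta> * (cmod (X \<omega>))\<^sup>2)) \<and> (\<integral>\<omega>. exp (\<beta> * (cmod (X \<omega>))\<^sup>2) \<partial>M) \<le> 2 \<and>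
     (\<integral>\<omega>. X \<omega> \<partial>M) = 0 \<and> (\<integral>\<omega>. (X \<omega>)\<^sup>2 \<partial>M) = 0 \<and>
     (\<integral>\<omega>. (cmod (X \<omega>))\<^sup>2 \<partial>M) = 1 \<and> (\<integral>\<omega>. cmod (X \<omega>) ^ 4 \<partial>M) = \<gamma>"

lemma cip_Suc: "cip (Suc n) u v = cip n u v + cnj (u n) * v n"
  by (simp add: cip_def)

locale standard_row = prob_space M for M :: "'a measure" +
  fixes X :: "nat \<Rightarrow> 'a \<Rightarrow> complex" and d :: nat and \<beta> \<gamma> :: real
  assumes beta_pos: "\<beta> > 0"
    and indep: "indep_vars (\<lambda>_. borel) X {..<d}"
    and entry: "l < d \<Longrightarrow> standard_entry M \<beta> \<gamma> (X l)"
begin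

lemma entry_measurable: "l < d \<Longrightarrow> X l \<in> borel_measurable M"
  using entry by (simp add: standard_entry_def)

lemma entry_moments: "l < d \<Longrightarrow> all_moments M (X l)"
  using entry beta_pos by (intro all_moments_if_exp_square_integrable) (auto simp: standard_entry_def)

lemma ip_moments: "n \<le> d \<Longrightarrow> all_moments M (\<lambda>\<omega>. cip n (\<lambda>l. X l \<omega>) f)"
  unfolding cip_def by (intro all_moments_intros entry_moments) auto

text \<open>
  The \<open>n\<close>-th entry is independent of the inner products over the coordinates below \<open>n\<close>. Through this
  factorisation the moments of a row are computed one coordinate at a time.
\<close>
lemma expectation_split:
  fixes \<phi> :: "complex \<Rightarrow> 'c::{real_normed_field, banach, second_countable_topology}"
    and \<psi> :: "complex \<times> complex \<Rightarrow> 'c"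
  assumes n: "n < d" and \<phi>: "\<phi> \<in> borel_measurable borel" and \<psi>: "\<psi> \<in> borel_measurable borel"
    and 1: "all_moments M (\<lambda>\<omega>. \<phi> (X n \<omega>))"
    and 2: "all_moments M (\<lambda>\<omega>. \<psi> (cip n (\<lambda>l. X l \<omega>) f, cip n (\<lambda>l. X l \<omega>) g))"
  shows "(\<integral>\<omega>. \<phi> (X n \<omega>) * \<psi> (cip n (\<lambda>l. X l \<omega>) f, cip n (\<lambda>l. X l \<omega>) g) \<partial>M) =
    (\<integral>\<omega>. \<phi> (X n \<omega>) \<partial>M) * (\<integral>\<omega>. \<psi> (cip n (\<lambda>l. X l \<omega>) f, cip n (\<lambda>l. X l \<omega>) g) \<partial>M)"
proof (rule indep_var_lebesgue_integral)
  have "indep_var borel ((\<lambda>r. \<phi> (r n)) \<circ> (\<lambda>\<omega>. restrict (\<lambda>l. X l \<omega>) {n}))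
     borel ((\<lambda>r. \<psi> (cip n r f, cip n r g)) \<circ> (\<lambda>\<omega>. restrict (\<lambda>l. X l \<omega>) {..<n}))"
  proof (rule indep_var_compose[OF indep_var_restrict[OF indep]])
    have 1: "(\<lambda>r. r n) \<in> borel_measurable (PiM {n} (\<lambda>_. borel :: complex measure))"
      by measurable
    show "(\<lambda>r. \<phi> (r n)) \<in> borel_measurable (PiM {n} (\<lambda>_. borel))"
      using measurable_compose[OF 1 \<phi>] by simp
    have 2: "(\<lambda>r. (cip n r f, cip n r g)) \<in> borel_measurable (PiM {..<n} (\<lambda>_. borel :: complex measure))"
      unfolding cip_def by measurable
    show "(\<lambda>r. \<psi> (cip n r f, cip n r g)) \<in> borel_measurable (PiM {..<n} (\<lambda>_. borel))"
      using measurable_compose[OF 2 \<psi>] by simp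
  qed (use n in auto)
  then show "indep_var borel (\<lambda>\<omega>. \<phi> (X n \<omega>)) borel (\<lambda>\<omega>. \<psi> (cip n (\<lambda>l. X l \<omega>) f, cip n (\<lambda>l. X l \<omega>) g))"
    by (simp add: comp_def cip_def)
qed (use 1 2 in \<open>auto intro: all_moments_integrable\<close>)

lemma expectation_ip_zero:
  assumes "n \<le> d"
  shows "(\<integral>\<omega>. cip n (\<lambda>l. X l \<omega>) f \<partial>M) = 0"
proof -
  have "(\<integral>\<omega>. cip n (\<lambda>l. X l \<omega>) f \<partial>M) = (\<Sum>l<n. \<integral>\<omega>. cnj (X l \<omega>) * f l \<partial>M)"
    unfolding cip_def using assms
    by (intro Bochner_Integration.integral_sum all_moments_integrable all_moments_intros entry_moments) auto
  also have "\<dots> = (\<Sum>l<n. 0)"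
  proof (rule sum.cong[OF refl])
    fix l assume "l \<in> {..<n}"
    then have l: "l < d" using assms by auto
    have "(\<integral>\<omega>. cnj (X l \<omega>) \<partial>M) = cnj (\<integral>\<omega>. X l \<omega> \<partial>M)"
      by (rule Bochner_Integration.integral_cnj)
    then show "(\<integral>\<omega>. cnj (X l \<omega>) * f l \<partial>M) = 0"
      using entry[OF l] by (simp add: standard_entry_def)
  qed
  finally show ?thesis by simp
qed

lemma expectation_cnj_ip_ip:
  assumes "n \<le> d"
  shows "(\<integral>\<omega>. cnj (cip n (\<lambda>l. X l \<omega>) f) * cip n (\<lambda>l. X l \<omega>) g \<partial>M) = cip n f g"
  using assms
proof (induction n)
  case 0
  then show ?case by (simp add: cip_def)
next
  case (Suc n)
  then have n: "n < d" "n \<le> d" by auto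
  define U where "U \<omega> = cip n (\<lambda>l. X l \<omega>) f" for \<omega>
  define V where "V \<omega> = cip n (\<lambda>l. X l \<omega>) g" for \<omega>
  have mom: "all_moments M U" "all_moments M V" "all_moments M (X n)"
    using n entry_moments ip_moments by (auto simp: U_def[abs_def] V_def[abs_def])
  have e: "(\<integral>\<omega>. X n \<omega> \<partial>M) = 0" "(\<integral>\<omega>. complex_of_real ((cmod (X n \<omega>))\<^sup>2) \<partial>M) = 1"
    using entry[OF n(1)] by (auto simp: standard_entry_def integral_complex_of_real simp del: of_real_power)
  have proj: "fst \<in> borel_measurable (borel :: (complex \<times> complex) measure)"
    "snd \<in> borel_measurable (borel :: (complex \<times> complex) measure)"
    by (intro borel_measurable_continuous_onI continuous_intros)+
  have 1: "(\<integral>\<omega>. X n \<omega> * V \<omega> \<partial>M) = 0"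
    using expectation_split[OF n(1), where \<phi>="\<lambda>a. a" and \<psi>="snd" and f=f and g=g] mom e proj ip_moments[OF n(2)]
    by (simp add: V_def)
  have 2: "(\<integral>\<omega>. cnj (X n \<omega>) * cnj (U \<omega>) \<partial>M) = 0"
  proof -
    have "(\<integral>\<omega>. X n \<omega> * U \<omega> \<partial>M) = 0"
      using expectation_split[OF n(1), where \<phi>="\<lambda>a. a" and \<psi>="fst" and f=f and g=g] mom e proj ip_moments[OF n(2)]
      by (simp add: U_def)
    then show ?thesis
      using Bochner_Integration.integral_cnj[of M "\<lambda>\<omega>. X n \<omega> * U \<omega>"] by simp
  qed
  have int: "integrable M (\<lambda>\<omega>. cnj (U \<omega>) * V \<omega>)" "integrable M (\<lambda>\<omega>. X n \<omega> * V \<omega>)"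
    "integrable M (\<lambda>\<omega>. cnj (X n \<omega>) * cnj (U \<omega>))"
    "integrable M (\<lambda>\<omega>. complex_of_real ((cmod (X n \<omega>))\<^sup>2))"
    by (intro all_moments_integrable all_moments_intros mom)+
  have "(\<integral>\<omega>. cnj (cip (Suc n) (\<lambda>l. X l \<omega>) f) * cip (Suc n) (\<lambda>l. X l \<omega>) g \<partial>M)
     = (\<integral>\<omega>. cnj (U \<omega>) * V \<omega> + cnj (f n) * (X n \<omega> * V \<omega>) + g n * (cnj (X n \<omega>) * cnj (U \<omega>))
          + cnj (f n) * g n * complex_of_real ((cmod (X n \<omega>))\<^sup>2) \<partial>M)"
    by (intro Bochner_Integration.integral_cong refl)
       (simp add: cip_Suc U_def V_def complex_norm_square algebra_simps del: of_real_power)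
  also have "\<dots> = (\<integral>\<omega>. cnj (U \<omega>) * V \<omega> \<partial>M) + cnj (f n) * (\<integral>\<omega>. X n \<omega> * V \<omega> \<partial>M)
          + g n * (\<integral>\<omega>. cnj (X n \<omega>) * cnj (U \<omega>) \<partial>M)
          + cnj (f n) * g n * (\<integral>\<omega>. complex_of_real ((cmod (X n \<omega>))\<^sup>2) \<partial>M)"
    by (simp add: Bochner_Integration.integral_add int del: of_real_power)
  also have "\<dots> = cip (Suc n) f g"
    using Suc.IH n(2) e 1 2 by (simp add: U_def V_def cip_Suc)
  finally show ?case .
qed

end

text \<open>
  For a centred \<open>q\<close> the linear term disappears under the expectation, so that the moment generating
  function is bounded by the expectation of \<open>exp (q\<^sup>2)\<close>.
\<close>
lemma exp_le_add_exp_square: "exp x \<le> x + exp (x\<^sup>2)" for x :: real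
proof -
  have sq: "1 + x\<^sup>2 \<le> exp (x\<^sup>2)"
    using exp_ge_add_one_self[of "x\<^sup>2"] by simp
  consider "x \<le> - 1" | "- 1 < x" "x < 0" | "0 \<le> x" "x \<le> 1" | "1 < x" by linarith
  then show ?thesis
  proof cases
    case 1
    then have "0 \<le> x * (x + 1)" by (simp add: mult_nonpos_nonpos)
    then have "0 \<le> x\<^sup>2 + x" by (simp add: power2_eq_square algebra_simps)
    moreover have "exp x \<le> 1" using 1 by simp
    ultimately show ?thesis using sq by linarith
  next
    case 2
    have "exp x = 1 / exp (- x)" by (simp add: exp_minus field_simps)
    also have "\<dots> \<le> 1 / (1 + (- x))"
      using 2 by (intro divide_left_mono) (auto simp: add.commute[of 1] intro!: order.trans[OF _ exp_ge_add_one_self])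
    also have "\<dots> \<le> 1 + x + x\<^sup>2"
    proof -
      have "x ^ 3 \<le> 0" using 2 by (simp add: power_less_zero_eq)
      then show ?thesis using 2 by (simp add: divide_le_eq power2_eq_square power3_eq_cube algebra_simps)
    qed
    finally show ?thesis using sq by linarith
  next
    case 3
    then have "exp x \<le> 1 + x + x\<^sup>2" by (rule exp_bound)
    then show ?thesis using sq by linarith
  next
    case 4
    then have "x \<le> x\<^sup>2" by (simp add: power2_eq_square)
    then have "exp x \<le> exp (x\<^sup>2)" by simp
    then show ?thesis using 4 by linarith
  qed
qed

text \<open>
  Off the event \<open>G = {c \<le> Y\<^sup>2}\<close> the variable \<open>Y\<^sup>2\<close> contributes at most \<open>c\<close> to its expectation. On \<open>G\<close> it is
  split by the inequality between the arithmetic and the geometric mean, with the weights for which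
  the part with \<open>Y\<^sup>4\<close> contributes at most \<open>c / 2\<close>; the remaining \<open>c / 2\<close> must come from the probability
  of \<open>G\<close>.
\<close>
lemma (in prob_space) paley_zygmund_fourth_moment:
  fixes Y :: "'a \<Rightarrow> real"
  assumes Y: "all_moments M Y"
    and c: "0 < c" "2 * c \<le> (\<integral>\<omega>. (Y \<omega>)\<^sup>2 \<partial>M)" and K: "0 < K" "(\<integral>\<omega>. Y \<omega> ^ 4 \<partial>M) \<le> K"
  shows "c\<^sup>2 / K \<le> prob {\<omega> \<in> space M. c \<le> (Y \<omega>)\<^sup>2}"
proof -
  note [measurable] = all_moments_measurable[OF Y]
  define G where "G = {\<omega> \<in> space M. c \<le> (Y \<omega>)\<^sup>2}"
  have G[measurable]: "G \<in> sets M" unfolding G_def by measurable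
  have int: "integrable M (\<lambda>\<omega>. (Y \<omega>)\<^sup>2)" "integrable M (\<lambda>\<omega>. Y \<omega> ^ 4)"
    by (intro all_moments_integrable all_moments_power Y)+
  have "(\<integral>\<omega>. (Y \<omega>)\<^sup>2 \<partial>M) \<le> (\<integral>\<omega>. c + (c / (2 * K)) * Y \<omega> ^ 4 + (K / (2 * c)) * indicator G \<omega> \<partial>M)"
  proof (rule integral_mono)
    fix \<omega> assume \<omega>: "\<omega> \<in> space M"
    show "(Y \<omega>)\<^sup>2 \<le> c + (c / (2 * K)) * Y \<omega> ^ 4 + (K / (2 * c)) * indicator G \<omega>"
    proof (cases "\<omega> \<in> G")
      case True
      have "0 \<le> (c * (Y \<omega>)\<^sup>2 - K)\<^sup>2" by simp
      also have "\<dots> = c\<^sup>2 * Y \<omega> ^ 4 - 2 * c * K * (Y \<omega>)\<^sup>2 + K\<^sup>2"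
        by (simp add: power2_eq_square power4_eq_xxxx algebra_simps)
      finally have "(Y \<omega>)\<^sup>2 * (2 * c * K) \<le> c\<^sup>2 * Y \<omega> ^ 4 + K\<^sup>2" by (simp add: algebra_simps)
      then have "(Y \<omega>)\<^sup>2 \<le> (c\<^sup>2 * Y \<omega> ^ 4 + K\<^sup>2) / (2 * c * K)"
        using c(1) K(1) by (simp add: pos_le_divide_eq)
      also have "\<dots> = (c / (2 * K)) * Y \<omega> ^ 4 + K / (2 * c)"
        using c(1) K(1) by (simp add: power2_eq_square field_simps)
      finally show ?thesis using True c(1) by simp
    next
      case False
      have "0 \<le> (c / (2 * K)) * Y \<omega> ^ 4" using c K by simp
      moreover have "(Y \<omega>)\<^sup>2 \<le> c" using False \<omega> by (simp add: G_def)
      ultimately show ?thesis using False by simp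
    qed
  next
    show "integrable M (\<lambda>\<omega>. c + (c / (2 * K)) * Y \<omega> ^ 4 + (K / (2 * c)) * indicator G \<omega>)"
      by (intro Bochner_Integration.integrable_add Bochner_Integration.integrable_mult_right
          integrable_const int integrable_real_indicator) (auto simp: emeasure_eq_measure)
  qed (rule int)
  also have "\<dots> = c + (c / (2 * K)) * (\<integral>\<omega>. Y \<omega> ^ 4 \<partial>M) + (K / (2 * c)) * prob G"
  proof -
    have "integrable M (indicat_real G)"
      by (intro integrable_real_indicator) (auto simp: emeasure_eq_measure)
    then show ?thesis
      using int by (simp add: Bochner_Integration.integral_add prob_space)
  qed
  also have "\<dots> \<le> c + (c / (2 * K)) * K + (K / (2 * c)) * prob G"
    using c K by (intro add_mono mult_left_mono) auto
  finally have "2 * c \<le> c + (c / (2 * K)) * K + (K / (2 * c)) * prob G"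
    using c(2) by linarith
  then have "c / 2 \<le> (K / (2 * c)) * prob G"
    using c K by simp
  then have "(2 * c / K) * (c / 2) \<le> (2 * c / K) * ((K / (2 * c)) * prob G)"
    using c K by (intro mult_left_mono) auto
  then show ?thesis
    using c K by (simp add: G_def power2_eq_square)
qed

lemma cmod_cip_le:
  "(cmod (cip n f g))\<^sup>2 \<le> (\<Sum>l<n. (cmod (f l))\<^sup>2) * (\<Sum>l<n. (cmod (g l))\<^sup>2)"
proof -
  have "cmod (cip n f g) \<le> (\<Sum>l<n. \<bar>cmod (f l)\<bar> * \<bar>cmod (g l)\<bar>)"
    unfolding cip_def by (rule order.trans[OF norm_sum]) (simp add: norm_mult)
  also have "\<dots> \<le> L2_set (\<lambda>l. cmod (f l)) {..<n} * L2_set (\<lambda>l. cmod (g l)) {..<n}"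
    by (rule L2_set_mult_ineq)
  finally have "(cmod (cip n f g))\<^sup>2 \<le> (L2_set (\<lambda>l. cmod (f l)) {..<n} * L2_set (\<lambda>l. cmod (g l)) {..<n})\<^sup>2"
    by (intro power_mono) auto
  then show ?thesis
    by (simp add: power_mult_distrib L2_set_def sum_nonneg)
qed

context standard_row
begin

lemma expectation_cmod_ip_sq:
  assumes "n \<le> d"
  shows "(\<integral>\<omega>. (cmod (cip n (\<lambda>l. X l \<omega>) f))\<^sup>2 \<partial>M) = (\<Sum>l<n. (cmod (f l))\<^sup>2)"
proof -
  have "complex_of_real (\<integral>\<omega>. (cmod (cip n (\<lambda>l. X l \<omega>) f))\<^sup>2 \<partial>M)
      = (\<integral>\<omega>. cnj (cip n (\<lambda>l. X l \<omega>) f) * cip n (\<lambda>l. X l \<omega>) f \<partial>M)"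
    unfolding integral_complex_of_real[symmetric]
    by (intro Bochner_Integration.integral_cong refl) (simp only: complex_norm_square mult.commute)
  also have "\<dots> = cip n f f"
    by (rule expectation_cnj_ip_ip[OF assms])
  also have "\<dots> = complex_of_real (\<Sum>l<n. (cmod (f l))\<^sup>2)"
    unfolding cip_def of_real_sum
    by (intro sum.cong refl) (simp only: complex_norm_square mult.commute)
  finally show ?thesis by (simp only: of_real_eq_iff)
qed

text \<open>
  The right-hand side is \<open>\<parallel>X\<parallel>\<^sub>F\<^sup>2 + (tr X)\<^sup>2 + (\<gamma> - 2) \<Sum>\<^sub>l X\<^sub>l\<^sub>l\<^sup>2\<close> for the Hermitian matrix \<open>X = (f g* + g f*) / 2\<close>.
  Adding the coordinate \<open>n\<close> with entry \<open>a\<close> changes the quadratic form \<open>Y\<close> to \<open>Y + Re (a W) + |a|\<^sup>2 r\<close>, where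
  \<open>W\<close> is linear in the inner products over the earlier coordinates and independent of \<open>a\<close>. Since \<open>a\<close>, \<open>a\<^sup>2\<close> and
  \<open>W\<close> have mean zero, of the mixed terms only \<open>E |W|\<^sup>2 / 2\<close> and \<open>2 r E Y\<close> survive.
\<close>
lemma expectation_Re_cnj_ip_ip_sq:
  assumes "n \<le> d"
  shows "(\<integral>\<omega>. (Re (cnj (cip n (\<lambda>l. X l \<omega>) f) * cip n (\<lambda>l. X l \<omega>) g))\<^sup>2 \<partial>M) =
    1 / 2 * ((\<Sum>l<n. (cmod (f l))\<^sup>2) * (\<Sum>l<n. (cmod (g l))\<^sup>2) + Re ((cip n f g)\<^sup>2))
    + (Re (cip n f g))\<^sup>2 + (\<gamma> - 2) * (\<Sum>l<n. (Re (cnj (f l) * g l))\<^sup>2)"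
  using assms
proof (induction n)
  case 0
  then show ?case by (simp add: cip_def)
next
  case (Suc n)
  then have n: "n < d" "n \<le> d" by auto
  define U where "U \<omega> = cip n (\<lambda>l. X l \<omega>) f" for \<omega>
  define V where "V \<omega> = cip n (\<lambda>l. X l \<omega>) g" for \<omega>
  define W where "W \<omega> = cnj (f n) * V \<omega> + cnj (g n) * U \<omega>" for \<omega>
  define Y where "Y \<omega> = Re (cnj (U \<omega>) * V \<omega>)" for \<omega>
  define a where "a = X n"
  define r where "r = Re (cnj (f n) * g n)"
  define F where "F = (\<Sum>l<n. (cmod (f l))\<^sup>2)"
  define G where "G = (\<Sum>l<n. (cmod (g l))\<^sup>2)"
  define R where "R = (\<Sum>l<n. (Re (cnj (f l) * g l))\<^sup>2)"
  define S where "S = cip n f g"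
  have UV: "all_moments M U" "all_moments M V" and a: "all_moments M a"
    using n entry_moments ip_moments by (auto simp: U_def[abs_def] V_def[abs_def] a_def)
  have W: "all_moments M W"
    unfolding W_def[abs_def] by (intro all_moments_intros UV)
  have Y: "all_moments M Y"
    unfolding Y_def[abs_def] by (intro all_moments_intros UV)
  have e: "(\<integral>\<omega>. a \<omega> \<partial>M) = 0" "(\<integral>\<omega>. (a \<omega>)\<^sup>2 \<partial>M) = 0" "(\<integral>\<omega>. (cmod (a \<omega>))\<^sup>2 \<partial>M) = 1"
    "(\<integral>\<omega>. cmod (a \<omega>) ^ 4 \<partial>M) = \<gamma>"
    using entry[OF n(1)] by (auto simp: standard_entry_def a_def)
  define w where "w p = cnj (f n) * snd p + cnj (g n) * fst p" for p :: "complex \<times> complex"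
  define y where "y p = Re (cnj (fst p) * snd p)" for p :: "complex \<times> complex"
  have w: "w (U \<omega>, V \<omega>) = W \<omega>" and y: "y (U \<omega>, V \<omega>) = Y \<omega>" for \<omega>
    by (simp_all add: w_def W_def y_def Y_def)
  have cont: "continuous_on UNIV w" "continuous_on UNIV y"
    unfolding w_def y_def by (intro continuous_intros)+
  have split: "(\<integral>\<omega>. \<phi> (a \<omega>) * \<psi> (U \<omega>, V \<omega>) \<partial>M) = (\<integral>\<omega>. \<phi> (a \<omega>) \<partial>M) * (\<integral>\<omega>. \<psi> (U \<omega>, V \<omega>) \<partial>M)"
    if "continuous_on UNIV \<phi>" "continuous_on UNIV \<psi>"
      "all_moments M (\<lambda>\<omega>. \<phi> (a \<omega>))" "all_moments M (\<lambda>\<omega>. \<psi> (U \<omega>, V \<omega>))"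
    for \<phi> :: "complex \<Rightarrow> 'c::{real_normed_field, banach, second_countable_topology}" and \<psi>
    using expectation_split[OF n(1) borel_measurable_continuous_onI borel_measurable_continuous_onI, of \<phi> \<psi> f g] that
    by (simp add: U_def V_def a_def)
  have e2: "(\<integral>\<omega>. (cmod (a \<omega>))\<^sup>2 * (cmod (W \<omega>))\<^sup>2 \<partial>M) = (\<integral>\<omega>. (cmod (W \<omega>))\<^sup>2 \<partial>M)"
    using split[of "\<lambda>a. (cmod a)\<^sup>2" "\<lambda>p. (cmod (w p))\<^sup>2"] e unfolding w
    by (simp add: continuous_intros cont all_moments_intros a W)
  have e3: "(\<integral>\<omega>. (a \<omega>)\<^sup>2 * (W \<omega>)\<^sup>2 \<partial>M) = 0"
    using split[of "\<lambda>a. a\<^sup>2" "\<lambda>p. (w p)\<^sup>2"] e unfolding w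
    by (simp add: continuous_intros cont all_moments_intros a W)
  have e5: "(\<integral>\<omega>. a \<omega> * (complex_of_real (Y \<omega>) * W \<omega>) \<partial>M) = 0"
    using split[of "\<lambda>a. a" "\<lambda>p. complex_of_real (y p) * w p"] e unfolding w y
    by (simp add: continuous_intros cont all_moments_intros a W Y)
  have e6: "(\<integral>\<omega>. (cmod (a \<omega>))\<^sup>2 * Y \<omega> \<partial>M) = (\<integral>\<omega>. Y \<omega> \<partial>M)"
    using split[of "\<lambda>a. (cmod a)\<^sup>2" y] e unfolding y
    by (simp add: continuous_intros cont all_moments_intros a Y)
  have EW: "(\<integral>\<omega>. W \<omega> \<partial>M) = 0"
  proof -
    have "(\<integral>\<omega>. U \<omega> \<partial>M) = 0" "(\<integral>\<omega>. V \<omega> \<partial>M) = 0"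
      using expectation_ip_zero[OF n(2)] by (simp_all add: U_def V_def)
    then show ?thesis
      unfolding W_def using all_moments_integrable[OF UV(1)] all_moments_integrable[OF UV(2)]
      by (simp add: Bochner_Integration.integral_add)
  qed
  have e7: "(\<integral>\<omega>. (complex_of_real ((cmod (a \<omega>))\<^sup>2) * a \<omega>) * W \<omega> \<partial>M) = 0"
    using split[of "\<lambda>a. complex_of_real ((cmod a)\<^sup>2) * a" w] EW unfolding w
    by (simp add: continuous_intros cont all_moments_intros a W del: of_real_power)
  have intUV: "integrable M (\<lambda>\<omega>. cnj (U \<omega>) * V \<omega>)" "integrable M (\<lambda>\<omega>. (cmod (U \<omega>))\<^sup>2)"
    "integrable M (\<lambda>\<omega>. (cmod (V \<omega>))\<^sup>2)"
    by (intro all_moments_integrable all_moments_intros UV)+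
  have EUV: "(\<integral>\<omega>. cnj (U \<omega>) * V \<omega> \<partial>M) = S"
    using expectation_cnj_ip_ip[OF n(2)] by (simp add: U_def V_def S_def)
  have EY: "(\<integral>\<omega>. Y \<omega> \<partial>M) = Re S"
    unfolding Y_def integral_Re[OF intUV(1)] EUV ..
  have "(cmod (W \<omega>))\<^sup>2 = (cmod (f n))\<^sup>2 * (cmod (V \<omega>))\<^sup>2 + (cmod (g n))\<^sup>2 * (cmod (U \<omega>))\<^sup>2
      + 2 * Re ((cnj (f n) * g n) * (cnj (U \<omega>) * V \<omega>))" for \<omega>
    unfolding W_def cmod_power2 by (simp add: power2_eq_square algebra_simps)
  then have "(\<integral>\<omega>. (cmod (W \<omega>))\<^sup>2 \<partial>M)
      = (\<integral>\<omega>. (cmod (f n))\<^sup>2 * (cmod (V \<omega>))\<^sup>2 + (cmod (g n))\<^sup>2 * (cmod (U \<omega>))\<^sup>2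
      + 2 * Re ((cnj (f n) * g n) * (cnj (U \<omega>) * V \<omega>)) \<partial>M)"
    by (simp only:)
  also have "\<dots> = (cmod (f n))\<^sup>2 * (\<integral>\<omega>. (cmod (V \<omega>))\<^sup>2 \<partial>M) + (cmod (g n))\<^sup>2 * (\<integral>\<omega>. (cmod (U \<omega>))\<^sup>2 \<partial>M)
      + 2 * Re ((cnj (f n) * g n) * (\<integral>\<omega>. cnj (U \<omega>) * V \<omega> \<partial>M))"
  proof -
    have int: "integrable M (\<lambda>\<omega>. (cnj (f n) * g n) * (cnj (U \<omega>) * V \<omega>))"
      using intUV(1) by (rule Bochner_Integration.integrable_mult_right)
    have Re: "Re ((cnj (f n) * g n) * (\<integral>\<omega>. cnj (U \<omega>) * V \<omega> \<partial>M))
        = (\<integral>\<omega>. Re ((cnj (f n) * g n) * (cnj (U \<omega>) * V \<omega>)) \<partial>M)"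
      by (simp only: integral_Re[OF int] Bochner_Integration.integral_mult_right_zero)
    show ?thesis
      unfolding Re
      using intUV int
      by (simp only: Bochner_Integration.integral_add Bochner_Integration.integrable_add
          Bochner_Integration.integral_mult_right_zero Bochner_Integration.integrable_mult_right integrable_Re)
  qed
  finally have EWW: "(\<integral>\<omega>. (cmod (W \<omega>))\<^sup>2 \<partial>M)
      = (cmod (f n))\<^sup>2 * G + (cmod (g n))\<^sup>2 * F + 2 * Re ((cnj (f n) * g n) * S)"
    using expectation_cmod_ip_sq[OF n(2), of f] expectation_cmod_ip_sq[OF n(2), of g]
    by (simp only: EUV flip: U_def V_def F_def G_def)
  have Y': "Re (cnj (cip (Suc n) (\<lambda>l. X l \<omega>) f) * cip (Suc n) (\<lambda>l. X l \<omega>) g)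
      = Y \<omega> + Re (a \<omega> * W \<omega>) + (cmod (a \<omega>))\<^sup>2 * r" for \<omega>
    unfolding Y_def W_def r_def cip_Suc U_def V_def a_def cmod_power2
    by (simp add: power2_eq_square algebra_simps)
  have Re_sq: "(Re z)\<^sup>2 = 1 / 2 * ((cmod z)\<^sup>2 + Re (z\<^sup>2))" for z
    by (simp add: cmod_power2 Re_power2)
  have "(Re (cnj (cip (Suc n) (\<lambda>l. X l \<omega>) f) * cip (Suc n) (\<lambda>l. X l \<omega>) g))\<^sup>2
      = (Y \<omega>)\<^sup>2 + 1 / 2 * ((cmod (a \<omega>))\<^sup>2 * (cmod (W \<omega>))\<^sup>2) + 1 / 2 * Re ((a \<omega>)\<^sup>2 * (W \<omega>)\<^sup>2)
        + r\<^sup>2 * cmod (a \<omega>) ^ 4 + 2 * Re (a \<omega> * (complex_of_real (Y \<omega>) * W \<omega>))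
        + 2 * r * ((cmod (a \<omega>))\<^sup>2 * Y \<omega>)
        + 2 * r * Re ((complex_of_real ((cmod (a \<omega>))\<^sup>2) * a \<omega>) * W \<omega>)" for \<omega>
  proof -
    have 1: "(Y \<omega> + q + s * r)\<^sup>2 = (Y \<omega>)\<^sup>2 + q\<^sup>2 + r\<^sup>2 * s\<^sup>2 + 2 * (Y \<omega> * q) + 2 * r * (s * Y \<omega>) + 2 * r * (s * q)" for q s
      by (simp add: power2_eq_square algebra_simps)
    have 2: "(Re (a \<omega> * W \<omega>))\<^sup>2 = 1 / 2 * ((cmod (a \<omega>))\<^sup>2 * (cmod (W \<omega>))\<^sup>2) + 1 / 2 * Re ((a \<omega>)\<^sup>2 * (W \<omega>)\<^sup>2)"
      unfolding Re_sq[of "a \<omega> * W \<omega>"] norm_mult power_mult_distrib by (simp only: distrib_left)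
    have 3: "Re (a \<omega> * (complex_of_real (Y \<omega>) * W \<omega>)) = Y \<omega> * Re (a \<omega> * W \<omega>)"
      by (simp add: algebra_simps)
    have 4: "Re ((complex_of_real s * a \<omega>) * W \<omega>) = s * Re (a \<omega> * W \<omega>)" for s
      by (simp add: algebra_simps)
    have 5: "((cmod (a \<omega>))\<^sup>2)\<^sup>2 = cmod (a \<omega>) ^ 4" by simp
    show ?thesis unfolding Y' 1 2 3 4 5 by simp
  qed
  then have "(\<integral>\<omega>. (Re (cnj (cip (Suc n) (\<lambda>l. X l \<omega>) f) * cip (Suc n) (\<lambda>l. X l \<omega>) g))\<^sup>2 \<partial>M)
      = (\<integral>\<omega>. (Y \<omega>)\<^sup>2 + 1 / 2 * ((cmod (a \<omega>))\<^sup>2 * (cmod (W \<omega>))\<^sup>2) + 1 / 2 * Re ((a \<omega>)\<^sup>2 * (W \<omega>)\<^sup>2)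
        + r\<^sup>2 * cmod (a \<omega>) ^ 4 + 2 * Re (a \<omega> * (complex_of_real (Y \<omega>) * W \<omega>))
        + 2 * r * ((cmod (a \<omega>))\<^sup>2 * Y \<omega>)
        + 2 * r * Re ((complex_of_real ((cmod (a \<omega>))\<^sup>2) * a \<omega>) * W \<omega>) \<partial>M)"
    by simp
  also have "\<dots> = (\<integral>\<omega>. (Y \<omega>)\<^sup>2 \<partial>M) + 1 / 2 * (\<integral>\<omega>. (cmod (a \<omega>))\<^sup>2 * (cmod (W \<omega>))\<^sup>2 \<partial>M)
        + 1 / 2 * Re (\<integral>\<omega>. (a \<omega>)\<^sup>2 * (W \<omega>)\<^sup>2 \<partial>M)
        + r\<^sup>2 * (\<integral>\<omega>. cmod (a \<omega>) ^ 4 \<partial>M) + 2 * Re (\<integral>\<omega>. a \<omega> * (complex_of_real (Y \<omega>) * W \<omega>) \<partial>M)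
        + 2 * r * (\<integral>\<omega>. (cmod (a \<omega>))\<^sup>2 * Y \<omega> \<partial>M)
        + 2 * r * Re (\<integral>\<omega>. (complex_of_real ((cmod (a \<omega>))\<^sup>2) * a \<omega>) * W \<omega> \<partial>M)"
  proof -
    have int: "integrable M (\<lambda>\<omega>. (Y \<omega>)\<^sup>2)" "integrable M (\<lambda>\<omega>. (cmod (a \<omega>))\<^sup>2 * (cmod (W \<omega>))\<^sup>2)"
      "integrable M (\<lambda>\<omega>. (a \<omega>)\<^sup>2 * (W \<omega>)\<^sup>2)" "integrable M (\<lambda>\<omega>. cmod (a \<omega>) ^ 4)"
      "integrable M (\<lambda>\<omega>. a \<omega> * (complex_of_real (Y \<omega>) * W \<omega>))"
      "integrable M (\<lambda>\<omega>. (cmod (a \<omega>))\<^sup>2 * Y \<omega>)"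
      "integrable M (\<lambda>\<omega>. (complex_of_real ((cmod (a \<omega>))\<^sup>2) * a \<omega>) * W \<omega>)"
      by (intro all_moments_integrable all_moments_intros Y W a)+
    show ?thesis
      unfolding integral_Re[OF int(3), symmetric] integral_Re[OF int(5), symmetric] integral_Re[OF int(7), symmetric]
      using int
      by (simp only: Bochner_Integration.integral_add Bochner_Integration.integrable_add
          Bochner_Integration.integral_mult_right_zero Bochner_Integration.integrable_mult_right integrable_Re)
  qed
  also have "\<dots> = (1 / 2 * (F * G + Re (S\<^sup>2)) + (Re S)\<^sup>2 + (\<gamma> - 2) * R)
      + 1 / 2 * ((cmod (f n))\<^sup>2 * G + (cmod (g n))\<^sup>2 * F + 2 * Re ((cnj (f n) * g n) * S)) + \<gamma> * r\<^sup>2 + 2 * r * Re S"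
    unfolding e2 e3 e5 e6 e7 e(4) EWW EY using Suc.IH[OF n(2)]
    by (simp add: Y_def U_def V_def F_def G_def S_def R_def)
  also have "\<dots> = 1 / 2 * ((F + (cmod (f n))\<^sup>2) * (G + (cmod (g n))\<^sup>2) + Re ((S + cnj (f n) * g n)\<^sup>2))
      + (Re (S + cnj (f n) * g n))\<^sup>2 + (\<gamma> - 2) * (R + r\<^sup>2)"
    unfolding r_def cmod_power2 Re_power2 by (simp add: power2_eq_square field_simps)
  finally show ?case
    by (simp add: cip_Suc F_def G_def R_def S_def r_def)
qed

text \<open>
  The diagonal of \<open>X\<close> has no larger Frobenius norm than \<open>X\<close>, so for \<open>\<gamma> < 2\<close> the negative term costs at
  most the fraction \<open>2 - \<gamma>\<close> of \<open>\<parallel>X\<parallel>\<^sub>F\<^sup>2\<close>. The imaginary part of \<open>\<langle>f, g\<rangle>\<close> has to be subtracted: for \<open>g = i f\<close>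
  the variable is identically zero.
\<close>
lemma expectation_Re_cnj_ip_ip_sq_ge:
  assumes "\<gamma> > 1"
  shows "min 1 (\<gamma> - 1) / 2 * ((\<Sum>l<d. (cmod (f l))\<^sup>2) * (\<Sum>l<d. (cmod (g l))\<^sup>2) - (Im (cip d f g))\<^sup>2)
    \<le> (\<integral>\<omega>. (Re (cnj (cip d (\<lambda>l. X l \<omega>) f) * cip d (\<lambda>l. X l \<omega>) g))\<^sup>2 \<partial>M)"
proof -
  define F where "F n = (\<Sum>l<n. (cmod (f l))\<^sup>2)" for n
  define G where "G n = (\<Sum>l<n. (cmod (g l))\<^sup>2)" for n
  define S where "S n = cip n f g" for n
  define R where "R n = (\<Sum>l<n. (Re (cnj (f l) * g l))\<^sup>2)" for n
  define H where "H n = 1 / 2 * (F n * G n + Re ((S n)\<^sup>2))" for n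
  have R_le: "R n \<le> H n" for n
  proof (induction n)
    case 0
    then show ?case by (simp add: R_def H_def F_def S_def cip_def)
  next
    case (Suc n)
    define z where "z = cnj (f n) * g n"
    have "\<bar>Re (z * S n)\<bar> \<le> cmod z * cmod (S n)"
      using abs_Re_le_cmod[of "z * S n"] by (simp add: norm_mult)
    also have "\<dots> \<le> cmod z * sqrt (F n * G n)"
      using cmod_cip_le[of n f g] by (intro mult_left_mono real_le_rsqrt) (auto simp: F_def G_def S_def)
    also have "\<dots> = (cmod (f n) * sqrt (G n)) * (cmod (g n) * sqrt (F n))"
      by (simp add: z_def norm_mult real_sqrt_mult)
    also have "\<dots> \<le> 1 / 2 * ((cmod (f n) * sqrt (G n))\<^sup>2 + (cmod (g n) * sqrt (F n))\<^sup>2)"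
      using sum_squares_bound[of "cmod (f n) * sqrt (G n)" "cmod (g n) * sqrt (F n)"] by simp
    also have "\<dots> = 1 / 2 * ((cmod (f n))\<^sup>2 * G n + (cmod (g n))\<^sup>2 * F n)"
      by (simp add: power_mult_distrib F_def G_def sum_nonneg)
    finally have cross: "0 \<le> 1 / 2 * ((cmod (f n))\<^sup>2 * G n + (cmod (g n))\<^sup>2 * F n) + Re (z * S n)"
      by linarith
    have "H (Suc n) = 1 / 2 * ((F n + (cmod (f n))\<^sup>2) * (G n + (cmod (g n))\<^sup>2) + Re ((S n + z)\<^sup>2))"
      by (simp add: H_def F_def G_def S_def cip_Suc z_def)
    also have "\<dots> = H n + (1 / 2 * ((cmod (f n))\<^sup>2 * G n + (cmod (g n))\<^sup>2 * F n) + Re (z * S n)) + (Re z)\<^sup>2"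
      unfolding H_def z_def cmod_power2 Re_power2 by (simp add: power2_eq_square field_simps)
    also have "\<dots> \<ge> R n + (Re z)\<^sup>2" using Suc cross by linarith
    also have "R n + (Re z)\<^sup>2 = R (Suc n)" by (simp add: R_def z_def)
    finally show ?case .
  qed
  have R0: "0 \<le> R d" by (simp add: R_def sum_nonneg)
  define m where "m = min 1 (\<gamma> - 1)"
  have "m * H d \<le> H d + (\<gamma> - 2) * R d"
  proof (cases "\<gamma> \<ge> 2")
    case True
    then show ?thesis using R0 by (simp add: m_def)
  next
    case False
    then have "(2 - \<gamma>) * R d \<le> (2 - \<gamma>) * H d"
      using R_le by (intro mult_left_mono) auto
    then show ?thesis using False by (simp add: m_def algebra_simps)
  qed
  moreover have "m * (1 / 2 * (F d * G d - (Im (S d))\<^sup>2)) \<le> m * H d"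
    unfolding H_def Re_power2 using assms by (intro mult_left_mono) (auto simp: m_def)
  moreover have "m / 2 * (F d * G d - (Im (S d))\<^sup>2) = m * (1 / 2 * (F d * G d - (Im (S d))\<^sup>2))"
    by simp
  ultimately have "m / 2 * (F d * G d - (Im (S d))\<^sup>2) \<le> H d + (Re (S d))\<^sup>2 + (\<gamma> - 2) * R d"
    using zero_le_power2[of "Re (S d)"] by linarith
  then show ?thesis
    unfolding expectation_Re_cnj_ip_ip_sq[OF order_refl] by (simp add: m_def H_def F_def G_def S_def R_def)
qed

end

lemma cmod_power8_le:
  "(cmod z) ^ 8 \<le> 8 * (Re z ^ 8 + Im z ^ 8)"
proof -
  have sq: "(a + b)\<^sup>2 \<le> 2 * (a\<^sup>2 + b\<^sup>2)" for a b :: real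
    using sum_squares_bound[of a b] by (simp add: power2_sum)
  have "(cmod z) ^ 8 = (((cmod z)\<^sup>2)\<^sup>2)\<^sup>2"
    by (simp flip: power_mult)
  also have "\<dots> \<le> (2 * ((Re z ^ 2)\<^sup>2 + (Im z ^ 2)\<^sup>2))\<^sup>2"
    unfolding cmod_power2 by (intro power_mono sq) auto
  also have "\<dots> = 4 * ((Re z ^ 2)\<^sup>2 + (Im z ^ 2)\<^sup>2)\<^sup>2"
    by (simp only: power_mult_distrib) simp
  also have "\<dots> \<le> 4 * (2 * (((Re z ^ 2)\<^sup>2)\<^sup>2 + ((Im z ^ 2)\<^sup>2)\<^sup>2))"
    by (intro mult_left_mono sq) auto
  also have "\<dots> = 8 * (Re z ^ 8 + Im z ^ 8)"
    by (simp flip: power_mult)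
  finally show ?thesis .
qed

lemma power8_le_exp: "x ^ 8 \<le> fact 8 * (exp x + exp (- x))" for x :: real
proof -
  have "x ^ 8 = \<bar>x\<bar> ^ 8" by (simp add: power_even_abs)
  also have "\<dots> \<le> fact 8 * exp \<bar>x\<bar>"
    using power_div_fact_le_exp[of "\<bar>x\<bar>" 8] by (simp add: divide_le_eq mult.commute del: fact_numeral)
  also have "\<dots> \<le> fact 8 * (exp x + exp (- x))"
    by (intro mult_left_mono) (auto simp: abs_if)
  finally show ?thesis .
qed

text \<open>
  The Chernoff bound for the eighth moment of \<open>\<langle>a, f\<rangle>\<close> with \<open>\<parallel>f\<parallel> \<le> 2\<close>: the four directions \<open>1, -1, i, -i\<close> of the
  moment generating function at distance \<open>sqrt (\<beta> / 4)\<close> from the origin.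
\<close>
definition moment8_bound :: "real \<Rightarrow> real" where
  "moment8_bound \<beta> = 32 * fact 8 * exp 1 * (4 / \<beta>) ^ 4"

context standard_row
begin

text \<open>
  With \<open>s = |z|\<^sup>2 / \<beta> \<le> 1\<close>, convexity of the exponential function gives
  \<open>exp (|z|\<^sup>2 |X|\<^sup>2) \<le> (1 - s) + s * exp (\<beta> |X|\<^sup>2)\<close>, whose expectation is at most \<open>1 + s\<close>.
\<close>
lemma entry_mgf:
  assumes l: "l < d" and z: "(cmod z)\<^sup>2 \<le> \<beta>"
  shows "integrable M (\<lambda>\<omega>. exp (Re (cnj (X l \<omega>) * z)))"
    and "(\<integral>\<omega>. exp (Re (cnj (X l \<omega>) * z)) \<partial>M) \<le> exp ((cmod z)\<^sup>2 / \<beta>)"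
proof -
  note [measurable] = entry_measurable[OF l]
  define s where "s = (cmod z)\<^sup>2 / \<beta>"
  have s: "0 \<le> s" "s \<le> 1" using z beta_pos by (auto simp: s_def)
  define q where "q \<omega> = Re (cnj (X l \<omega>) * z)" for \<omega>
  have [measurable]: "q \<in> borel_measurable M" unfolding q_def[abs_def] by measurable
  have int: "integrable M (\<lambda>\<omega>. exp (\<beta> * (cmod (X l \<omega>))\<^sup>2))"
    and le2: "(\<integral>\<omega>. exp (\<beta> * (cmod (X l \<omega>))\<^sup>2) \<partial>M) \<le> 2" and E0: "(\<integral>\<omega>. X l \<omega> \<partial>M) = 0"
    using entry[OF l] by (auto simp: standard_entry_def)
  have q_le: "exp (q \<omega>) \<le> q \<omega> + ((1 - s) + s * exp (\<beta> * (cmod (X l \<omega>))\<^sup>2))" for \<omega>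
  proof -
    have "\<bar>q \<omega>\<bar> \<le> cmod z * cmod (X l \<omega>)"
      unfolding q_def using abs_Re_le_cmod[of "cnj (X l \<omega>) * z"] by (simp add: norm_mult mult.commute)
    then have "(q \<omega>)\<^sup>2 \<le> (cmod z * cmod (X l \<omega>))\<^sup>2"
      using power_mono[of "\<bar>q \<omega>\<bar>" _ 2] by simp
    also have "\<dots> = s * (\<beta> * (cmod (X l \<omega>))\<^sup>2)"
      using beta_pos by (simp add: s_def power_mult_distrib)
    finally have "exp ((q \<omega>)\<^sup>2) \<le> exp ((1 - s) * 0 + s * (\<beta> * (cmod (X l \<omega>))\<^sup>2))"
      by simp
    also have "\<dots> \<le> (1 - s) * exp 0 + s * exp (\<beta> * (cmod (X l \<omega>))\<^sup>2)"
      using convex_onD[OF convex_on_exp[of 1, simplified], of s 0 "\<beta> * (cmod (X l \<omega>))\<^sup>2"] s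
      by simp
    finally show ?thesis
      using exp_le_add_exp_square[of "q \<omega>"] by simp
  qed
  have q: "integrable M q"
    unfolding q_def[abs_def] by (intro all_moments_integrable all_moments_intros entry_moments l)
  have Eq: "(\<integral>\<omega>. q \<omega> \<partial>M) = 0"
  proof -
    have "integrable M (\<lambda>\<omega>. cnj (X l \<omega>) * z)"
      by (intro all_moments_integrable all_moments_intros entry_moments l)
    then show ?thesis
      unfolding q_def using E0 by (simp only: integral_Re) simp
  qed
  have int': "integrable M (\<lambda>\<omega>. q \<omega> + ((1 - s) + s * exp (\<beta> * (cmod (X l \<omega>))\<^sup>2)))"
    using q int by (intro Bochner_Integration.integrable_add) auto
  have intq: "integrable M (\<lambda>\<omega>. exp (q \<omega>))"
  proof (rule Bochner_Integration.integrable_bound[OF int'])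
    show "AE \<omega> in M. norm (exp (q \<omega>)) \<le> norm (q \<omega> + ((1 - s) + s * exp (\<beta> * (cmod (X l \<omega>))\<^sup>2)))"
      by (rule AE_I2) (use q_le order.trans[OF _ abs_ge_self] in auto)
  qed simp
  then show "integrable M (\<lambda>\<omega>. exp (Re (cnj (X l \<omega>) * z)))" by (simp add: q_def)
  have "(\<integral>\<omega>. exp (q \<omega>) \<partial>M) \<le> (\<integral>\<omega>. q \<omega> + ((1 - s) + s * exp (\<beta> * (cmod (X l \<omega>))\<^sup>2)) \<partial>M)"
    by (intro integral_mono intq int' q_le)
  also have "\<dots> = (1 - s) + s * (\<integral>\<omega>. exp (\<beta> * (cmod (X l \<omega>))\<^sup>2) \<partial>M)"
    using q int Eq by (simp add: Bochner_Integration.integral_add prob_space)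
  also have "\<dots> \<le> (1 - s) + s * 2"
    using le2 s by (intro add_left_mono mult_left_mono) auto
  also have "\<dots> \<le> exp s"
    using exp_ge_add_one_self[of s] by linarith
  finally show "(\<integral>\<omega>. exp (Re (cnj (X l \<omega>) * z)) \<partial>M) \<le> exp ((cmod z)\<^sup>2 / \<beta>)"
    by (simp add: q_def s_def)
qed

lemma ip_mgf:
  assumes z: "\<And>l. l < d \<Longrightarrow> (cmod (z l))\<^sup>2 \<le> \<beta>"
  shows "integrable M (\<lambda>\<omega>. exp (Re (cip d (\<lambda>l. X l \<omega>) z)))"
    and "(\<integral>\<omega>. exp (Re (cip d (\<lambda>l. X l \<omega>) z)) \<partial>M) \<le> exp ((\<Sum>l<d. (cmod (z l))\<^sup>2) / \<beta>)"
proof -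
  have eq: "exp (Re (cip d (\<lambda>l. X l \<omega>) z)) = (\<Prod>l<d. exp (Re (cnj (X l \<omega>) * z l)))" for \<omega>
    unfolding cip_def Re_sum by (rule exp_sum) simp
  have ind: "indep_vars (\<lambda>_. borel) (\<lambda>l \<omega>. exp (Re (cnj (X l \<omega>) * z l))) {..<d}"
    by (rule indep_vars_compose2[OF indep, of "\<lambda>l x. exp (Re (cnj x * z l))"]) measurable
  show "integrable M (\<lambda>\<omega>. exp (Re (cip d (\<lambda>l. X l \<omega>) z)))"
    unfolding eq by (rule indep_vars_integrable[OF finite_lessThan ind]) (rule entry_mgf(1), simp_all add: z)
  have "(\<integral>\<omega>. exp (Re (cip d (\<lambda>l. X l \<omega>) z)) \<partial>M) = (\<Prod>l<d. \<integral>\<omega>. exp (Re (cnj (X l \<omega>) * z l)) \<partial>M)"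
    unfolding eq by (rule indep_vars_lebesgue_integral[OF finite_lessThan ind]) (rule entry_mgf(1), simp_all add: z)
  also have "\<dots> \<le> (\<Prod>l<d. exp ((cmod (z l))\<^sup>2 / \<beta>))"
    by (intro prod_mono conjI entry_mgf z) auto
  also have "\<dots> = exp ((\<Sum>l<d. (cmod (z l))\<^sup>2) / \<beta>)"
    by (simp add: exp_sum sum_divide_distrib)
  finally show "(\<integral>\<omega>. exp (Re (cip d (\<lambda>l. X l \<omega>) z)) \<partial>M) \<le> exp ((\<Sum>l<d. (cmod (z l))\<^sup>2) / \<beta>)" .
qed

lemma expectation_cmod_ip_power8_le:
  assumes f: "(\<Sum>l<d. (cmod (f l))\<^sup>2) \<le> 4"
  shows "(\<integral>\<omega>. cmod (cip d (\<lambda>l. X l \<omega>) f) ^ 8 \<partial>M) \<le> moment8_bound \<beta>"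
proof -
  \<comment> \<open>The largest scaling for which every coordinate of \<open>t f\<close> satisfies the hypothesis of \<open>ip_mgf\<close>.\<close>
  define t where "t = sqrt (\<beta> / 4)"
  have t: "t > 0" "t\<^sup>2 = \<beta> / 4" using beta_pos by (auto simp: t_def)
  define U where "U \<omega> = cip d (\<lambda>l. X l \<omega>) f" for \<omega>
  define e where "e \<theta> \<omega> = exp (Re (\<theta> * complex_of_real t * U \<omega>))" for \<theta> \<omega>
  have e: "integrable M (e \<theta>)" "(\<integral>\<omega>. e \<theta> \<omega> \<partial>M) \<le> exp 1" if \<theta>: "cmod \<theta> = 1" for \<theta>
  proof -
    define z where "z l = \<theta> * complex_of_real t * f l" for l
    have z: "(cmod (z l))\<^sup>2 = \<beta> / 4 * (cmod (f l))\<^sup>2" for l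
      by (simp add: z_def norm_mult \<theta> power_mult_distrib t)
    have "(cmod (f l))\<^sup>2 \<le> 4" if "l < d" for l
      using that by (intro order.trans[OF member_le_sum f]) auto
    then have zle: "(cmod (z l))\<^sup>2 \<le> \<beta>" if "l < d" for l
      using that beta_pos unfolding z by (simp add: mult_le_cancel_left1 field_simps)
    have eq: "e \<theta> \<omega> = exp (Re (cip d (\<lambda>l. X l \<omega>) z))" for \<omega>
      unfolding e_def U_def cip_def z_def sum_distrib_left by (simp only: mult_ac)
    show "integrable M (e \<theta>)" using ip_mgf(1)[OF zle] by (simp add: eq[abs_def])
    have "(\<integral>\<omega>. e \<theta> \<omega> \<partial>M) \<le> exp ((\<Sum>l<d. (cmod (z l))\<^sup>2) / \<beta>)"
      unfolding eq by (rule ip_mgf(2)[OF zle])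
    also have "(\<Sum>l<d. (cmod (z l))\<^sup>2) / \<beta> = (\<Sum>l<d. (cmod (f l))\<^sup>2) / 4"
      unfolding z sum_distrib_left[symmetric] using beta_pos by simp
    also have "exp \<dots> \<le> exp 1" using f by simp
    finally show "(\<integral>\<omega>. e \<theta> \<omega> \<partial>M) \<le> exp 1" .
  qed
  note e1 = e[of 1, simplified] e[of "-1", simplified] e[of "\<i>", simplified] e[of "-\<i>", simplified]
  have U: "all_moments M U" unfolding U_def[abs_def] by (rule ip_moments) simp
  have ptw: "t ^ 8 * cmod (U \<omega>) ^ 8 \<le> 8 * fact 8 * (e 1 \<omega> + e (-1) \<omega> + e \<i> \<omega> + e (-\<i>) \<omega>)" for \<omega>
  proof -
    have "t ^ 8 * cmod (U \<omega>) ^ 8 = cmod (complex_of_real t * U \<omega>) ^ 8"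
      using t by (simp add: norm_mult power_mult_distrib)
    also have "\<dots> \<le> 8 * (Re (complex_of_real t * U \<omega>) ^ 8 + Im (complex_of_real t * U \<omega>) ^ 8)"
      by (rule cmod_power8_le)
    also have "\<dots> \<le> 8 * (fact 8 * (exp (Re (complex_of_real t * U \<omega>)) + exp (- Re (complex_of_real t * U \<omega>)))
        + fact 8 * (exp (Im (complex_of_real t * U \<omega>)) + exp (- Im (complex_of_real t * U \<omega>))))"
      by (intro mult_left_mono add_mono power8_le_exp) auto
    also have "\<dots> = 8 * fact 8 * (e 1 \<omega> + e (-1) \<omega> + e \<i> \<omega> + e (-\<i>) \<omega>)"
      by (simp add: e_def algebra_simps del: fact_numeral)
    finally show ?thesis .
  qed
  have "t ^ 8 * (\<integral>\<omega>. cmod (U \<omega>) ^ 8 \<partial>M) = (\<integral>\<omega>. t ^ 8 * cmod (U \<omega>) ^ 8 \<partial>M)"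
    by simp
  also have "\<dots> \<le> (\<integral>\<omega>. 8 * fact 8 * (e 1 \<omega> + e (-1) \<omega> + e \<i> \<omega> + e (-\<i>) \<omega>) \<partial>M)"
    using U e1 ptw by (intro integral_mono) (auto simp: all_moments_def)
  also have "\<dots> = 8 * fact 8 * ((\<integral>\<omega>. e 1 \<omega> \<partial>M) + (\<integral>\<omega>. e (-1) \<omega> \<partial>M) + (\<integral>\<omega>. e \<i> \<omega> \<partial>M) + (\<integral>\<omega>. e (-\<i>) \<omega> \<partial>M))"
    using e1 by (simp add: Bochner_Integration.integral_add del: fact_numeral)
  also have "\<dots> \<le> 8 * fact 8 * (exp 1 + exp 1 + exp 1 + exp 1)"
    using e1 by (intro mult_left_mono add_mono) auto
  also have "\<dots> = 32 * fact 8 * exp 1" by simp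
  finally have "(\<integral>\<omega>. cmod (U \<omega>) ^ 8 \<partial>M) \<le> 32 * fact 8 * exp 1 / t ^ 8"
    using t by (simp add: pos_le_divide_eq mult.commute del: fact_numeral)
  also have "t ^ 8 = (\<beta> / 4) ^ 4"
    using t(2) by (metis mult_2 numeral_Bit0 power_mult)
  also have "32 * fact 8 * exp 1 / (\<beta> / 4) ^ 4 = moment8_bound \<beta>"
    by (simp add: moment8_bound_def power_divide del: fact_numeral)
  finally show ?thesis by (simp add: U_def)
qed

text \<open>
  The Paley--Zygmund inequality gives probability \<open>4 \<delta>\<close> to the event that \<open>Y\<close> is large. By Markov's
  inequality each of the factors exceeds \<open>2 / sqrt \<delta>\<close> with probability at most \<open>\<delta>\<close>, which leaves \<open>2 \<delta>\<close>.
  The bounds on \<open>f\<close> and \<open>g\<close> are slack, because the lemma is applied to approximations of unit vectors.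
\<close>
lemma row_small_ball:
  assumes "\<gamma> > 1"
    and f: "(\<Sum>l<d. (cmod (f l))\<^sup>2) \<le> 4" and g: "(\<Sum>l<d. (cmod (g l))\<^sup>2) \<le> 4"
    and fg: "1 / 2 \<le> (\<Sum>l<d. (cmod (f l))\<^sup>2) * (\<Sum>l<d. (cmod (g l))\<^sup>2) - (Im (cip d f g))\<^sup>2"
  defines "c \<equiv> min 1 (\<gamma> - 1) / 8"
  defines "\<delta> \<equiv> c\<^sup>2 / (4 * moment8_bound \<beta>)"
  shows "2 * \<delta> \<le> prob {\<omega> \<in> space M. sqrt c \<le> \<bar>Re (cnj (cip d (\<lambda>l. X l \<omega>) f) * cip d (\<lambda>l. X l \<omega>) g)\<bar>
      \<and> cmod (cip d (\<lambda>l. X l \<omega>) f) \<le> 2 / sqrt \<delta> \<and> cmod (cip d (\<lambda>l. X l \<omega>) g) \<le> 2 / sqrt \<delta>}"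
proof -
  define U where "U \<omega> = cip d (\<lambda>l. X l \<omega>) f" for \<omega>
  define V where "V \<omega> = cip d (\<lambda>l. X l \<omega>) g" for \<omega>
  define Y where "Y \<omega> = Re (cnj (U \<omega>) * V \<omega>)" for \<omega>
  define K where "K = moment8_bound \<beta>"
  have K: "K > 0" using beta_pos by (simp add: K_def moment8_bound_def)
  have c: "c > 0" using assms(1) by (simp add: c_def)
  have \<delta>: "\<delta> > 0" "c\<^sup>2 / K = 4 * \<delta>" using c K by (auto simp: \<delta>_def K_def)
  have UV: "all_moments M U" "all_moments M V"
    unfolding U_def[abs_def] V_def[abs_def] by (auto intro: ip_moments)
  note [measurable] = all_moments_measurable[OF UV(1)] all_moments_measurable[OF UV(2)]
  have Y: "all_moments M Y" unfolding Y_def[abs_def] by (intro all_moments_intros UV)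
  note [measurable] = all_moments_measurable[OF Y]
  have "2 * c \<le> min 1 (\<gamma> - 1) / 2 * (1 / 2)"
    using assms(1) by (simp add: c_def)
  also have "\<dots> \<le> min 1 (\<gamma> - 1) / 2 * ((\<Sum>l<d. (cmod (f l))\<^sup>2) * (\<Sum>l<d. (cmod (g l))\<^sup>2) - (Im (cip d f g))\<^sup>2)"
    using assms(1) by (intro mult_left_mono fg) auto
  also have "\<dots> \<le> (\<integral>\<omega>. (Y \<omega>)\<^sup>2 \<partial>M)"
    unfolding Y_def U_def V_def by (rule expectation_Re_cnj_ip_ip_sq_ge) fact
  finally have Y2: "2 * c \<le> (\<integral>\<omega>. (Y \<omega>)\<^sup>2 \<partial>M)" .
  have Y4: "(\<integral>\<omega>. Y \<omega> ^ 4 \<partial>M) \<le> K"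
  proof -
    have int: "integrable M (\<lambda>\<omega>. cmod (U \<omega>) ^ 8)" "integrable M (\<lambda>\<omega>. cmod (V \<omega>) ^ 8)" "integrable M (\<lambda>\<omega>. Y \<omega> ^ 4)"
      by (intro all_moments_integrable all_moments_intros UV Y)+
    have "Y \<omega> ^ 4 \<le> 1 / 2 * (cmod (U \<omega>) ^ 8 + cmod (V \<omega>) ^ 8)" for \<omega>
    proof -
      have "\<bar>Y \<omega>\<bar> \<le> cmod (U \<omega>) * cmod (V \<omega>)"
        unfolding Y_def using abs_Re_le_cmod[of "cnj (U \<omega>) * V \<omega>"] by (simp add: norm_mult)
      then have "\<bar>Y \<omega>\<bar> ^ 4 \<le> (cmod (U \<omega>) * cmod (V \<omega>)) ^ 4"
        by (intro power_mono) auto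
      then have "Y \<omega> ^ 4 \<le> cmod (U \<omega>) ^ 4 * cmod (V \<omega>) ^ 4"
        by (simp add: power_mult_distrib power_even_abs)
      also have "\<dots> \<le> 1 / 2 * ((cmod (U \<omega>) ^ 4)\<^sup>2 + (cmod (V \<omega>) ^ 4)\<^sup>2)"
        using sum_squares_bound[of "cmod (U \<omega>) ^ 4" "cmod (V \<omega>) ^ 4"] by simp
      finally show ?thesis by (simp flip: power_mult)
    qed
    then have "(\<integral>\<omega>. Y \<omega> ^ 4 \<partial>M) \<le> (\<integral>\<omega>. 1 / 2 * (cmod (U \<omega>) ^ 8 + cmod (V \<omega>) ^ 8) \<partial>M)"
      using int by (intro integral_mono) auto
    also have "\<dots> = 1 / 2 * ((\<integral>\<omega>. cmod (U \<omega>) ^ 8 \<partial>M) + (\<integral>\<omega>. cmod (V \<omega>) ^ 8 \<partial>M))"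
      using int by (simp only: Bochner_Integration.integral_mult_right_zero Bochner_Integration.integral_add)
    also have "\<dots> \<le> 1 / 2 * (K + K)"
      unfolding K_def U_def V_def
      by (intro mult_left_mono add_mono expectation_cmod_ip_power8_le f g) auto
    finally show ?thesis by simp
  qed
  define A where "A = {\<omega> \<in> space M. c \<le> (Y \<omega>)\<^sup>2}"
  define B where "B Z = {\<omega> \<in> space M. (2 / sqrt \<delta>)\<^sup>2 \<le> (cmod (Z \<omega>))\<^sup>2}" for Z :: "'a \<Rightarrow> complex"
  have [measurable]: "A \<in> sets M" "B U \<in> sets M" "B V \<in> sets M"
    unfolding A_def B_def by measurable
  have A: "4 * \<delta> \<le> prob A"
    using paley_zygmund_fourth_moment[OF Y c Y2 K Y4] by (simp add: A_def \<delta>)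
  have B: "prob (B Z) \<le> \<delta>"
    if Z: "all_moments M Z" and Z2: "(\<integral>\<omega>. (cmod (Z \<omega>))\<^sup>2 \<partial>M) \<le> 4" for Z
  proof -
    have "prob (B Z) \<le> (\<integral>\<omega>. (cmod (Z \<omega>))\<^sup>2 \<partial>M) / (2 / sqrt \<delta>)\<^sup>2"
      unfolding B_def
    proof (rule integral_Markov_inequality_measure[where A="{}"])
      show "integrable M (\<lambda>\<omega>. (cmod (Z \<omega>))\<^sup>2)" using Z by (simp add: all_moments_def)
    qed (use \<delta> in auto)
    also have "\<dots> \<le> 4 / (2 / sqrt \<delta>)\<^sup>2"
      using Z2 by (intro divide_right_mono) auto
    also have "\<dots> = \<delta>" using \<delta> by (simp add: power_divide)
    finally show ?thesis .
  qed
  have BU: "prob (B U) \<le> \<delta>"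
    using expectation_cmod_ip_sq[OF order_refl, of f] f by (intro B UV) (simp add: U_def)
  have BV: "prob (B V) \<le> \<delta>"
    using expectation_cmod_ip_sq[OF order_refl, of g] g by (intro B UV) (simp add: V_def)
  define E where "E = {\<omega> \<in> space M. sqrt c \<le> \<bar>Y \<omega>\<bar> \<and> cmod (U \<omega>) \<le> 2 / sqrt \<delta> \<and> cmod (V \<omega>) \<le> 2 / sqrt \<delta>}"
  have [measurable]: "E \<in> sets M" unfolding E_def by measurable
  have sub: "A \<subseteq> E \<union> (B U \<union> B V)"
  proof
    fix \<omega> assume "\<omega> \<in> A"
    then have \<omega>: "\<omega> \<in> space M" "sqrt c \<le> \<bar>Y \<omega>\<bar>"
      by (auto simp: A_def intro: real_le_lsqrt simp flip: real_sqrt_abs)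
    have "\<omega> \<in> B Z" if "\<not> cmod (Z \<omega>) \<le> 2 / sqrt \<delta>" for Z
      unfolding B_def using \<omega> that \<delta>(1) by (auto intro!: power_mono)
    then show "\<omega> \<in> E \<union> (B U \<union> B V)" using \<omega> by (auto simp: E_def)
  qed
  have "4 * \<delta> \<le> prob (E \<union> (B U \<union> B V))"
    using A finite_measure_mono[OF sub] by simp
  also have "\<dots> \<le> prob E + prob (B U \<union> B V)"
    by (rule measure_Un_le) auto
  also have "prob (B U \<union> B V) \<le> prob (B U) + prob (B V)"
    by (rule measure_Un_le) auto
  finally have "2 * \<delta> \<le> prob E" using BU BV by linarith
  then show ?thesis by (simp add: E_def Y_def U_def V_def)
qed

end

section \<open>A matrix of independent entries\<close>

locale standard_matrix = prob_space M for M :: "'a measure" +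
  fixes a :: "nat \<Rightarrow> nat \<Rightarrow> 'a \<Rightarrow> complex" and m d :: nat and \<beta> \<gamma> :: real
  assumes beta_pos: "\<beta> > 0"
    and indep: "indep_vars (\<lambda>_. borel) (\<lambda>(j, l). a j l) ({..<m} \<times> {..<d})"
    and entry: "j < m \<Longrightarrow> l < d \<Longrightarrow> standard_entry M \<beta> \<gamma> (a j l)"
begin

lemma entry_measurable: "j < m \<Longrightarrow> l < d \<Longrightarrow> a j l \<in> borel_measurable M"
  using entry by (simp add: standard_entry_def)

lemma row: "j < m \<Longrightarrow> standard_row M (a j) d \<beta> \<gamma>"
proof unfold_locales
  assume j: "j < m"
  have "indep_vars (\<lambda>l. PiM {(j, l)} (\<lambda>_. borel)) (\<lambda>l \<omega>. restrict (\<lambda>i. (\<lambda>(j, l). a j l) i \<omega>) {(j, l)}) {..<d}"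
    by (rule indep_vars_restrict[OF indep]) (use j in \<open>auto simp: disjoint_family_on_def\<close>)
  then have "indep_vars (\<lambda>_. borel) (\<lambda>l \<omega>. (\<lambda>r. r (j, l)) (restrict (\<lambda>i. (\<lambda>(j, l). a j l) i \<omega>) {(j, l)})) {..<d}"
    by (rule indep_vars_compose2) measurable
  then show "indep_vars (\<lambda>_. borel) (a j) {..<d}"
    by simp
qed (use beta_pos entry in auto)

lemma indep_column:
  assumes l: "l < d"
  shows "indep_vars (\<lambda>_. borel) (\<lambda>j. a j l) {..<m}"
proof -
  have "indep_vars (\<lambda>j. PiM {(j, l)} (\<lambda>_. borel)) (\<lambda>j \<omega>. restrict (\<lambda>i. (\<lambda>(j, l). a j l) i \<omega>) {(j, l)}) {..<m}"
    by (rule indep_vars_restrict[OF indep]) (use l in \<open>auto simp: disjoint_family_on_def\<close>)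
  then have "indep_vars (\<lambda>_. borel) (\<lambda>j \<omega>. (\<lambda>r. r (j, l)) (restrict (\<lambda>i. (\<lambda>(j, l). a j l) i \<omega>) {(j, l)})) {..<m}"
    by (rule indep_vars_compose2) measurable
  then show ?thesis by simp
qed

text \<open>
  The Chernoff bound: the exponential moment of the sum is at most \<open>2\<^sup>m \<le> exp m\<close>, and the threshold costs
  \<open>exp (2 m)\<close>.
\<close>
lemma column_norm_tail:
  assumes l: "l < d"
  shows "prob {\<omega> \<in> space M. 2 / \<beta> * real m \<le> (\<Sum>j<m. (cmod (a j l \<omega>))\<^sup>2)} \<le> exp (- real m)"
proof -
  define Z where "Z \<omega> = (\<Prod>j<m. exp (\<beta> * (cmod (a j l \<omega>))\<^sup>2))" for \<omega>
  have ind: "indep_vars (\<lambda>_. borel) (\<lambda>j \<omega>. exp (\<beta> * (cmod (a j l \<omega>))\<^sup>2)) {..<m}"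
    by (rule indep_vars_compose2[OF indep_column[OF l], of "\<lambda>_ x. exp (\<beta> * (cmod x)\<^sup>2)"]) measurable
  have int: "integrable M (\<lambda>\<omega>. exp (\<beta> * (cmod (a j l \<omega>))\<^sup>2))" "(\<integral>\<omega>. exp (\<beta> * (cmod (a j l \<omega>))\<^sup>2) \<partial>M) \<le> 2"
    if "j < m" for j
    using entry[OF that l] by (auto simp: standard_entry_def)
  have Z: "integrable M Z"
    unfolding Z_def[abs_def] by (rule indep_vars_integrable[OF finite_lessThan ind]) (simp add: int)
  have "(\<integral>\<omega>. Z \<omega> \<partial>M) = (\<Prod>j<m. \<integral>\<omega>. exp (\<beta> * (cmod (a j l \<omega>))\<^sup>2) \<partial>M)"
    unfolding Z_def by (rule indep_vars_lebesgue_integral[OF finite_lessThan ind]) (simp add: int)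
  also have "\<dots> \<le> (\<Prod>j<m. 2)"
    by (intro prod_mono conjI int) auto
  finally have EZ: "(\<integral>\<omega>. Z \<omega> \<partial>M) \<le> 2 ^ m" by simp
  have Z_eq: "Z \<omega> = exp (\<beta> * (\<Sum>j<m. (cmod (a j l \<omega>))\<^sup>2))" for \<omega>
    by (simp add: Z_def exp_sum sum_distrib_left)
  have "{\<omega> \<in> space M. 2 / \<beta> * real m \<le> (\<Sum>j<m. (cmod (a j l \<omega>))\<^sup>2)} = {\<omega> \<in> space M. exp (2 * real m) \<le> Z \<omega>}"
    unfolding Z_eq using beta_pos by (auto simp: field_simps)
  also have "prob \<dots> \<le> (\<integral>\<omega>. Z \<omega> \<partial>M) / exp (2 * real m)"
    by (rule integral_Markov_inequality_measure[where A="{}", OF Z]) (auto simp: Z_eq)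
  also have "\<dots> \<le> exp (real m) / exp (2 * real m)"
  proof (intro divide_right_mono order.trans[OF EZ])
    have "(2::real) \<le> exp 1" using exp_ge_add_one_self[of 1] by simp
    then have "(2::real) ^ m \<le> exp 1 ^ m" by (intro power_mono) auto
    then show "2 ^ m \<le> exp (real m)" by (simp flip: exp_of_nat_mult)
  qed simp
  also have "\<dots> = exp (- real m)" by (simp flip: exp_diff)
  finally show ?thesis .
qed

lemma count_rows_measurable:
  assumes S[measurable]: "S \<in> sets borel"
  shows "(\<lambda>\<omega>. real (card {j. j < m \<and> (cip d (\<lambda>l. a j l \<omega>) f, cip d (\<lambda>l. a j l \<omega>) g) \<in> S})) \<in> borel_measurable M"
proof -
  have "real (card {j. j < m \<and> (cip d (\<lambda>l. a j l \<omega>) f, cip d (\<lambda>l. a j l \<omega>) g) \<in> S})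
      = (\<Sum>j<m. indicator S (cip d (\<lambda>l. a j l \<omega>) f, cip d (\<lambda>l. a j l \<omega>) g))" for \<omega>
    by (simp add: indicator_def sum.If_cases Int_def)
  moreover have "(\<lambda>\<omega>. indicator S (cip d (\<lambda>l. a j l \<omega>) f, cip d (\<lambda>l. a j l \<omega>) g) :: real) \<in> borel_measurable M"
    if "j < m" for j
  proof -
    have "(\<lambda>\<omega>. (cip d (\<lambda>l. a j l \<omega>) f, cip d (\<lambda>l. a j l \<omega>) g)) \<in> borel_measurable M"
      unfolding cip_def using entry_measurable[OF that] by measurable
    from measurable_compose[OF this borel_measurable_indicator[OF S]] show ?thesis .
  qed
  ultimately show ?thesis by (simp add: borel_measurable_sum)
qed

lemma count_rows_tail:
  assumes m: "0 < m" and S[measurable]: "S \<in> sets borel" and t: "0 \<le> t"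
    and p: "\<And>j. j < m \<Longrightarrow> p \<le> prob {\<omega> \<in> space M. (cip d (\<lambda>l. a j l \<omega>) f, cip d (\<lambda>l. a j l \<omega>) g) \<in> S}"
  shows "prob {\<omega> \<in> space M. real (card {j. j < m \<and> (cip d (\<lambda>l. a j l \<omega>) f, cip d (\<lambda>l. a j l \<omega>) g) \<in> S})
      \<le> (p - t) * real m} \<le> exp (- 2 * t\<^sup>2 * real m)"
proof -
  define h where "h j \<omega> = (indicator S (cip d (\<lambda>l. a j l \<omega>) f, cip d (\<lambda>l. a j l \<omega>) g) :: real)" for j \<omega>
  have ind: "indep_vars (\<lambda>_. borel) h {..<m}"
  proof -
    have "indep_vars (\<lambda>j. PiM ({j} \<times> {..<d}) (\<lambda>_. borel))
        (\<lambda>j \<omega>. restrict (\<lambda>i. (\<lambda>(j, l). a j l) i \<omega>) ({j} \<times> {..<d})) {..<m}"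
      by (rule indep_vars_restrict[OF indep]) (auto simp: disjoint_family_on_def)
    then have "indep_vars (\<lambda>_. borel)
        (\<lambda>j \<omega>. (\<lambda>r. indicator S (cip d (\<lambda>l. r (j, l)) f, cip d (\<lambda>l. r (j, l)) g) :: real)
          (restrict (\<lambda>i. (\<lambda>(j, l). a j l) i \<omega>) ({j} \<times> {..<d}))) {..<m}"
    proof (rule indep_vars_compose2)
      fix j
      have "(\<lambda>r. (cip d (\<lambda>l. r (j, l)) f, cip d (\<lambda>l. r (j, l)) g))
          \<in> borel_measurable (PiM ({j} \<times> {..<d}) (\<lambda>_. borel :: complex measure))"
        unfolding cip_def by measurable
      from measurable_compose[OF this borel_measurable_indicator[OF S]]
      show "(\<lambda>r. indicator S (cip d (\<lambda>l. r (j, l)) f, cip d (\<lambda>l. r (j, l)) g) :: real)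
          \<in> borel_measurable (PiM ({j} \<times> {..<d}) (\<lambda>_. borel :: complex measure))" .
    qed
    also have "(\<lambda>j \<omega>. (\<lambda>r. indicator S (cip d (\<lambda>l. r (j, l)) f, cip d (\<lambda>l. r (j, l)) g) :: real)
          (restrict (\<lambda>i. (\<lambda>(j, l). a j l) i \<omega>) ({j} \<times> {..<d}))) = h"
      by (simp add: h_def[abs_def] cip_def)
    finally show ?thesis .
  qed
  interpret H: Hoeffding_ineq M "{..<m}" h "\<lambda>_. 0" "\<lambda>_. 1" "\<Sum>j<m. expectation (h j)"
    by unfold_locales (use ind in \<open>auto simp: h_def indicator_def\<close>)
  have Eh: "p \<le> expectation (h j)" if j: "j < m" for j
  proof -
    have meas: "(\<lambda>\<omega>. (cip d (\<lambda>l. a j l \<omega>) f, cip d (\<lambda>l. a j l \<omega>) g)) \<in> borel_measurable M"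
      unfolding cip_def using entry_measurable[OF j] by measurable
    have "expectation (h j) = expectation (indicator {\<omega> \<in> space M. (cip d (\<lambda>l. a j l \<omega>) f, cip d (\<lambda>l. a j l \<omega>) g) \<in> S})"
      by (intro Bochner_Integration.integral_cong refl) (auto simp: h_def indicator_def)
    also have "\<dots> = prob {\<omega> \<in> space M. (cip d (\<lambda>l. a j l \<omega>) f, cip d (\<lambda>l. a j l \<omega>) g) \<in> S}"
      using measurable_sets[OF meas S] by (simp add: vimage_def Int_def conj_commute)
    finally show ?thesis using p[OF j] by simp
  qed
  have "(\<Sum>j<m. p) \<le> (\<Sum>j<m. expectation (h j))"
    by (intro sum_mono Eh) auto
  then have mu: "p * real m \<le> (\<Sum>j<m. expectation (h j))" by (simp add: mult.commute)
  have count: "(\<Sum>j<m. h j \<omega>) = real (card {j. j < m \<and> (cip d (\<lambda>l. a j l \<omega>) f, cip d (\<lambda>l. a j l \<omega>) g) \<in> S})" for \<omega>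
    unfolding h_def by (simp add: indicator_def sum.If_cases Int_def)
  have meas_h[measurable]: "h j \<in> borel_measurable M" if "j < m" for j
    using ind that by (auto simp: indep_vars_def)
  have "prob {\<omega> \<in> space M. (\<Sum>j<m. h j \<omega>) \<le> (p - t) * real m}
      \<le> prob {\<omega> \<in> space M. (\<Sum>j<m. h j \<omega>) \<le> (\<Sum>j<m. expectation (h j)) - t * real m}"
    using mu by (intro finite_measure_mono) (auto simp: algebra_simps)
  also have "\<dots> \<le> exp (- 2 * (t * real m)\<^sup>2 / (\<Sum>j<m. (1 - 0)\<^sup>2))"
    using m t by (intro H.Hoeffding_ineq_le) auto
  also have "- 2 * (t * real m)\<^sup>2 / (\<Sum>j<m. (1 - 0)\<^sup>2) = - 2 * t\<^sup>2 * real m"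
    using m by (simp add: power2_eq_square)
  finally show ?thesis by (simp add: count)
qed

end

section \<open>Maurey's empirical approximation\<close>

text \<open>
  The bias-variance decomposition for a random vector that takes the value \<open>\<phi> i\<close> with probability \<open>w i\<close>
  and has mean \<open>\<mu>\<close>.
\<close>
lemma weighted_sum_norm_square:
  fixes \<phi> :: "'i \<Rightarrow> 'b::real_inner"
  assumes "finite I" and "sum w I = 1"
  defines "\<mu> \<equiv> \<Sum>i\<in>I. w i *\<^sub>R \<phi> i"
  shows "(\<Sum>i\<in>I. w i * (norm (s + \<phi> i - \<mu>))\<^sup>2) = (norm s)\<^sup>2 + (\<Sum>i\<in>I. w i * (norm (\<phi> i))\<^sup>2) - (norm \<mu>)\<^sup>2"
proof -
  have "w i * (norm (s + \<phi> i - \<mu>))\<^sup>2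
      = w i * (norm (s - \<mu>))\<^sup>2 + 2 * ((s - \<mu>) \<bullet> (w i *\<^sub>R \<phi> i)) + w i * (norm (\<phi> i))\<^sup>2" for i
    by (simp add: power2_norm_eq_inner inner_add_left inner_add_right inner_diff_left inner_diff_right
        inner_commute algebra_simps)
  then have "(\<Sum>i\<in>I. w i * (norm (s + \<phi> i - \<mu>))\<^sup>2)
      = (norm (s - \<mu>))\<^sup>2 + 2 * ((s - \<mu>) \<bullet> \<mu>) + (\<Sum>i\<in>I. w i * (norm (\<phi> i))\<^sup>2)"
    unfolding \<mu>_def inner_sum_right
    by (simp add: sum.distrib assms(2) flip: sum_distrib_left sum_distrib_right)
  also have "(norm (s - \<mu>))\<^sup>2 + 2 * ((s - \<mu>) \<bullet> \<mu>) = (norm s)\<^sup>2 - (norm \<mu>)\<^sup>2"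
    by (simp add: power2_norm_eq_inner inner_diff_left inner_diff_right inner_commute)
  finally show ?thesis by simp
qed

text \<open>
  On average over the weights the step from \<open>s\<close> to \<open>s + \<Phi> i - \<mu>\<close> increases the squared norm by the variance,
  so at least one \<open>i\<close> increases it by no more.
\<close>
lemma maurey_step:
  fixes \<Phi> :: "'i \<Rightarrow> 'j \<Rightarrow> 'b::real_inner"
  assumes I: "finite I" and w: "\<And>i. i \<in> I \<Longrightarrow> 0 \<le> w i" "sum w I = 1"
    and \<rho>: "\<And>i. i \<in> I \<Longrightarrow> (\<Sum>j\<in>J. (norm (\<Phi> i j))\<^sup>2) \<le> \<rho>"
  shows "\<exists>i\<in>I. (\<Sum>j\<in>J. (norm (s j + \<Phi> i j - (\<Sum>i\<in>I. w i *\<^sub>R \<Phi> i j)))\<^sup>2) \<le> (\<Sum>j\<in>J. (norm (s j))\<^sup>2) + \<rho>"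
proof (rule ccontr)
  define \<mu> where "\<mu> j = (\<Sum>i\<in>I. w i *\<^sub>R \<Phi> i j)" for j
  define T where "T = (\<Sum>j\<in>J. (norm (s j))\<^sup>2) + \<rho>"
  assume "\<not> ?thesis"
  then have gt: "T < (\<Sum>j\<in>J. (norm (s j + \<Phi> i j - \<mu> j))\<^sup>2)" if "i \<in> I" for i
    using that by (auto simp: T_def \<mu>_def not_le)
  obtain i0 where i0: "i0 \<in> I" "0 < w i0"
    using w by (metis less_eq_real_def sum.neutral zero_neq_one)
  have "T = (\<Sum>i\<in>I. w i * T)" using w by (simp flip: sum_distrib_right)
  also have "\<dots> < (\<Sum>i\<in>I. w i * (\<Sum>j\<in>J. (norm (s j + \<Phi> i j - \<mu> j))\<^sup>2))"
  proof (rule sum_strict_mono_ex1[OF I])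
    show "\<forall>i\<in>I. w i * T \<le> w i * (\<Sum>j\<in>J. (norm (s j + \<Phi> i j - \<mu> j))\<^sup>2)"
      by (intro ballI mult_left_mono w(1) less_imp_le[OF gt])
    show "\<exists>i\<in>I. w i * T < w i * (\<Sum>j\<in>J. (norm (s j + \<Phi> i j - \<mu> j))\<^sup>2)"
      using i0 gt by (intro bexI[of _ i0]) auto
  qed
  also have "\<dots> = (\<Sum>j\<in>J. \<Sum>i\<in>I. w i * (norm (s j + \<Phi> i j - \<mu> j))\<^sup>2)"
    unfolding sum_distrib_left by (rule sum.swap)
  also have "\<dots> = (\<Sum>j\<in>J. (norm (s j))\<^sup>2 + (\<Sum>i\<in>I. w i * (norm (\<Phi> i j))\<^sup>2) - (norm (\<mu> j))\<^sup>2)"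
    unfolding \<mu>_def by (intro sum.cong refl weighted_sum_norm_square I w)
  also have "\<dots> \<le> (\<Sum>j\<in>J. (norm (s j))\<^sup>2 + (\<Sum>i\<in>I. w i * (norm (\<Phi> i j))\<^sup>2))"
    by (intro sum_mono) auto
  also have "\<dots> = (\<Sum>j\<in>J. (norm (s j))\<^sup>2) + (\<Sum>i\<in>I. w i * (\<Sum>j\<in>J. (norm (\<Phi> i j))\<^sup>2))"
    unfolding sum.distrib sum_distrib_left by (simp add: sum.swap[of _ J I])
  also have "\<dots> \<le> (\<Sum>j\<in>J. (norm (s j))\<^sup>2) + (\<Sum>i\<in>I. w i * \<rho>)"
    by (intro add_left_mono sum_mono mult_left_mono \<rho> w)
  also have "\<dots> = T" using w by (simp add: T_def flip: sum_distrib_right)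
  finally show False by simp
qed

text \<open>
  The index set \<open>J\<close> makes the ambient Hilbert space a finite product, in which several seminorms of a
  vector are controlled by the same selection.
\<close>
lemma maurey_selection:
  fixes \<Phi> :: "'i \<Rightarrow> 'j \<Rightarrow> 'b::real_inner"
  assumes I: "finite I" and w: "\<And>i. i \<in> I \<Longrightarrow> 0 \<le> w i" "sum w I = 1"
    and \<rho>: "\<And>i. i \<in> I \<Longrightarrow> (\<Sum>j\<in>J. (norm (\<Phi> i j))\<^sup>2) \<le> \<rho>"
  shows "\<exists>p. (\<forall>n<N. p n \<in> I) \<and>
    (\<Sum>j\<in>J. (norm ((\<Sum>n<N. \<Phi> (p n) j) - real N *\<^sub>R (\<Sum>i\<in>I. w i *\<^sub>R \<Phi> i j)))\<^sup>2) \<le> real N * \<rho>"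
proof (induction N)
  case 0
  then show ?case by simp
next
  case (Suc N)
  define \<mu> where "\<mu> j = (\<Sum>i\<in>I. w i *\<^sub>R \<Phi> i j)" for j
  from Suc obtain p where p: "\<And>n. n < N \<Longrightarrow> p n \<in> I"
    and le: "(\<Sum>j\<in>J. (norm ((\<Sum>n<N. \<Phi> (p n) j) - real N *\<^sub>R \<mu> j))\<^sup>2) \<le> real N * \<rho>"
    by (auto simp: \<mu>_def)
  have "\<exists>i\<in>I. (\<Sum>j\<in>J. (norm (((\<Sum>n<N. \<Phi> (p n) j) - real N *\<^sub>R \<mu> j) + \<Phi> i j - \<mu> j))\<^sup>2)
      \<le> (\<Sum>j\<in>J. (norm ((\<Sum>n<N. \<Phi> (p n) j) - real N *\<^sub>R \<mu> j))\<^sup>2) + \<rho>"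
    unfolding \<mu>_def by (rule maurey_step[OF I w \<rho>])
  then obtain i where i: "i \<in> I"
    and step: "(\<Sum>j\<in>J. (norm (((\<Sum>n<N. \<Phi> (p n) j) - real N *\<^sub>R \<mu> j) + \<Phi> i j - \<mu> j))\<^sup>2)
      \<le> (\<Sum>j\<in>J. (norm ((\<Sum>n<N. \<Phi> (p n) j) - real N *\<^sub>R \<mu> j))\<^sup>2) + \<rho>"
    by (rule bexE)
  have eq: "(\<Sum>n<Suc N. \<Phi> ((p(N := i)) n) j) - real (Suc N) *\<^sub>R \<mu> j
      = ((\<Sum>n<N. \<Phi> (p n) j) - real N *\<^sub>R \<mu> j) + \<Phi> i j - \<mu> j" for j
    by (simp add: algebra_simps)
  have "(\<Sum>j\<in>J. (norm ((\<Sum>n<Suc N. \<Phi> ((p(N := i)) n) j) - real (Suc N) *\<^sub>R \<mu> j))\<^sup>2) \<le> real (Suc N) * \<rho>"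
    unfolding eq using step le by (simp add: algebra_simps)
  then show ?case
    using p i by (intro exI[of _ "p(N := i)"]) (auto simp: \<mu>_def less_Suc_eq)
qed

text \<open>
  The \<open>4 d\<close> vectors \<open>i\<^sup>q e\<^sub>l\<close>, enumerated by \<open>4 l + q\<close>. On the coordinates below \<open>d\<close> the atom with index
  \<open>4 d\<close> is the zero vector; it takes up the weight that a convex combination has left.
\<close>
definition atom :: "nat \<Rightarrow> nat \<Rightarrow> complex" where
  "atom i l = (if l = i div 4 then \<i> ^ (i mod 4) else 0)"

text \<open>
  The list holds the multiplicities of the atoms. Averages that differ only in the order of their
  terms are thereby counted once, which is responsible for \<open>ln (e d / k)\<close> instead of \<open>ln d\<close> in the size of
  the net.
\<close>
definition empirical_vector :: "real \<Rightarrow> nat list \<Rightarrow> nat \<Rightarrow> complex" where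
  "empirical_vector R xs l =
     complex_of_real (R / real (sum_list xs)) * (\<Sum>i<length xs. of_nat (xs ! i) * atom i l)"

definition empirical_net :: "nat \<Rightarrow> real \<Rightarrow> nat \<Rightarrow> (nat \<Rightarrow> complex) set" where
  "empirical_net d R N = empirical_vector R ` {xs. length xs = 4 * d + 1 \<and> sum_list xs = N}"

lemma finite_empirical_net: "finite (empirical_net d R N)"
proof -
  have "{xs. length xs = 4 * d + 1 \<and> sum_list xs = N} \<subseteq> {xs. set xs \<subseteq> {..N} \<and> length xs = 4 * d + 1}"
    using member_le_sum_list by fastforce
  then show ?thesis
    unfolding empirical_net_def
    by (intro finite_imageI finite_subset[OF _ finite_lists_length_eq[of "{..N}"]]) auto
qed

lemma card_empirical_net_le: "card (empirical_net d R N) \<le> (N + 4 * d) choose N"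
proof -
  have "finite {xs. length xs = 4 * d + 1 \<and> sum_list xs = N}"
    by (rule finite_subset[OF _ finite_lists_length_eq[of "{..N}" "4 * d + 1"]])
       (use member_le_sum_list in fastforce)+
  then have "card (empirical_net d R N) \<le> card {xs. length xs = 4 * d + 1 \<and> sum_list xs = N}"
    unfolding empirical_net_def by (rule card_image_le)
  then show ?thesis by (simp add: card_length_sum_list)
qed

text \<open>
  The \<open>N\<close>-th term of the binomial expansion of \<open>(1 + x)\<^sup>N\<^sup>+\<^sup>n\<close> at \<open>x = N / n\<close>.
\<close>
lemma binomial_le_exp:
  assumes "1 \<le> N" "1 \<le> n"
  shows "real ((N + n) choose N) \<le> (real n / real N) ^ N * exp (real N + (real N)\<^sup>2 / real n)"
proof -
  define x where "x = real N / real n"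
  have x: "x > 0" using assms by (simp add: x_def)
  have "real ((N + n) choose N) * x ^ N = (\<Sum>k\<in>{N}. real ((N + n) choose k) * x ^ k * 1 ^ (N + n - k))"
    by simp
  also have "\<dots> \<le> (\<Sum>k\<le>N + n. real ((N + n) choose k) * x ^ k * 1 ^ (N + n - k))"
    using x by (intro sum_mono2) auto
  also have "\<dots> = (x + 1) ^ (N + n)"
    by (rule binomial_ring[symmetric])
  also have "\<dots> \<le> exp x ^ (N + n)"
    using x exp_ge_add_one_self[of x, unfolded add.commute[of 1]] by (intro power_mono) auto
  also have "\<dots> = exp (real N + (real N)\<^sup>2 / real n)"
    using assms by (simp add: x_def power2_eq_square field_simps flip: exp_of_nat_mult)
  finally have "real ((N + n) choose N) \<le> exp (real N + (real N)\<^sup>2 / real n) / x ^ N"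
    using x by (simp add: pos_le_divide_eq)
  then show ?thesis by (simp add: x_def power_divide mult.commute)
qed

lemma card_empirical_net_le_exp:
  assumes k: "1 \<le> k" "k \<le> d" and L: "4 \<le> L"
  shows "real (card (empirical_net d R (L * k)))
    \<le> exp (real (L * (L + 1)) * (real k * ln (exp 1 * real d / real k)))"
proof -
  define q where "q = real d / real k"
  have q: "q \<ge> 1" using k by (simp add: q_def)
  have "real (card (empirical_net d R (L * k))) \<le> real ((L * k + 4 * d) choose (L * k))"
    using card_empirical_net_le by simp
  also have "\<dots> \<le> (real (4 * d) / real (L * k)) ^ (L * k) * exp (real (L * k) + (real (L * k))\<^sup>2 / real (4 * d))"
    using k L by (intro binomial_le_exp) auto
  also have "\<dots> \<le> q ^ (L * k) * exp (real (L * k) + real (L * k) * real L)"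
  proof (intro mult_mono power_mono)
    show "real (4 * d) / real (L * k) \<le> q"
      using k L by (simp add: q_def field_simps)
    have "real L * real k \<le> real L * real (4 * d)"
      using k by (intro mult_left_mono) auto
    then have "real (L * k) * real (L * k) \<le> real (L * k) * (real L * real (4 * d))"
      by (intro mult_left_mono) auto
    then have "(real (L * k))\<^sup>2 / real (4 * d) \<le> real (L * k) * real L"
      using k by (simp add: power2_eq_square divide_le_eq mult_ac)
    then show "exp (real (L * k) + (real (L * k))\<^sup>2 / real (4 * d)) \<le> exp (real (L * k) + real (L * k) * real L)"
      by simp
  qed (use q in auto)
  also have "q ^ (L * k) = exp (real (L * k) * ln q)"
    using q by (simp only: exp_of_nat_mult) simp
  also have "exp (real (L * k) * ln q) * exp (real (L * k) + real (L * k) * real L)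
      = exp (real (L * k) * (ln q + 1 + real L))"
    by (simp add: algebra_simps flip: exp_add)
  also have "\<dots> \<le> exp (real (L * k) * ((real L + 1) * (1 + ln q)))"
  proof -
    have "ln q + 1 + real L \<le> (real L + 1) * (1 + ln q)"
      using q by (simp add: algebra_simps)
    then show ?thesis by (simp only: exp_le_cancel_iff) (intro mult_left_mono, auto)
  qed
  also have "1 + ln q = ln (exp 1 * real d / real k)"
    using k by (simp add: q_def ln_div ln_mult)
  finally show ?thesis by (simp add: algebra_simps)
qed

lemma sum_lessThan_4_mult: "(\<Sum>i<4 * d. f i) = (\<Sum>l<d. f (4 * l) + f (4 * l + 1) + f (4 * l + 2) + f (4 * l + 3))"
  for f :: "nat \<Rightarrow> 'b::comm_monoid_add"
proof (induction d)
  case (Suc d)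
  have "4 * Suc d = Suc (Suc (Suc (Suc (4 * d))))" by simp
  then show ?case using Suc by (simp add: add.assoc eval_nat_numeral)
qed simp

text \<open>
  The weights are the positive and negative parts of the real and imaginary parts of the
  coordinates, divided by \<open>R\<close>. Their sum is at most \<open>2 \<parallel>v\<parallel>\<^sub>1 / R\<close>, whence the factor \<open>1 / 2\<close>.
\<close>
lemma convex_combination_of_atoms:
  assumes R: "0 < R" and v: "norm_1 d v \<le> R / 2"
  obtains w where "\<And>i. i < 4 * d + 1 \<Longrightarrow> 0 \<le> w i" and "(\<Sum>i<4 * d + 1. w i) = 1"
    and "\<And>l. l < d \<Longrightarrow> (\<Sum>i<4 * d + 1. w i *\<^sub>R (complex_of_real R * atom i l)) = v l"
proof -
  define u where "u z q = max 0 (Re (z * (- \<i>) ^ q))" for z q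
  have pow: "\<i> ^ 2 = -1" "\<i> ^ 3 = - \<i>" "(- \<i>) ^ 2 = -1" "(- \<i>) ^ 3 = \<i>"
    by (simp_all add: power3_eq_cube)
  have mods: "4 * l mod 4 = 0" "4 * l div 4 = l" "(4 * l + 1) mod 4 = 1" "(4 * l + 2) mod 4 = 2" "(4 * l + 3) mod 4 = 3"
    "(4 * l + 1) div 4 = l" "(4 * l + 2) div 4 = l" "(4 * l + 3) div 4 = l" for l :: nat
    by presburger+
  define s where "s = (\<Sum>l<d. u (v l) 0 + u (v l) 1 + u (v l) 2 + u (v l) 3)"
  define w where "w i = (if i = 4 * d then 1 - s / R else u (v (i div 4)) (i mod 4) / R)" for i
  have "u z 0 + u z 1 + u z 2 + u z 3 \<le> 2 * cmod z" for z
    using abs_Re_le_cmod[of z] abs_Im_le_cmod[of z] unfolding u_def pow by (auto simp: max_def)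
  then have "s \<le> (\<Sum>l<d. 2 * cmod (v l))"
    unfolding s_def by (intro sum_mono)
  also have "\<dots> \<le> R" using v by (simp add: norm_1_def flip: sum_distrib_left)
  finally have s: "s \<le> R" .
  have w4: "w (4 * l) = u (v l) 0 / R" "w (4 * l + 1) = u (v l) 1 / R"
    "w (4 * l + 2) = u (v l) 2 / R" "w (4 * l + 3) = u (v l) 3 / R" if "l < d" for l
  proof -
    have "4 * l \<noteq> 4 * d" "4 * l + 1 \<noteq> 4 * d" "4 * l + 2 \<noteq> 4 * d" "4 * l + 3 \<noteq> 4 * d"
      using that by presburger+
    then show "w (4 * l) = u (v l) 0 / R" "w (4 * l + 1) = u (v l) 1 / R"
      "w (4 * l + 2) = u (v l) 2 / R" "w (4 * l + 3) = u (v l) 3 / R"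
      by (simp_all only: w_def mods if_False)
  qed
  have sum_w: "(\<Sum>i<4 * d. w i *\<^sub>R h i) = (\<Sum>l<d. (u (v l) 0 / R) *\<^sub>R h (4 * l) + (u (v l) 1 / R) *\<^sub>R h (4 * l + 1)
      + (u (v l) 2 / R) *\<^sub>R h (4 * l + 2) + (u (v l) 3 / R) *\<^sub>R h (4 * l + 3))" for h :: "nat \<Rightarrow> 'b::real_vector"
    unfolding sum_lessThan_4_mult by (intro sum.cong refl) (simp only: w4 lessThan_iff)
  show thesis
  proof
    show "0 \<le> w i" if "i < 4 * d + 1" for i
      using R s by (simp add: w_def u_def)
    have "(\<Sum>i<4 * d. w i) = s / R"
      using sum_w[of "\<lambda>_. 1 :: real"] by (simp add: s_def sum_divide_distrib add_divide_distrib)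
    then show "(\<Sum>i<4 * d + 1. w i) = 1" by (simp add: w_def)
    show "(\<Sum>i<4 * d + 1. w i *\<^sub>R (complex_of_real R * atom i l)) = v l" if l: "l < d" for l
    proof -
      have "u z 0 + u z 1 * \<i> + u z 2 * (-1) + u z 3 * (-\<i>) = z" for z
        unfolding u_def pow by (auto simp: max_def complex_eq_iff)
      note z = this
      have "(\<Sum>i<4 * d + 1. w i *\<^sub>R (complex_of_real R * atom i l)) = (\<Sum>i<4 * d. w i *\<^sub>R (complex_of_real R * atom i l))"
        using l by (simp add: atom_def)
      also have "\<dots> = (\<Sum>l'<d. if l' = l then v l else 0)"
        unfolding sum_w
      proof (intro sum.cong refl)
        fix l'
        show "(u (v l') 0 / R) *\<^sub>R (complex_of_real R * atom (4 * l') l) + (u (v l') 1 / R) *\<^sub>R (complex_of_real R * atom (4 * l' + 1) l)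
          + (u (v l') 2 / R) *\<^sub>R (complex_of_real R * atom (4 * l' + 2) l) + (u (v l') 3 / R) *\<^sub>R (complex_of_real R * atom (4 * l' + 3) l)
          = (if l' = l then v l else 0)"
          using z[of "v l"] R unfolding atom_def mods pow by (auto simp: scaleR_conv_of_real)
      qed
      also have "\<dots> = v l" using l by simp
      finally show ?thesis .
    qed
  qed
qed

lemma sum_eq_sum_count:
  fixes h :: "'i \<Rightarrow> 'b::real_algebra_1" and N :: nat
  assumes "finite I" and "\<And>n. n < N \<Longrightarrow> p n \<in> I"
  shows "(\<Sum>n<N. h (p n)) = (\<Sum>i\<in>I. of_nat (card {n. n < N \<and> p n = i}) * h i)"
proof -
  have "(\<Sum>n<N. h (p n)) = (\<Sum>i\<in>I. \<Sum>n\<in>{n \<in> {..<N}. p n = i}. h (p n))"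
    using assms by (intro sum.group[symmetric]) auto
  also have "\<dots> = (\<Sum>i\<in>I. \<Sum>n\<in>{n \<in> {..<N}. p n = i}. h i)"
    by (intro sum.cong refl) auto
  also have "\<dots> = (\<Sum>i\<in>I. of_nat (card {n. n < N \<and> p n = i}) * h i)"
    by simp
  finally show ?thesis .
qed

lemma cip_atom:
  assumes "i < 4 * d + 1"
  shows "cip d u (atom i) = (if i < 4 * d then cnj (u (i div 4)) * \<i> ^ (i mod 4) else 0)"
proof -
  have "cip d u (atom i) = (\<Sum>l<d. if l = i div 4 then cnj (u (i div 4)) * \<i> ^ (i mod 4) else 0)"
    unfolding cip_def by (intro sum.cong refl) (auto simp: atom_def)
  also have "\<dots> = (if i div 4 < d then cnj (u (i div 4)) * \<i> ^ (i mod 4) else 0)"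
    by simp
  also have "i div 4 < d \<longleftrightarrow> i < 4 * d" by auto
  finally show ?thesis .
qed

text \<open>
  Maurey's selection in the product of \<open>\<complex>\<^sup>d\<close> and \<open>\<complex>\<^sup>m\<close>, with a vector \<open>v\<close> embedded as \<open>(v, A v / sqrt b)\<close>.
  A multiple \<open>R i\<^sup>q e\<^sub>l\<close> of an atom has squared norm at most \<open>2 R\<^sup>2\<close> there, because \<open>A e\<^sub>l\<close> is a column of \<open>A\<close>.
  One and the same average is therefore close to \<open>v\<close> and has close measurements.
\<close>
lemma empirical_net_approximation:
  fixes A :: "nat \<Rightarrow> nat \<Rightarrow> complex"
  assumes R: "0 < R" and N: "1 \<le> N" and v: "norm_1 d v \<le> R / 2" and b: "0 < b"
    and A: "\<And>l. l < d \<Longrightarrow> (\<Sum>j<m. (cmod (A j l))\<^sup>2) \<le> b"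
  obtains v' where "v' \<in> empirical_net d R N"
    and "(\<Sum>l<d. (cmod (v l - v' l))\<^sup>2) \<le> 2 * R\<^sup>2 / real N"
    and "(\<Sum>j<m. (cmod (cip d (A j) v - cip d (A j) v'))\<^sup>2) \<le> b * (2 * R\<^sup>2 / real N)"
proof -
  obtain w where w0: "\<And>i. i < 4 * d + 1 \<Longrightarrow> 0 \<le> w i" and w1: "(\<Sum>i<4 * d + 1. w i) = 1"
    and wv: "\<And>l. l < d \<Longrightarrow> (\<Sum>i<4 * d + 1. w i *\<^sub>R (complex_of_real R * atom i l)) = v l"
    using convex_combination_of_atoms[OF R v] by blast
  define I where "I = {..<4 * d + 1}"
  define J where "J = {..<d} <+> {..<m}"
  define \<Phi> where "\<Phi> i j = (case j of Inl l \<Rightarrow> complex_of_real R * atom i l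
      | Inr j \<Rightarrow> complex_of_real (R / sqrt b) * cip d (A j) (atom i))" for i and j :: "nat + nat"
  have sumJ: "(\<Sum>j\<in>J. h j) = (\<Sum>l<d. h (Inl l)) + (\<Sum>j<m. h (Inr j))" for h :: "nat + nat \<Rightarrow> real"
    unfolding J_def by (simp add: sum.Plus)
  have norm_i: "cmod (\<i> ^ q) = 1" for q by (simp add: norm_power)
  have \<rho>: "(\<Sum>j\<in>J. (norm (\<Phi> i j))\<^sup>2) \<le> 2 * R\<^sup>2" if i: "i \<in> I" for i
  proof -
    have "(\<Sum>l<d. (norm (\<Phi> i (Inl l)))\<^sup>2) = (\<Sum>l<d. if l = i div 4 then R\<^sup>2 else 0)"
      by (intro sum.cong refl) (auto simp: \<Phi>_def atom_def norm_mult norm_i)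
    also have "\<dots> \<le> R\<^sup>2" by simp
    finally have 1: "(\<Sum>l<d. (norm (\<Phi> i (Inl l)))\<^sup>2) \<le> R\<^sup>2" .
    have 2: "(\<Sum>j<m. (norm (\<Phi> i (Inr j)))\<^sup>2) \<le> R\<^sup>2"
    proof (cases "i < 4 * d")
      case True
      then have l: "i div 4 < d" by auto
      have "(\<Sum>j<m. (norm (\<Phi> i (Inr j)))\<^sup>2) = R\<^sup>2 / b * (\<Sum>j<m. (cmod (A j (i div 4)))\<^sup>2)"
        unfolding sum_distrib_left using True b
        by (intro sum.cong refl)
           (simp add: \<Phi>_def cip_atom norm_mult norm_divide norm_i power_mult_distrib power_divide)
      also have "\<dots> \<le> R\<^sup>2 / b * b"
        using b by (intro mult_left_mono A l) auto
      finally show ?thesis using b by simp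
    next
      case False
      then show ?thesis using i by (simp add: \<Phi>_def cip_atom I_def)
    qed
    show ?thesis unfolding sumJ using 1 2 by simp
  qed
  obtain p where p: "\<And>n. n < N \<Longrightarrow> p n \<in> I" and
    le: "(\<Sum>j\<in>J. (norm ((\<Sum>n<N. \<Phi> (p n) j) - real N *\<^sub>R (\<Sum>i\<in>I. w i *\<^sub>R \<Phi> i j)))\<^sup>2) \<le> real N * (2 * R\<^sup>2)"
  proof -
    have w: "0 \<le> w i" if "i \<in> I" for i
      using w0 w1 that by (simp_all only: I_def lessThan_iff)
    have "finite I" "sum w I = 1"
      using w1 by (simp_all only: I_def finite_lessThan)
    then have "\<exists>p. (\<forall>n<N. p n \<in> I) \<and>
        (\<Sum>j\<in>J. (norm ((\<Sum>n<N. \<Phi> (p n) j) - real N *\<^sub>R (\<Sum>i\<in>I. w i *\<^sub>R \<Phi> i j)))\<^sup>2) \<le> real N * (2 * R\<^sup>2)"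
      by (intro maurey_selection w \<rho>)
    then show ?thesis using that by blast
  qed
  define xs where "xs = map (\<lambda>i. card {n. n < N \<and> p n = i}) [0..<4 * d + 1]"
  have len: "length xs = 4 * d + 1" by (simp add: xs_def)
  have nth: "xs ! i = card {n. n < N \<and> p n = i}" if "i < 4 * d + 1" for i
    using that by (simp add: xs_def del: upt_Suc)
  have "real N = (\<Sum>i\<in>I. real (card {n. n < N \<and> p n = i}))"
    using sum_eq_sum_count[of I N p "\<lambda>_. 1 :: real"] p by (simp add: I_def)
  then have "N = (\<Sum>i\<in>I. card {n. n < N \<and> p n = i})"
    by (simp only: of_nat_sum[symmetric] of_nat_eq_iff)
  then have sum_xs: "sum_list xs = N"
    by (simp add: xs_def I_def sum_list_sum_nth atLeast0LessThan del: upt_Suc)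
  define v' where "v' = empirical_vector R xs"
  have v'_net: "v' \<in> empirical_net d R N"
    unfolding v'_def empirical_net_def using len sum_xs by auto
  have v'_eq: "v' l = complex_of_real (R / real N) * (\<Sum>i\<in>I. of_nat (card {n. n < N \<and> p n = i}) * atom i l)" for l
    unfolding v'_def empirical_vector_def sum_xs len I_def
    by (intro arg_cong2[where f="(*)"] refl sum.cong) (simp add: nth)
  have N0: "complex_of_real (real N) \<noteq> 0" using N by simp
  have L: "(\<Sum>n<N. \<Phi> (p n) (Inl l)) - real N *\<^sub>R (\<Sum>i\<in>I. w i *\<^sub>R \<Phi> i (Inl l)) = of_real (real N) * (v' l - v l)"
    if "l < d" for l
  proof -
    have "(\<Sum>n<N. \<Phi> (p n) (Inl l)) = of_real (real N) * v' l"
    proof -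
      have "(\<Sum>n<N. \<Phi> (p n) (Inl l)) = (\<Sum>i\<in>I. of_nat (card {n. n < N \<and> p n = i}) * \<Phi> i (Inl l))"
        by (rule sum_eq_sum_count) (use p in \<open>simp_all add: I_def\<close>)
      also have "\<dots> = of_real R * (\<Sum>i\<in>I. of_nat (card {n. n < N \<and> p n = i}) * atom i l)"
        unfolding sum_distrib_left by (intro sum.cong refl) (simp add: \<Phi>_def)
      also have "\<dots> = of_real (real N) * v' l"
        unfolding v'_eq using N0 by simp
      finally show ?thesis .
    qed
    moreover have "(\<Sum>i\<in>I. w i *\<^sub>R \<Phi> i (Inl l)) = v l"
      using wv[OF that] by (simp add: \<Phi>_def I_def)
    ultimately show ?thesis by (simp add: scaleR_conv_of_real algebra_simps)
  qed
  have Rr: "(\<Sum>n<N. \<Phi> (p n) (Inr j)) - real N *\<^sub>R (\<Sum>i\<in>I. w i *\<^sub>R \<Phi> i (Inr j))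
      = of_real (real N / sqrt b) * (cip d (A j) v' - cip d (A j) v)" for j
  proof -
    have eq: "\<Phi> i (Inr j) = of_real (1 / sqrt b) * (\<Sum>l<d. cnj (A j l) * \<Phi> i (Inl l))" for i
      by (simp add: \<Phi>_def cip_def sum_distrib_left mult_ac)
    have "(\<Sum>n<N. \<Phi> (p n) (Inr j)) - real N *\<^sub>R (\<Sum>i\<in>I. w i *\<^sub>R \<Phi> i (Inr j))
      = of_real (1 / sqrt b) * (\<Sum>l<d. cnj (A j l) * ((\<Sum>n<N. \<Phi> (p n) (Inl l)) - real N *\<^sub>R (\<Sum>i\<in>I. w i *\<^sub>R \<Phi> i (Inl l))))"
    proof -
      have 1: "(\<Sum>n<N. \<Phi> (p n) (Inr j)) = of_real (1 / sqrt b) * (\<Sum>l<d. cnj (A j l) * (\<Sum>n<N. \<Phi> (p n) (Inl l)))"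
        unfolding eq by (simp only: sum_distrib_left sum.swap[of _ "{..<d}"])
      have 2: "(\<Sum>i\<in>I. w i *\<^sub>R \<Phi> i (Inr j))
          = of_real (1 / sqrt b) * (\<Sum>l<d. cnj (A j l) * (\<Sum>i\<in>I. w i *\<^sub>R \<Phi> i (Inl l)))"
        unfolding eq
        by (simp only: sum_distrib_left scaleR_sum_right mult_scaleR_right sum.swap[of _ "{..<d}"])
      have 3: "c * (\<Sum>l<d. cnj (A j l) * S l) - r *\<^sub>R (c * (\<Sum>l<d. cnj (A j l) * T l))
          = c * (\<Sum>l<d. cnj (A j l) * (S l - r *\<^sub>R T l))" for c r and S T :: "nat \<Rightarrow> complex"
        by (simp add: scaleR_conv_of_real right_diff_distrib sum_subtractf sum_distrib_left mult_ac)
      show ?thesis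
        unfolding 1 2 by (rule 3)
    qed
    also have "\<dots> = of_real (1 / sqrt b) * (\<Sum>l<d. cnj (A j l) * (of_real (real N) * (v' l - v l)))"
      by (intro arg_cong2[where f="(*)"] refl sum.cong) (simp add: L)
    also have "\<dots> = of_real (real N / sqrt b) * (cip d (A j) v' - cip d (A j) v)"
      by (simp add: cip_def sum_distrib_left right_diff_distrib sum_subtractf mult_ac)
    finally show ?thesis .
  qed
  have "(\<Sum>l<d. (cmod (of_real (real N) * (v' l - v l)))\<^sup>2)
      + (\<Sum>j<m. (cmod (of_real (real N / sqrt b) * (cip d (A j) v' - cip d (A j) v)))\<^sup>2) \<le> real N * (2 * R\<^sup>2)"
  proof -
    have "(\<Sum>l<d. (norm ((\<Sum>n<N. \<Phi> (p n) (Inl l)) - real N *\<^sub>R (\<Sum>i\<in>I. w i *\<^sub>R \<Phi> i (Inl l))))\<^sup>2)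
        = (\<Sum>l<d. (cmod (of_real (real N) * (v' l - v l)))\<^sup>2)"
      by (intro sum.cong refl) (simp only: L lessThan_iff)
    then show ?thesis using le unfolding sumJ Rr by simp
  qed
  also have "(\<Sum>l<d. (cmod (of_real (real N) * (v' l - v l)))\<^sup>2) = (real N)\<^sup>2 * (\<Sum>l<d. (cmod (v l - v' l))\<^sup>2)"
    unfolding sum_distrib_left norm_minus_commute[of "v _"]
    by (intro sum.cong refl) (simp add: norm_mult power_mult_distrib)
  also have "(\<Sum>j<m. (cmod (of_real (real N / sqrt b) * (cip d (A j) v' - cip d (A j) v)))\<^sup>2)
      = (real N)\<^sup>2 * ((\<Sum>j<m. (cmod (cip d (A j) v - cip d (A j) v'))\<^sup>2) / b)"
    unfolding sum_divide_distrib sum_distrib_left norm_minus_commute[of "cip d _ v"]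
    using b by (intro sum.cong refl) (simp add: norm_mult norm_divide power_mult_distrib power_divide)
  finally have "real N * (real N * ((\<Sum>l<d. (cmod (v l - v' l))\<^sup>2)
      + (\<Sum>j<m. (cmod (cip d (A j) v - cip d (A j) v'))\<^sup>2) / b)) \<le> real N * (2 * R\<^sup>2)"
    by (simp only: power2_eq_square distrib_left mult.assoc)
  then have both: "(\<Sum>l<d. (cmod (v l - v' l))\<^sup>2)
      + (\<Sum>j<m. (cmod (cip d (A j) v - cip d (A j) v'))\<^sup>2) / b \<le> 2 * R\<^sup>2 / real N"
    using N by (simp add: pos_le_divide_eq mult.commute)
  have nn: "0 \<le> (\<Sum>l<d. (cmod (v l - v' l))\<^sup>2)" "0 \<le> (\<Sum>j<m. (cmod (cip d (A j) v - cip d (A j) v'))\<^sup>2) / b"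
    using b by (auto intro!: sum_nonneg divide_nonneg_pos)
  show thesis
  proof
    show "(\<Sum>l<d. (cmod (v l - v' l))\<^sup>2) \<le> 2 * R\<^sup>2 / real N" using both nn by linarith
    have "(\<Sum>j<m. (cmod (cip d (A j) v - cip d (A j) v'))\<^sup>2) / b \<le> 2 * R\<^sup>2 / real N" using both nn by linarith
    then show "(\<Sum>j<m. (cmod (cip d (A j) v - cip d (A j) v'))\<^sup>2) \<le> b * (2 * R\<^sup>2 / real N)"
      using b by (simp add: pos_divide_le_eq mult.commute)
  qed (rule v'_net)
qed

section \<open>Uniform small-ball property\<close>

lemma norm_2_power2: "(norm_2 n x)\<^sup>2 = (\<Sum>l<n. (norm (x l))\<^sup>2)"
  by (simp add: norm_2_def L2_set_def sum_nonneg)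

lemma norm_2_nonneg: "0 \<le> norm_2 n x"
  by (simp add: norm_2_def)

lemma norm_2_triangle: "norm_2 n (\<lambda>l. x l + y l) \<le> norm_2 n x + norm_2 n y"
  unfolding norm_2_def
  by (rule order.trans[OF L2_set_mono L2_set_triangle_ineq]) (auto intro: norm_triangle_ineq)

lemma norm_2_minus_commute: "norm_2 n (\<lambda>l. x l - y l) = norm_2 n (\<lambda>l. y l - x l)"
  by (simp add: norm_2_def norm_minus_commute)

lemma norm_2_cmult: "norm_2 n (\<lambda>l. c * x l) = cmod c * norm_2 n x" for x :: "nat \<Rightarrow> complex"
  by (simp add: norm_2_def norm_mult L2_set_right_distrib)

lemma norm_1_cmult: "norm_1 n (\<lambda>l. c * x l) = cmod c * norm_1 n x"
  by (simp add: norm_1_def norm_mult sum_distrib_left)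

lemma cip_linear:
  "cip n u (\<lambda>l. v l + w l) = cip n u v + cip n u w"
  "cip n u (\<lambda>l. v l - w l) = cip n u v - cip n u w"
  "cip n u (\<lambda>l. c * v l) = c * cip n u v"
  "cip n (\<lambda>l. v l + w l) u = cip n v u + cip n w u"
  "cip n (\<lambda>l. v l - w l) u = cip n v u - cip n w u"
  "cip n (\<lambda>l. c * v l) u = cnj c * cip n v u"
  by (simp_all add: cip_def algebra_simps sum.distrib sum_subtractf sum_distrib_left)

lemma cip_commute: "cip n u v = cnj (cip n v u)"
  by (simp add: cip_def mult.commute)

lemma cip_self: "cip n u u = complex_of_real ((norm_2 n u)\<^sup>2)"
  unfolding norm_2_power2 cip_def of_real_sum
  by (intro sum.cong refl) (simp only: complex_norm_square mult.commute)

lemma cmod_cip_le_norm_2: "cmod (cip n f g) \<le> norm_2 n f * norm_2 n g"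
  using cmod_cip_le[of n f g]
  by (intro power2_le_imp_le[OF _ mult_nonneg_nonneg])
     (simp_all only: power_mult_distrib norm_2_power2 norm_2_nonneg)

lemma sum_abs_le_sqrt_card:
  assumes "finite T"
  shows "(\<Sum>l\<in>T. \<bar>y l\<bar>) \<le> sqrt (real (card T)) * L2_set y T"
  using L2_set_mult_ineq[of y "\<lambda>_. 1" T] by (simp add: L2_set_def mult.commute)

lemma card_large_entries:
  fixes y :: "nat \<Rightarrow> complex"
  assumes "0 < \<tau>" and "(\<Sum>j<m. (cmod (y j))\<^sup>2) \<le> c * \<tau>\<^sup>2"
  shows "real (card {j. j < m \<and> \<tau> < cmod (y j)}) \<le> c"
proof -
  have "real (card {j. j < m \<and> \<tau> < cmod (y j)}) * \<tau>\<^sup>2 = (\<Sum>j\<in>{j. j < m \<and> \<tau> < cmod (y j)}. \<tau>\<^sup>2)"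
    by simp
  also have "\<dots> \<le> (\<Sum>j\<in>{j. j < m \<and> \<tau> < cmod (y j)}. (cmod (y j))\<^sup>2)"
    using assms(1) by (intro sum_mono power_mono) auto
  also have "\<dots> \<le> (\<Sum>j<m. (cmod (y j))\<^sup>2)"
    by (intro sum_mono2) auto
  finally have "real (card {j. j < m \<and> \<tau> < cmod (y j)}) * \<tau>\<^sup>2 \<le> c * \<tau>\<^sup>2"
    using assms(2) by simp
  then show ?thesis using assms(1) by simp
qed

text \<open>
  The pairs \<open>(\<langle>a, f\<rangle>, \<langle>a, g\<rangle>)\<close> at which a row detects the difference of two phaseless signals.
\<close>
definition correlated_values :: "real \<Rightarrow> real \<Rightarrow> (complex \<times> complex) set" where
  "correlated_values s B = {z. s \<le> \<bar>Re (cnj (fst z) * snd z)\<bar> \<and> cmod (fst z) \<le> B \<and> cmod (snd z) \<le> B}"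

lemma correlated_values_borel: "correlated_values s B \<in> sets borel"
  unfolding correlated_values_def
  by (intro borel_closed closed_Collect_conj closed_Collect_le continuous_intros)

text \<open>
  Within the distance \<open>\<tau> = min B (s / (6 B))\<close> the moduli at most double, and the product changes by at
  most \<open>2 B \<tau> + B \<tau> \<le> s / 2\<close>.
\<close>
lemma correlated_values_perturb:
  assumes uv: "(u, v) \<in> correlated_values s B" and B: "0 < B" and s: "0 < s"
    and u: "cmod (u' - u) \<le> min B (s / (6 * B))" and v: "cmod (v' - v) \<le> min B (s / (6 * B))"
  shows "(u', v') \<in> correlated_values (s / 2) (2 * B)"
proof -
  define \<tau> where "\<tau> = min B (s / (6 * B))"
  have \<tau>: "0 < \<tau>" "\<tau> \<le> B" "3 * B * \<tau> \<le> s / 2"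
    using B s by (auto simp: \<tau>_def min_def field_simps)
  have uB: "cmod u \<le> B" "cmod v \<le> B" and suv: "s \<le> \<bar>Re (cnj u * v)\<bar>"
    using uv by (auto simp: correlated_values_def)
  have u'B: "cmod u' \<le> 2 * B" and v'B: "cmod v' \<le> 2 * B"
    using norm_triangle_sub[of u' u] norm_triangle_sub[of v' v] uB u v \<tau> by (auto simp: \<tau>_def)
  have "cnj u' * v' - cnj u * v = cnj (u' - u) * v' + cnj u * (v' - v)"
    by (simp add: algebra_simps)
  then have "cmod (cnj u' * v' - cnj u * v) \<le> cmod (u' - u) * cmod v' + cmod u * cmod (v' - v)"
    by (metis norm_triangle_ineq norm_mult complex_mod_cnj)
  also have "\<dots> \<le> \<tau> * (2 * B) + B * \<tau>"
    using u v uB v'B \<tau> B unfolding \<tau>_def[symmetric] by (intro add_mono mult_mono) auto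
  also have "\<dots> = 3 * B * \<tau>" by simp
  also have "\<dots> \<le> s / 2" by (rule \<tau>)
  finally have "cmod (cnj u' * v' - cnj u * v) \<le> s / 2" .
  then have "\<bar>Re (cnj u' * v') - Re (cnj u * v)\<bar> \<le> s / 2"
    using abs_Re_le_cmod[of "cnj u' * v' - cnj u * v"] by (simp only: minus_complex.sel)
  then have "s / 2 \<le> \<bar>Re (cnj u' * v')\<bar>" using suv by linarith
  then show ?thesis using u'B v'B by (simp add: correlated_values_def)
qed

text \<open>
  Both vectors are replaced by elements of the net at squared distance at most \<open>128 / L \<le> 1 / 100\<close>. Their
  norms change by at most \<open>1 / 10\<close> and their inner product by at most \<open>21 / 100\<close>, so the pair in the net is
  one to which the count applies. A row that is good for this pair is good for \<open>f\<close> and \<open>g\<close>, with worse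
  constants, unless one of the two measurements moved by more than \<open>\<tau> = min B (s / (6 B))\<close>; each of them
  does so for at most \<open>\<delta> m / 4\<close> rows.
\<close>
lemma uniform_small_ball:
  fixes A :: "nat \<Rightarrow> nat \<Rightarrow> complex"
  assumes k: "1 \<le> k" and L: "12800 \<le> L" and s: "0 < s" and B: "0 < B"
    and b: "0 < b" "b * (128 / real L) \<le> \<delta> / 4 * real m * (min B (s / (6 * B)))\<^sup>2"
    and cols: "\<And>l. l < d \<Longrightarrow> (\<Sum>j<m. (cmod (A j l))\<^sup>2) \<le> b"
    and net: "\<And>f g. f \<in> empirical_net d (8 * sqrt k) (L * k) \<Longrightarrow> g \<in> empirical_net d (8 * sqrt k) (L * k) \<Longrightarrow>
      (norm_2 d f)\<^sup>2 \<le> 4 \<Longrightarrow> (norm_2 d g)\<^sup>2 \<le> 4 \<Longrightarrow>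
      1 / 2 \<le> (norm_2 d f)\<^sup>2 * (norm_2 d g)\<^sup>2 - (Im (cip d f g))\<^sup>2 \<Longrightarrow>
      \<delta> * real m \<le> real (card {j. j < m \<and> (cip d (A j) f, cip d (A j) g) \<in> correlated_values s B})"
    and f: "norm_2 d f = 1" "norm_1 d f \<le> 4 * sqrt k" and g: "norm_2 d g = 1" "norm_1 d g \<le> 4 * sqrt k"
    and fg: "Im (cip d f g) = 0"
  shows "\<delta> / 2 * real m \<le> real (card {j. j < m \<and> (cip d (A j) f, cip d (A j) g) \<in> correlated_values (s / 2) (2 * B)})"
proof -
  define \<tau> where "\<tau> = min B (s / (6 * B))"
  have \<tau>: "0 < \<tau>" using B s by (simp add: \<tau>_def)
  define N where "N = L * k"
  have N: "1 \<le> N" using k L by (simp add: N_def)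
  have R: "2 * (8 * sqrt k)\<^sup>2 / real N = 128 / real L"
    using k L by (simp add: N_def power_mult_distrib)
  have approx: "\<exists>v'\<in>empirical_net d (8 * sqrt k) N. norm_2 d (\<lambda>l. v' l - v l) \<le> 1 / 10 \<and>
      real (card {j. j < m \<and> \<tau> < cmod (cip d (A j) v - cip d (A j) v')}) \<le> \<delta> / 4 * real m"
    if v: "norm_1 d v \<le> 4 * sqrt k" for v
  proof -
    have pos: "0 < 8 * sqrt k" and v': "norm_1 d v \<le> 8 * sqrt k / 2" using v k by auto
    obtain v' where v': "v' \<in> empirical_net d (8 * sqrt k) N"
      and 1: "(\<Sum>l<d. (cmod (v l - v' l))\<^sup>2) \<le> 2 * (8 * sqrt k)\<^sup>2 / real N"
      and 2: "(\<Sum>j<m. (cmod (cip d (A j) v - cip d (A j) v'))\<^sup>2) \<le> b * (2 * (8 * sqrt k)\<^sup>2 / real N)"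
      by (rule empirical_net_approximation[OF pos N v' b(1) cols])
    note 1 = 1[unfolded R] and 2 = 2[unfolded R]
    have "128 / real L \<le> (1 / 10)\<^sup>2"
      using L by (simp add: power_divide divide_le_eq)
    then have "(norm_2 d (\<lambda>l. v' l - v l))\<^sup>2 \<le> (1 / 10)\<^sup>2"
      using 1 unfolding norm_2_minus_commute[of d v'] norm_2_power2 by simp
    then have "norm_2 d (\<lambda>l. v' l - v l) \<le> 1 / 10"
      by (rule power2_le_imp_le) simp
    moreover have "real (card {j. j < m \<and> \<tau> < cmod (cip d (A j) v - cip d (A j) v')}) \<le> \<delta> / 4 * real m"
      using 2 b(2) unfolding \<tau>_def[symmetric] by (intro card_large_entries[OF \<tau>]) linarith
    ultimately show ?thesis using v' by blast
  qed
  obtain f' where f': "f' \<in> empirical_net d (8 * sqrt k) N" "norm_2 d (\<lambda>l. f' l - f l) \<le> 1 / 10"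
    "real (card {j. j < m \<and> \<tau> < cmod (cip d (A j) f - cip d (A j) f')}) \<le> \<delta> / 4 * real m"
    using approx[OF f(2)] by blast
  obtain g' where g': "g' \<in> empirical_net d (8 * sqrt k) N" "norm_2 d (\<lambda>l. g' l - g l) \<le> 1 / 10"
    "real (card {j. j < m \<and> \<tau> < cmod (cip d (A j) g - cip d (A j) g')}) \<le> \<delta> / 4 * real m"
    using approx[OF g(2)] by blast
  have norms: "9 / 10 \<le> norm_2 d v'" "norm_2 d v' \<le> 11 / 10"
    if "norm_2 d v = 1" "norm_2 d (\<lambda>l. v' l - v l) \<le> 1 / 10" for v v' :: "nat \<Rightarrow> complex"
    using norm_2_triangle[of d "\<lambda>l. v' l - v l" v] norm_2_triangle[of d "\<lambda>l. v l - v' l" v'] that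
    unfolding norm_2_minus_commute[of d v v'] by simp_all
  note nf = norms[OF f(1) f'(2)] and ng = norms[OF g(1) g'(2)]
  have upper: "(norm_2 d f')\<^sup>2 \<le> 4" "(norm_2 d g')\<^sup>2 \<le> 4"
    using power_mono[OF nf(2) norm_2_nonneg, of 2] power_mono[OF ng(2) norm_2_nonneg, of 2]
    by (simp_all add: power_divide)
  have lower: "81 / 100 \<le> (norm_2 d f')\<^sup>2" "81 / 100 \<le> (norm_2 d g')\<^sup>2"
    using power_mono[OF nf(1), of 2] power_mono[OF ng(1), of 2] by (simp_all add: power_divide)
  have "81 / 100 * (81 / 100) \<le> (norm_2 d f')\<^sup>2 * (norm_2 d g')\<^sup>2"
    using lower by (intro mult_mono) auto
  moreover have "(Im (cip d f' g'))\<^sup>2 \<le> (21 / 100)\<^sup>2"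
  proof -
    have "cip d f' g' - cip d f g = cip d (\<lambda>l. f' l - f l) g' + cip d f (\<lambda>l. g' l - g l)"
      by (simp add: cip_linear)
    then have "cmod (cip d f' g' - cip d f g) \<le> cmod (cip d (\<lambda>l. f' l - f l) g') + cmod (cip d f (\<lambda>l. g' l - g l))"
      by (simp only: norm_triangle_ineq)
    also have "\<dots> \<le> norm_2 d (\<lambda>l. f' l - f l) * norm_2 d g' + norm_2 d f * norm_2 d (\<lambda>l. g' l - g l)"
      by (intro add_mono cmod_cip_le_norm_2)
    also have "\<dots> \<le> 1 / 10 * (11 / 10) + 1 * (1 / 10)"
      using f'(2) g'(2) f(1) ng(2) norm_2_nonneg by (intro add_mono mult_mono) auto
    finally have "\<bar>Im (cip d f' g')\<bar> \<le> 21 / 100"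
      using abs_Im_le_cmod[of "cip d f' g' - cip d f g"] fg by simp
    then show ?thesis by (metis abs_ge_zero power2_abs power_mono)
  qed
  ultimately have "1 / 2 \<le> (norm_2 d f')\<^sup>2 * (norm_2 d g')\<^sup>2 - (Im (cip d f' g'))\<^sup>2"
    by (simp add: power_divide)
  from net[OF f'(1)[unfolded N_def] g'(1)[unfolded N_def] upper this]
  have "\<delta> * real m \<le> real (card {j. j < m \<and> (cip d (A j) f', cip d (A j) g') \<in> correlated_values s B})" .
  also have "{j. j < m \<and> (cip d (A j) f', cip d (A j) g') \<in> correlated_values s B}
    \<subseteq> {j. j < m \<and> (cip d (A j) f, cip d (A j) g) \<in> correlated_values (s / 2) (2 * B)}
      \<union> ({j. j < m \<and> \<tau> < cmod (cip d (A j) f - cip d (A j) f')}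
      \<union> {j. j < m \<and> \<tau> < cmod (cip d (A j) g - cip d (A j) g')})" (is "?G' \<subseteq> ?G \<union> (?F1 \<union> ?F2)")
  proof
    fix j assume j: "j \<in> ?G'"
    show "j \<in> ?G \<union> (?F1 \<union> ?F2)"
    proof (rule ccontr)
      assume n: "j \<notin> ?G \<union> (?F1 \<union> ?F2)"
      then have "cmod (cip d (A j) f - cip d (A j) f') \<le> \<tau>" "cmod (cip d (A j) g - cip d (A j) g') \<le> \<tau>"
        using j by auto
      moreover have "(cip d (A j) f', cip d (A j) g') \<in> correlated_values s B"
        using j by simp
      ultimately have "(cip d (A j) f, cip d (A j) g) \<in> correlated_values (s / 2) (2 * B)"
        unfolding \<tau>_def by (intro correlated_values_perturb[OF _ B s])
      then show False using n j by auto
    qed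
  qed
  then have "card ?G' \<le> card (?G \<union> (?F1 \<union> ?F2))"
    by (intro card_mono) auto
  also have "\<dots> \<le> card ?G + (card ?F1 + card ?F2)"
    by (intro order.trans[OF card_Un_le] add_left_mono card_Un_le)
  finally have "\<delta> * real m \<le> real (card ?G) + (real (card ?F1) + real (card ?F2))"
    by (simp only: of_nat_add[symmetric] of_nat_le_iff)
  then show ?thesis using f'(3) g'(3) by linarith
qed

section \<open>Stable recovery from the small-ball property\<close>

lemma sparse_norm_1_le:
  assumes "sparse d k x"
  shows "norm_1 d x \<le> sqrt k * norm_2 d x"
proof -
  define T where "T = {l. l < d \<and> x l \<noteq> 0}"
  have T: "finite T" "card T \<le> k" using assms by (auto simp: T_def sparse_def)
  have "norm_1 d x = (\<Sum>l\<in>T. \<bar>cmod (x l)\<bar>)"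
    unfolding norm_1_def abs_norm_cancel by (intro sum.mono_neutral_right) (auto simp: T_def)
  also have "\<dots> \<le> sqrt (real (card T)) * L2_set (\<lambda>l. cmod (x l)) T"
    by (rule sum_abs_le_sqrt_card[OF T(1)])
  also have "\<dots> \<le> sqrt k * norm_2 d x"
    unfolding norm_2_def L2_set_def using T
    by (intro mult_mono real_sqrt_le_mono sum_mono2) (auto simp: T_def intro!: sum_nonneg)
  finally show ?thesis .
qed

text \<open>
  Off the support of \<open>u\<close> the difference equals \<open>x\<close>, and its \<open>\<ell>\<^sub>1\<close> norm there is at most that on the support,
  since otherwise \<open>x\<close> would have a larger norm than \<open>u\<close>.
\<close>
lemma descent_cone_norm_1_le:
  assumes u: "sparse d k u" and le: "norm_1 d x \<le> norm_1 d u"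
  shows "norm_1 d (\<lambda>l. x l - u l) \<le> 2 * sqrt k * norm_2 d (\<lambda>l. x l - u l)"
proof -
  define T where "T = {l. l < d \<and> u l \<noteq> 0}"
  define h where "h l = x l - u l" for l
  have T: "finite T" "card T \<le> k" "T \<subseteq> {..<d}" using u by (auto simp: T_def sparse_def)
  have split: "norm_1 d v = (\<Sum>l\<in>T. cmod (v l)) + (\<Sum>l\<in>{..<d} - T. cmod (v l))" for v
    unfolding norm_1_def using sum.subset_diff[OF T(3), of "\<lambda>l. cmod (v l)"] by simp
  have u0: "(\<Sum>l\<in>{..<d} - T. cmod (u l)) = 0" by (intro sum.neutral) (auto simp: T_def)
  have hx: "(\<Sum>l\<in>{..<d} - T. cmod (h l)) = (\<Sum>l\<in>{..<d} - T. cmod (x l))"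
    by (intro sum.cong refl) (auto simp: T_def h_def)
  have "(\<Sum>l\<in>T. cmod (u l)) \<le> (\<Sum>l\<in>T. cmod (x l) + cmod (h l))"
    unfolding h_def by (intro sum_mono) (metis norm_minus_commute norm_triangle_sub)
  then have "norm_1 d h \<le> 2 * (\<Sum>l\<in>T. cmod (h l))"
    using le unfolding split[of h] split[of x] split[of u] u0 hx sum.distrib by linarith
  also have "(\<Sum>l\<in>T. cmod (h l)) \<le> sqrt (real (card T)) * L2_set (\<lambda>l. cmod (h l)) T"
    using sum_abs_le_sqrt_card[OF T(1), of "\<lambda>l. cmod (h l)"] by simp
  also have "\<dots> \<le> sqrt k * norm_2 d h"
    unfolding norm_2_def L2_set_def using T
    by (intro mult_mono real_sqrt_le_mono sum_mono2) (auto intro!: sum_nonneg)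
  finally show ?thesis by (simp add: h_def[abs_def])
qed

text \<open>
  Factor \<open>|p|\<^sup>2 - |q|\<^sup>2 = Re (cnj (p - q) * (p + q))\<close> and divide by
  \<open>|p| + |q| \<le> |p - q| + |p + q| \<le> 2 t B\<close>. The scale \<open>t\<close> cancels, and what remains is proportional to the
  smaller scale \<open>s\<close>.
\<close>
lemma abs_cmod_diff_lower_bound:
  assumes st: "0 \<le> s" "0 < t" "s \<le> t" and B: "0 < B"
    and corr: "(u, v) \<in> correlated_values \<sigma> B"
    and u: "of_real s * u = p - q" and v: "of_real t * v = p + q"
  shows "s * \<sigma> / (2 * B) \<le> \<bar>cmod p - cmod q\<bar>"
proof -
  have uv: "\<sigma> \<le> \<bar>Re (cnj u * v)\<bar>" "cmod u \<le> B" "cmod v \<le> B"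
    using corr by (auto simp: correlated_values_def)
  have "Re (cnj (p - q) * (p + q)) = (cmod p)\<^sup>2 - (cmod q)\<^sup>2"
    unfolding cmod_power2 by (simp add: power2_eq_square algebra_simps)
  moreover have "Re (cnj (p - q) * (p + q)) = s * t * Re (cnj u * v)"
  proof -
    have "cnj (p - q) * (p + q) = complex_of_real (s * t) * (cnj u * v)"
      unfolding u[symmetric] v[symmetric] by simp
    then show ?thesis by (simp only: Re_complex_of_real Im_complex_of_real times_complex.sel)
  qed
  ultimately have "s * t * Re (cnj u * v) = (cmod p - cmod q) * (cmod p + cmod q)"
    by (simp only: power2_eq_square square_diff_square_factored mult.commute)
  then have "s * t * \<bar>Re (cnj u * v)\<bar> = \<bar>cmod p - cmod q\<bar> * (cmod p + cmod q)"
    using st by (metis abs_mult abs_of_nonneg add_nonneg_nonneg less_imp_le norm_ge_zero)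
  moreover have "s * t * \<sigma> \<le> s * t * \<bar>Re (cnj u * v)\<bar>"
    using st uv by (intro mult_left_mono) auto
  moreover have "cmod p + cmod q \<le> t * (2 * B)"
  proof -
    have "2 * cmod p = cmod ((p - q) + (p + q))" "2 * cmod q = cmod ((p + q) - (p - q))"
      by (simp_all flip: mult_2 add: norm_mult)
    then have "cmod p + cmod q \<le> cmod (p - q) + cmod (p + q)"
      using norm_triangle_ineq[of "p - q" "p + q"] norm_triangle_ineq4[of "p + q" "p - q"] by linarith
    also have "\<dots> = s * cmod u + t * cmod v"
      using st by (simp add: norm_mult flip: u v)
    also have "\<dots> \<le> t * B + t * B"
      using st uv by (intro add_mono mult_mono) auto
    finally show ?thesis by (simp add: mult_ac)
  qed
  then have "\<bar>cmod p - cmod q\<bar> * (cmod p + cmod q) \<le> \<bar>cmod p - cmod q\<bar> * (t * (2 * B))"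
    by (intro mult_left_mono) auto
  ultimately have "t * (s * \<sigma>) \<le> t * (\<bar>cmod p - cmod q\<bar> * (2 * B))"
    by (simp add: mult_ac)
  then have "s * \<sigma> \<le> \<bar>cmod p - cmod q\<bar> * (2 * B)"
    using st by (simp only: mult_le_cancel_left_pos)
  then show ?thesis using B by (simp add: divide_le_eq)
qed

text \<open>
  The phase is chosen such that \<open>\<langle>u, x\<rangle> \<ge> 0\<close>. This gives \<open>\<parallel>x - u\<parallel> \<le> \<parallel>x + u\<parallel>\<close> and \<open>\<parallel>u\<parallel> \<le> \<parallel>x + u\<parallel>\<close>, and it makes the inner
  product of \<open>x - u\<close> and \<open>x + u\<close> real.
\<close>
lemma stable_recovery:
  fixes A :: "nat \<Rightarrow> nat \<Rightarrow> complex"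
  assumes B: "0 < B" and \<sigma>: "0 < \<sigma>" and \<mu>: "0 < \<mu>" and m: "0 < m"
    and ball: "\<And>f g. norm_2 d f = 1 \<Longrightarrow> norm_1 d f \<le> 4 * sqrt k \<Longrightarrow> norm_2 d g = 1 \<Longrightarrow>
      norm_1 d g \<le> 4 * sqrt k \<Longrightarrow> Im (cip d f g) = 0 \<Longrightarrow>
      \<mu> * real m \<le> real (card {j. j < m \<and> (cip d (A j) f, cip d (A j) g) \<in> correlated_values \<sigma> B})"
    and sp: "sparse d k x0" and \<eta>: "norm_2 m \<eta> \<le> \<epsilon>"
    and b: "b = (\<lambda>j. cmod (cip d (A j) x0) + \<eta> j)"
    and sol: "l1_solution m d A b \<epsilon> x"
  shows "phase_dist d x x0 \<le> 4 * B / (\<sigma> * sqrt \<mu>) * (\<epsilon> / sqrt (real m))"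
proof -
  have \<epsilon>: "0 \<le> \<epsilon>" using \<eta> norm_2_nonneg order.trans by blast
  define z where "z = cip d x0 x"
  define \<theta> where "\<theta> = Arg2pi z"
  define e where "e = exp (\<i> * complex_of_real \<theta>)"
  have e1: "cmod e = 1" by (simp add: e_def)
  have z: "z = of_real (cmod z) * e"
    unfolding e_def \<theta>_def by (rule Arg2pi_eq)
  define u where "u l = e * x0 l" for l
  define h where "h l = x l - u l" for l
  define w where "w l = x l + u l" for l
  have cu: "cip d v u = e * cip d v x0" for v
    unfolding u_def[abs_def] by (rule cip_linear)
  have ux: "cip d u x = of_real (cmod z)"
  proof -
    have "cip d u x = cnj e * z"
      unfolding u_def[abs_def] z_def by (rule cip_linear)
    also have "\<dots> = of_real (cmod z) * (e * cnj e)"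
      using z by (metis mult.assoc mult.commute)
    also have "e * cnj e = 1" using e1 by (simp add: complex_norm_square[symmetric])
    finally show ?thesis by simp
  qed
  have n1u: "norm_1 d u = norm_1 d x0"
    unfolding u_def[abs_def] norm_1_cmult e1 by simp
  have sp_u: "sparse d k u"
  proof -
    have "e \<noteq> 0" using e1 by auto
    then show ?thesis using sp by (simp add: sparse_def u_def)
  qed
  have feas: "norm_2 m (\<lambda>j. cmod (cip d (A j) x) - b j) \<le> \<epsilon>"
    and opt: "\<And>y. norm_2 m (\<lambda>j. cmod (cip d (A j) y) - b j) \<le> \<epsilon> \<Longrightarrow> norm_1 d x \<le> norm_1 d y"
    using sol unfolding l1_solution_def is_arg_min_def by (auto simp: not_less)
  have "norm_2 m (\<lambda>j. cmod (cip d (A j) x0) - b j) = norm_2 m \<eta>"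
    by (simp add: b norm_2_def)
  then have le1: "norm_1 d x \<le> norm_1 d u"
    using opt[of x0] \<eta> n1u by simp
  have sq: "(norm_2 d h)\<^sup>2 = (norm_2 d x)\<^sup>2 + (norm_2 d u)\<^sup>2 - 2 * cmod z"
    "(norm_2 d w)\<^sup>2 = (norm_2 d x)\<^sup>2 + (norm_2 d u)\<^sup>2 + 2 * cmod z"
  proof -
    have xu: "cip d x u = of_real (cmod z)" using ux cip_commute[of d x u] by simp
    have "complex_of_real ((norm_2 d h)\<^sup>2) = of_real ((norm_2 d x)\<^sup>2 + (norm_2 d u)\<^sup>2 - 2 * cmod z)"
      unfolding cip_self[symmetric] h_def[abs_def] cip_linear ux xu by (simp add: cip_self)
    then show "(norm_2 d h)\<^sup>2 = (norm_2 d x)\<^sup>2 + (norm_2 d u)\<^sup>2 - 2 * cmod z" by (simp only: of_real_eq_iff)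
    have "complex_of_real ((norm_2 d w)\<^sup>2) = of_real ((norm_2 d x)\<^sup>2 + (norm_2 d u)\<^sup>2 + 2 * cmod z)"
      unfolding cip_self[symmetric] w_def[abs_def] cip_linear ux xu by (simp add: cip_self)
    then show "(norm_2 d w)\<^sup>2 = (norm_2 d x)\<^sup>2 + (norm_2 d u)\<^sup>2 + 2 * cmod z" by (simp only: of_real_eq_iff)
  qed
  have hw: "norm_2 d h \<le> norm_2 d w" and uw: "norm_2 d u \<le> norm_2 d w"
    by (rule power2_le_imp_le[OF _ norm_2_nonneg], simp add: sq)+
  have pd: "phase_dist d x x0 \<le> norm_2 d h"
    unfolding phase_dist_def h_def[abs_def] u_def e_def
    by (rule cINF_lower) (auto simp: \<theta>_def Arg2pi_ge_0 Arg2pi_lt_2pi intro!: bdd_belowI2[where m=0] norm_2_nonneg)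
  define s t where "s = norm_2 d h" and "t = norm_2 d w"
  have bound: "s \<le> 4 * B / (\<sigma> * sqrt \<mu>) * (\<epsilon> / sqrt (real m))"
  proof (cases "s = 0")
    case True
    then show ?thesis using B \<sigma> \<mu> \<epsilon> by simp
  next
    case False
    then have s: "0 < s" using norm_2_nonneg[of d h] by (simp add: s_def)
    have t: "0 < t" "s \<le> t" using s hw by (auto simp: s_def t_def)
    have h1: "norm_1 d h \<le> 2 * sqrt k * s"
      unfolding s_def h_def[abs_def] by (rule descent_cone_norm_1_le[OF sp_u le1])
    have w1: "norm_1 d w \<le> 4 * sqrt k * t"
    proof -
      have "norm_1 d w \<le> (\<Sum>l<d. cmod (h l) + 2 * cmod (u l))"
        unfolding norm_1_def
      proof (rule sum_mono)
        fix l
        have "w l = h l + 2 * u l" by (simp add: w_def h_def)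
        then show "cmod (w l) \<le> cmod (h l) + 2 * cmod (u l)"
          using norm_triangle_ineq[of "h l" "2 * u l"] by (simp add: norm_mult)
      qed
      also have "\<dots> = norm_1 d h + 2 * norm_1 d u"
        by (simp add: norm_1_def sum.distrib sum_distrib_left)
      also have "\<dots> \<le> 2 * sqrt k * s + 2 * (sqrt k * norm_2 d u)"
        by (intro add_mono mult_left_mono h1 sparse_norm_1_le sp_u) auto
      also have "\<dots> \<le> 2 * sqrt k * t + 2 * (sqrt k * t)"
        using t uw by (intro add_mono mult_left_mono) (auto simp: t_def)
      finally show ?thesis by (simp add: mult_ac)
    qed
    define f where "f l = of_real (1 / s) * h l" for l
    define g where "g l = of_real (1 / t) * w l" for l
    have fg2: "norm_2 d f = 1" "norm_2 d g = 1"
      unfolding f_def[abs_def] g_def[abs_def] norm_2_cmult using s t by (simp_all add: norm_divide s_def[symmetric] t_def[symmetric])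
    have f1: "norm_1 d f \<le> 4 * sqrt k"
    proof -
      have "norm_1 d f = norm_1 d h / s"
        unfolding f_def[abs_def] norm_1_cmult using s by (simp add: norm_divide)
      also have "\<dots> \<le> 2 * sqrt k" using h1 s by (simp add: divide_le_eq)
      also have "\<dots> \<le> 4 * sqrt k" by simp
      finally show ?thesis .
    qed
    have g1: "norm_1 d g \<le> 4 * sqrt k"
      unfolding g_def[abs_def] norm_1_cmult using w1 t by (simp add: norm_divide divide_le_eq)
    have "cip d h w = of_real ((norm_2 d x)\<^sup>2 - (norm_2 d u)\<^sup>2)"
      unfolding h_def[abs_def] w_def[abs_def] cip_linear ux
      using cip_commute[of d x u] by (simp add: ux cip_self)
    then have "Im (cip d f g) = 0"
      unfolding f_def[abs_def] g_def[abs_def] cip_linear by simp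
    from ball[OF fg2(1) f1 fg2(2) g1 this]
    have count: "\<mu> * real m \<le> real (card {j. j < m \<and> (cip d (A j) f, cip d (A j) g) \<in> correlated_values \<sigma> B})"
      (is "_ \<le> real (card ?G)") .
    have large: "(s * \<sigma> / (2 * B))\<^sup>2 \<le> (cmod (cip d (A j) x) - cmod (cip d (A j) x0))\<^sup>2" if "j \<in> ?G" for j
    proof -
      have "s * \<sigma> / (2 * B) \<le> \<bar>cmod (cip d (A j) x) - cmod (cip d (A j) u)\<bar>"
      proof (rule abs_cmod_diff_lower_bound)
        show "of_real s * cip d (A j) f = cip d (A j) x - cip d (A j) u"
          unfolding f_def[abs_def] h_def[abs_def] cip_linear using s by simp
        show "of_real t * cip d (A j) g = cip d (A j) x + cip d (A j) u"
          unfolding g_def[abs_def] w_def[abs_def] cip_linear using t by simp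
      qed (use s t B that in auto)
      also have "cmod (cip d (A j) u) = cmod (cip d (A j) x0)"
        unfolding cu by (simp add: norm_mult e1)
      finally have "(s * \<sigma> / (2 * B))\<^sup>2 \<le> \<bar>cmod (cip d (A j) x) - cmod (cip d (A j) x0)\<bar>\<^sup>2"
        using s \<sigma> B by (intro power_mono) auto
      then show ?thesis by simp
    qed
    have "\<mu> * real m * (s * \<sigma> / (2 * B))\<^sup>2 \<le> real (card ?G) * (s * \<sigma> / (2 * B))\<^sup>2"
      by (intro mult_right_mono count) simp
    also have "\<dots> = (\<Sum>j\<in>?G. (s * \<sigma> / (2 * B))\<^sup>2)" by simp
    also have "\<dots> \<le> (\<Sum>j\<in>?G. (cmod (cip d (A j) x) - cmod (cip d (A j) x0))\<^sup>2)"
      by (intro sum_mono large)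
    also have "\<dots> \<le> (\<Sum>j<m. (cmod (cip d (A j) x) - cmod (cip d (A j) x0))\<^sup>2)"
      by (intro sum_mono2) auto
    also have "\<dots> = (norm_2 m (\<lambda>j. cmod (cip d (A j) x) - cmod (cip d (A j) x0)))\<^sup>2"
      by (simp add: norm_2_power2)
    also have "\<dots> \<le> (2 * \<epsilon>)\<^sup>2"
    proof (intro power_mono norm_2_nonneg)
      have "norm_2 m (\<lambda>j. (cmod (cip d (A j) x) - b j) + \<eta> j) \<le> norm_2 m (\<lambda>j. cmod (cip d (A j) x) - b j) + norm_2 m \<eta>"
        by (rule norm_2_triangle)
      then show "norm_2 m (\<lambda>j. cmod (cip d (A j) x) - cmod (cip d (A j) x0)) \<le> 2 * \<epsilon>"
        using feas \<eta> by (simp add: b)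
    qed
    finally have "(sqrt \<mu> * sqrt (real m) * (s * \<sigma> / (2 * B)))\<^sup>2 \<le> (2 * \<epsilon>)\<^sup>2"
      using \<mu> by (subst power_mult_distrib, subst power_mult_distrib) simp
    then have "sqrt \<mu> * sqrt (real m) * (s * \<sigma> / (2 * B)) \<le> 2 * \<epsilon>"
      by (rule power2_le_imp_le) (use \<epsilon> in simp)
    then have "s * (\<sigma> * sqrt \<mu> * sqrt (real m)) \<le> 4 * B * \<epsilon>"
      using B by (simp add: field_simps)
    then have "s \<le> 4 * B * \<epsilon> / (\<sigma> * sqrt \<mu> * sqrt (real m))"
      using \<sigma> \<mu> m by (simp add: pos_le_divide_eq)
    then show ?thesis by simp
  qed
  then show ?thesis using pd by (simp add: s_def)
qed

section \<open>The recovery constants\<close>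

lemma standard_entry_cong_distr:
  assumes X: "standard_entry M \<beta> \<gamma> X" and Y[measurable]: "Y \<in> borel_measurable N"
    and eq: "distr N borel Y = distr M borel X"
  shows "standard_entry N \<beta> \<gamma> Y"
proof -
  have [measurable]: "X \<in> borel_measurable M" using X by (simp add: standard_entry_def)
  have int: "(\<integral>\<omega>. h (Y \<omega>) \<partial>N) = (\<integral>\<omega>. h (X \<omega>) \<partial>M)" if [measurable]: "h \<in> borel_measurable borel"
    for h :: "complex \<Rightarrow> 'c::{banach, second_countable_topology}"
    using integral_distr[of Y N borel h] integral_distr[of X M borel h] eq by simp
  have "integrable N (\<lambda>\<omega>. exp (\<beta> * (cmod (Y \<omega>))\<^sup>2))"
    using X integrable_distr_eq[of Y N borel "\<lambda>z. exp (\<beta> * (cmod z)\<^sup>2)"]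
      integrable_distr_eq[of X M borel "\<lambda>z. exp (\<beta> * (cmod z)\<^sup>2)"] eq
    by (simp add: standard_entry_def)
  then show ?thesis
    using X int[of "\<lambda>z. exp (\<beta> * (cmod z)\<^sup>2)"] int[of "\<lambda>z. z"] int[of "\<lambda>z. z\<^sup>2"]
      int[of "\<lambda>z. (cmod z)\<^sup>2"] int[of "\<lambda>z. cmod z ^ 4"]
    by (simp add: standard_entry_def)
qed

text \<open>
  The event excludes the outcomes with a long column and, for each admissible pair of elements of the
  net, those with few good rows. The \<open>d\<close> columns cost a factor \<open>exp \<kappa>\<close>, as \<open>ln d \<le> k ln (e d / k)\<close>; the
  pairs cost the square of the size of the net, which half of the exponent in Hoeffding's inequality
  absorbs.
\<close>
lemma (in standard_matrix) small_ball_event: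
  assumes \<gamma>: "\<gamma> > 1" and k: "1 \<le> k" "k \<le> d" and m: "0 < m"
  defines "c \<equiv> min 1 (\<gamma> - 1) / 8"
  defines "\<delta> \<equiv> c\<^sup>2 / (4 * moment8_bound \<beta>)"
  defines "B \<equiv> 2 / sqrt \<delta>"
  defines "\<kappa> \<equiv> real k * ln (exp 1 * real d / real k)"
  assumes L: "12800 \<le> L" "1024 / (\<beta> * \<delta> * (min B (sqrt c / (6 * B)))\<^sup>2) \<le> real L"
    and m_ge: "2 * \<kappa> \<le> real m" "2 * real (L * (L + 1)) * \<kappa> \<le> \<delta>\<^sup>2 * real m"
  shows "\<exists>E\<in>sets M. prob E \<ge> 1 - 2 * exp (- (min (1 / 2) (\<delta>\<^sup>2) * real m)) \<and>
    (\<forall>\<omega>\<in>E. \<forall>f g. norm_2 d f = 1 \<longrightarrow> norm_1 d f \<le> 4 * sqrt k \<longrightarrow> norm_2 d g = 1 \<longrightarrow>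
      norm_1 d g \<le> 4 * sqrt k \<longrightarrow> Im (cip d f g) = 0 \<longrightarrow>
      \<delta> / 2 * real m \<le> real (card {j. j < m \<and>
        (cip d (\<lambda>l. a j l \<omega>) f, cip d (\<lambda>l. a j l \<omega>) g) \<in> correlated_values (sqrt c / 2) (2 * B)}))"
proof -
  have c: "0 < c" using \<gamma> by (simp add: c_def)
  have \<delta>: "0 < \<delta>" using c beta_pos by (simp add: \<delta>_def moment8_bound_def)
  have B: "0 < B" using \<delta> by (simp add: B_def)
  define \<tau> where "\<tau> = min B (sqrt c / (6 * B))"
  have \<tau>: "0 < \<tau>" using B c by (simp add: \<tau>_def)
  define Net where "Net = empirical_net d (8 * sqrt k) (L * k)"
  define P where "P = {(f, g) \<in> Net \<times> Net. (norm_2 d f)\<^sup>2 \<le> 4 \<and> (norm_2 d g)\<^sup>2 \<le> 4 \<and>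
      1 / 2 \<le> (norm_2 d f)\<^sup>2 * (norm_2 d g)\<^sup>2 - (Im (cip d f g))\<^sup>2}"
  have finNet: "finite Net" unfolding Net_def by (rule finite_empirical_net)
  have P: "P \<subseteq> Net \<times> Net" "finite P"
    using finNet by (auto simp: P_def intro: finite_subset[of _ "Net \<times> Net"])
  define S where "S = correlated_values (sqrt c) B"
  have S: "S \<in> sets borel" unfolding S_def by (rule correlated_values_borel)
  define Col where "Col l = {\<omega> \<in> space M. 2 / \<beta> * real m \<le> (\<Sum>j<m. (cmod (a j l \<omega>))\<^sup>2)}" for l
  define Cnt where "Cnt = (\<lambda>(f, g). {\<omega> \<in> space M.
      real (card {j. j < m \<and> (cip d (\<lambda>l. a j l \<omega>) f, cip d (\<lambda>l. a j l \<omega>) g) \<in> S}) \<le> (2 * \<delta> - \<delta>) * real m})"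
  have Col_sets: "Col l \<in> sets M" if "l < d" for l
    unfolding Col_def using entry_measurable[OF _ that] by measurable
  have Cnt_sets: "Cnt p \<in> sets M" for p
    unfolding Cnt_def case_prod_unfold
    by (intro borel_measurable_le count_rows_measurable S borel_measurable_const)
  have Cnt_le: "prob (Cnt p) \<le> exp (- 2 * \<delta>\<^sup>2 * real m)" if "p \<in> P" for p
  proof -
    obtain f g where p: "p = (f, g)" by (cases p)
    have fg: "(norm_2 d f)\<^sup>2 \<le> 4" "(norm_2 d g)\<^sup>2 \<le> 4"
      "1 / 2 \<le> (norm_2 d f)\<^sup>2 * (norm_2 d g)\<^sup>2 - (Im (cip d f g))\<^sup>2"
      using that by (auto simp: P_def p)
    have "2 * \<delta> \<le> prob {\<omega> \<in> space M. (cip d (\<lambda>l. a j l \<omega>) f, cip d (\<lambda>l. a j l \<omega>) g) \<in> S}" if "j < m" for j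
    proof -
      interpret row: standard_row M "a j" d \<beta> \<gamma> by (rule row[OF that])
      show ?thesis
        using row.row_small_ball[OF \<gamma> fg[unfolded norm_2_power2]]
        by (simp add: S_def correlated_values_def B_def \<delta>_def c_def)
    qed
    then show ?thesis
      unfolding p Cnt_def prod.case using \<delta> by (intro count_rows_tail m S) auto
  qed
  define Bad where "Bad = (\<Union>l<d. Col l) \<union> (\<Union>p\<in>P. Cnt p)"
  have Bad_sets: "Bad \<in> sets M"
    unfolding Bad_def using Col_sets Cnt_sets P(2) by (intro sets.Un sets.finite_UN) auto
  have q: "real d / real k \<ge> 1" using k by simp
  have \<kappa>_eq: "\<kappa> = real k + real k * ln (real d / real k)"
    using k by (simp add: \<kappa>_def ln_div ln_mult algebra_simps)
  have d_le: "real d \<le> exp \<kappa>"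
  proof -
    have "ln (real d) = ln (real d / real k) + ln (real k)"
      using k by (simp add: ln_div)
    also have "\<dots> \<le> real k * ln (real d / real k) + real k"
      using k q ln_le_minus_one[of "real k"] mult_right_mono[of 1 "real k" "ln (real d / real k)"]
      by (intro add_mono) auto
    finally have "ln (real d) \<le> \<kappa>" by (simp add: \<kappa>_eq)
    then have "exp (ln (real d)) \<le> exp \<kappa>" by simp
    then show ?thesis using k by simp
  qed
  have "prob Bad \<le> prob (\<Union>l<d. Col l) + prob (\<Union>p\<in>P. Cnt p)"
    unfolding Bad_def using Col_sets Cnt_sets P(2)
    by (intro measure_Un_le sets.finite_UN) auto
  also have "prob (\<Union>l<d. Col l) \<le> (\<Sum>l<d. prob (Col l))"
    using Col_sets by (intro finite_measure_subadditive_finite) auto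
  also have "\<dots> \<le> (\<Sum>l<d. exp (- real m))"
    unfolding Col_def by (intro sum_mono column_norm_tail) auto
  also have "\<dots> \<le> exp \<kappa> * exp (- real m)"
    using d_le by (simp add: mult_right_mono)
  also have "\<dots> \<le> exp (- (min (1 / 2) (\<delta>\<^sup>2) * real m))"
  proof -
    have "min (1 / 2) (\<delta>\<^sup>2) * real m \<le> 1 / 2 * real m" by (intro mult_right_mono) auto
    then show ?thesis using m_ge(1) by (simp flip: exp_add)
  qed
  also have "prob (\<Union>p\<in>P. Cnt p) \<le> (\<Sum>p\<in>P. prob (Cnt p))"
    using P Cnt_sets by (intro finite_measure_subadditive_finite) auto
  also have "\<dots> \<le> (\<Sum>p\<in>P. exp (- 2 * \<delta>\<^sup>2 * real m))"
    by (intro sum_mono Cnt_le)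
  also have "\<dots> = real (card P) * exp (- 2 * \<delta>\<^sup>2 * real m)" by simp
  also have "\<dots> \<le> (exp (real (L * (L + 1)) * \<kappa>))\<^sup>2 * exp (- 2 * \<delta>\<^sup>2 * real m)"
  proof (intro mult_right_mono)
    have "card P \<le> card Net * card Net"
      using card_mono[OF _ P(1)] finNet by (simp add: card_cartesian_product)
    then have "real (card P) \<le> (real (card Net))\<^sup>2"
      by (simp add: power2_eq_square flip: of_nat_mult)
    also have "\<dots> \<le> (exp (real (L * (L + 1)) * \<kappa>))\<^sup>2"
      unfolding Net_def \<kappa>_def using L by (intro power_mono card_empirical_net_le_exp k) auto
    finally show "real (card P) \<le> (exp (real (L * (L + 1)) * \<kappa>))\<^sup>2" .
  qed simp
  also have "\<dots> = exp (2 * (real (L * (L + 1)) * \<kappa>) + - 2 * \<delta>\<^sup>2 * real m)"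
    by (simp only: exp_add exp_double)
  also have "\<dots> = exp (2 * real (L * (L + 1)) * \<kappa> - 2 * \<delta>\<^sup>2 * real m)"
    by (simp only: mult.assoc minus_mult_left[symmetric] diff_conv_add_uminus)
  also have "\<dots> \<le> exp (- (min (1 / 2) (\<delta>\<^sup>2) * real m))"
  proof -
    have "min (1 / 2) (\<delta>\<^sup>2) * real m \<le> \<delta>\<^sup>2 * real m" by (intro mult_right_mono) auto
    then have "2 * real (L * (L + 1)) * \<kappa> - 2 * \<delta>\<^sup>2 * real m \<le> - (min (1 / 2) (\<delta>\<^sup>2) * real m)"
      using m_ge(2) by linarith
    then show ?thesis by (simp only: exp_le_cancel_iff)
  qed
  finally have Bad: "prob Bad \<le> 2 * exp (- (min (1 / 2) (\<delta>\<^sup>2) * real m))" by simp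
  show ?thesis
  proof (intro bexI[of _ "space M - Bad"] conjI ballI allI impI)
    show "prob (space M - Bad) \<ge> 1 - 2 * exp (- (min (1 / 2) (\<delta>\<^sup>2) * real m))"
      using Bad prob_compl[OF Bad_sets] by simp
    show "space M - Bad \<in> sets M" using Bad_sets by auto
    fix \<omega> and f g :: "nat \<Rightarrow> complex"
    assume \<omega>: "\<omega> \<in> space M - Bad"
      and f: "norm_2 d f = 1" "norm_1 d f \<le> 4 * sqrt k" and g: "norm_2 d g = 1" "norm_1 d g \<le> 4 * sqrt k"
      and fg: "Im (cip d f g) = 0"
    show "\<delta> / 2 * real m \<le> real (card {j. j < m \<and>
        (cip d (\<lambda>l. a j l \<omega>) f, cip d (\<lambda>l. a j l \<omega>) g) \<in> correlated_values (sqrt c / 2) (2 * B)})"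
    proof (rule uniform_small_ball[OF k(1) L(1) _ B _ _ _ _ f g fg])
      show "0 < sqrt c" using c by simp
      show "0 < 2 / \<beta> * real m" using beta_pos m by simp
      show "2 / \<beta> * real m * (128 / real L) \<le> \<delta> / 4 * real m * (min B (sqrt c / (6 * B)))\<^sup>2"
      proof -
        have "1024 \<le> real L * (\<beta> * \<delta> * \<tau>\<^sup>2)"
          using L(2) beta_pos \<delta> \<tau> unfolding \<tau>_def[symmetric] by (simp add: pos_divide_le_eq)
        then have "256 / (\<beta> * real L) \<le> \<delta> / 4 * \<tau>\<^sup>2"
          using L(1) beta_pos by (simp add: pos_divide_le_eq mult_ac)
        then have "256 / (\<beta> * real L) * real m \<le> \<delta> / 4 * \<tau>\<^sup>2 * real m"
          by (intro mult_right_mono) auto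
        then show ?thesis unfolding \<tau>_def[symmetric] by (simp add: mult_ac)
      qed
      show "(\<Sum>j<m. (cmod (a j l \<omega>))\<^sup>2) \<le> 2 / \<beta> * real m" if "l < d" for l
        using \<omega> that by (force simp: Bad_def Col_def not_le)
      show "\<delta> * real m \<le> real (card {j. j < m \<and>
          (cip d (\<lambda>l. a j l \<omega>) f, cip d (\<lambda>l. a j l \<omega>) g) \<in> correlated_values (sqrt c) B})"
        if "f \<in> empirical_net d (8 * sqrt k) (L * k)" "g \<in> empirical_net d (8 * sqrt k) (L * k)"
          "(norm_2 d f)\<^sup>2 \<le> 4" "(norm_2 d g)\<^sup>2 \<le> 4"
          "1 / 2 \<le> (norm_2 d f)\<^sup>2 * (norm_2 d g)\<^sup>2 - (Im (cip d f g))\<^sup>2" for f g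
      proof -
        have "(f, g) \<in> P" using that by (simp add: P_def Net_def)
        then have "\<omega> \<notin> Cnt (f, g)" using \<omega> by (auto simp: Bad_def)
        then show ?thesis using \<omega> by (simp add: Cnt_def S_def)
      qed
    qed
  qed
qed

lemma recovery_constants_exist:
  assumes C\<psi>: "C\<psi> > 0" and \<gamma>: "\<gamma> > 1"
  shows "\<exists>C C' c\<^sub>0. recovery_constants TYPE('a) C\<psi> \<gamma> C C' c\<^sub>0"
proof -
  define \<beta> where "\<beta> = 1 / (4 * exp 1 * C\<psi>\<^sup>2)"
  define c where "c = min 1 (\<gamma> - 1) / 8"
  define \<delta> where "\<delta> = c\<^sup>2 / (4 * moment8_bound \<beta>)"
  define B where "B = 2 / sqrt \<delta>"
  \<comment> \<open>For columns of squared length \<open>2 m / \<beta>\<close> the net moves the measurements by \<open>256 m / (\<beta> L)\<close> in squared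
    norm; \<open>L \<ge> r\<close> makes this at most \<open>\<delta> m \<tau>\<^sup>2 / 4\<close>, where \<open>\<tau>\<close> is the admissible perturbation of one
    measurement.\<close>
  define r where "r = 1024 / (\<beta> * \<delta> * (min B (sqrt c / (6 * B)))\<^sup>2)"
  define L where "L = 12800 + nat \<lceil>r\<rceil>"
  \<comment> \<open>The first summand pays for the union over the columns, the second for the union over pairs of
    elements of the net.\<close>
  define C where "C = 2 + 2 * real (L * (L + 1)) / \<delta>\<^sup>2"
  define C' where "C' = 4 * (2 * B) / (sqrt c / 2 * sqrt (\<delta> / 2))"
  define c0 where "c0 = 4 * min (1 / 2) (\<delta>\<^sup>2)"
  have \<beta>: "0 < \<beta>" using C\<psi> by (simp add: \<beta>_def)
  have c: "0 < c" using \<gamma> by (simp add: c_def)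
  have \<delta>: "0 < \<delta>" using c \<beta> by (simp add: \<delta>_def moment8_bound_def)
  have B: "0 < B" using \<delta> by (simp add: B_def)
  have L: "12800 \<le> L" "r \<le> real L"
    using real_nat_ceiling_ge[of r] by (auto simp: L_def intro: order.trans)
  have "recovery_constants TYPE('a) C\<psi> \<gamma> C C' c0"
    unfolding recovery_constants_def
  proof (intro conjI allI impI)
    show "C > 0" using \<delta> by (auto simp: C_def intro!: add_pos_nonneg divide_nonneg_pos)
    show "C' > 0" using B c \<delta> by (simp add: C'_def)
    show "c0 > 0" using \<delta> by (simp add: c0_def)
    fix M :: "'a measure" and \<xi> a and m d k :: nat and \<epsilon> :: real
    assume M: "prob_space M" and \<xi>: "entry_variable C\<psi> \<gamma> M \<xi>" and a: "iid_entries M m d \<xi> a"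
      and k: "1 \<le> k" "k \<le> d" and "0 \<le> \<epsilon>"
      and m_ge: "C * real k * ln (exp 1 * real d / real k) \<le> real m"
    interpret prob_space M by fact
    define \<kappa> where "\<kappa> = real k * ln (exp 1 * real d / real k)"
    have \<kappa>: "1 \<le> \<kappa>"
    proof -
      have "exp 1 * 1 \<le> exp 1 * (real d / real k)" using k by (intro mult_left_mono) auto
      then have "ln (exp 1) \<le> ln (exp 1 * real d / real k)" using k by (intro ln_mono) auto
      then have "1 * 1 \<le> real k * ln (exp 1 * real d / real k)" using k by (intro mult_mono) auto
      then show ?thesis by (simp add: \<kappa>_def)
    qed
    have mC: "2 * \<kappa> + 2 * real (L * (L + 1)) / \<delta>\<^sup>2 * \<kappa> \<le> real m"
      using m_ge by (simp add: \<kappa>_def C_def algebra_simps)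
    have nn: "0 \<le> 2 * real (L * (L + 1)) / \<delta>\<^sup>2 * \<kappa>" using \<kappa> by simp
    have m2: "2 * \<kappa> \<le> real m" using mC nn by linarith
    then have m: "0 < m" using \<kappa> by (cases m) auto
    have "2 * real (L * (L + 1)) / \<delta>\<^sup>2 * \<kappa> \<le> real m" using mC \<kappa> by linarith
    then have "\<delta>\<^sup>2 * (2 * real (L * (L + 1)) / \<delta>\<^sup>2 * \<kappa>) \<le> \<delta>\<^sup>2 * real m"
      by (intro mult_left_mono) auto
    then have m3: "2 * real (L * (L + 1)) * \<kappa> \<le> \<delta>\<^sup>2 * real m"
      using \<delta> by simp
    have \<xi>': "standard_entry M \<beta> \<gamma> \<xi>"
    proof -
      have sg: "sub_gaussian M \<xi>" "psi2_norm M \<xi> \<le> C\<psi>"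
        using \<xi> by (auto simp: entry_variable_def)
      show ?thesis
        using psi2_norm_exp_square_moment[OF M sg C\<psi>] \<xi> unfolding \<beta>_def[symmetric]
        by (auto simp: standard_entry_def entry_variable_def sub_gaussian_def)
    qed
    have ind: "indep_vars (\<lambda>_. borel) (\<lambda>(j, l). a j l) ({..<m} \<times> {..<d})"
      using a by (simp add: iid_entries_def)
    interpret standard_matrix M a m d \<beta> \<gamma>
    proof unfold_locales
      fix j l assume jl: "j < m" "l < d"
      have "a j l \<in> borel_measurable M"
        using ind jl unfolding indep_vars_def by fastforce
      then show "standard_entry M \<beta> \<gamma> (a j l)"
        using \<xi>' a jl by (intro standard_entry_cong_distr[OF \<xi>']) (auto simp: iid_entries_def)
    qed (use \<beta> ind in auto)
    obtain E where E: "E \<in> sets M" "prob E \<ge> 1 - 2 * exp (- (min (1 / 2) (\<delta>\<^sup>2) * real m))"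
      and ball: "\<And>\<omega> f g. \<omega> \<in> E \<Longrightarrow> norm_2 d f = 1 \<Longrightarrow> norm_1 d f \<le> 4 * sqrt k \<Longrightarrow> norm_2 d g = 1 \<Longrightarrow>
        norm_1 d g \<le> 4 * sqrt k \<Longrightarrow> Im (cip d f g) = 0 \<Longrightarrow>
        \<delta> / 2 * real m \<le> real (card {j. j < m \<and>
          (cip d (\<lambda>l. a j l \<omega>) f, cip d (\<lambda>l. a j l \<omega>) g) \<in> correlated_values (sqrt c / 2) (2 * B)})"
      using small_ball_event[OF \<gamma> k m, of L, folded c_def, folded \<delta>_def, folded B_def, folded r_def \<kappa>_def,
          OF L m2 m3] by auto
    show "\<exists>E\<in>sets M. prob E \<ge> 1 - 2 * exp (- c0 * real m / 4) \<and>
           (\<forall>\<omega>\<in>E. \<forall>x\<^sub>0 \<eta> b x'.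
              sparse d k x\<^sub>0 \<longrightarrow> norm_2 m \<eta> \<le> \<epsilon> \<longrightarrow>
              b = (\<lambda>j. cmod (cip d (\<lambda>l. a j l \<omega>) x\<^sub>0) + \<eta> j) \<longrightarrow>
              l1_solution m d (\<lambda>j l. a j l \<omega>) b \<epsilon> x' \<longrightarrow>
              phase_dist d x' x\<^sub>0 \<le> C' * (\<epsilon> / sqrt (real m)))"
    proof (intro bexI[OF _ E(1)] conjI ballI allI impI)
      show "prob E \<ge> 1 - 2 * exp (- c0 * real m / 4)"
        using E(2) by (simp add: c0_def)
      fix \<omega> x0 \<eta> b x
      assume \<omega>: "\<omega> \<in> E" and sp: "sparse d k x0" and \<eta>: "norm_2 m \<eta> \<le> \<epsilon>"
        and b: "b = (\<lambda>j. cmod (cip d (\<lambda>l. a j l \<omega>) x0) + \<eta> j)"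
        and sol: "l1_solution m d (\<lambda>j l. a j l \<omega>) b \<epsilon> x"
      show "phase_dist d x x0 \<le> C' * (\<epsilon> / sqrt (real m))"
        unfolding C'_def
        by (rule stable_recovery[OF _ _ _ m ball[OF \<omega>] sp \<eta> b sol]) (use B c \<delta> in simp_all)
    qed
  qed
  then show ?thesis by blast
qed

section \<open>Change of the sample space\<close>

lemma sub_gaussian_distr:
  assumes [measurable]: "\<phi> \<in> measurable M N" "Y \<in> borel_measurable N"
  shows "sub_gaussian (distr M N \<phi>) Y \<longleftrightarrow> sub_gaussian M (\<lambda>\<omega>. Y (\<phi> \<omega>))"
proof -
  have "measure (distr M N \<phi>) {x \<in> space (distr M N \<phi>). t \<le> norm (Y x)}
      = measure M {\<omega> \<in> space M. t \<le> norm (Y (\<phi> \<omega>))}" for t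
  proof -
    have "{x \<in> space N. t \<le> norm (Y x)} \<in> sets N" by measurable
    moreover have "\<phi> -` {x \<in> space N. t \<le> norm (Y x)} \<inter> space M = {\<omega> \<in> space M. t \<le> norm (Y (\<phi> \<omega>))}"
      using measurable_space[of \<phi> M N] by auto
    ultimately show ?thesis by (simp add: measure_distr)
  qed
  then show ?thesis by (simp add: sub_gaussian_def)
qed

lemma psi2_norm_distr:
  assumes [measurable]: "\<phi> \<in> measurable M N" "Y \<in> borel_measurable N"
  shows "psi2_norm (distr M N \<phi>) Y = psi2_norm M (\<lambda>\<omega>. Y (\<phi> \<omega>))"
  by (simp add: psi2_norm_def integral_distr)

lemma (in prob_space) indep_var_distr:
  assumes [measurable]: "\<phi> \<in> measurable M N" "Y \<in> measurable N S" "Z \<in> measurable N T"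
    and "indep_var S (\<lambda>\<omega>. Y (\<phi> \<omega>)) T (\<lambda>\<omega>. Z (\<phi> \<omega>))"
  shows "prob_space.indep_var (distr M N \<phi>) S Y T Z"
proof -
  interpret N: prob_space "distr M N \<phi>" by (rule prob_space_distr) measurable
  show ?thesis
    using assms(4) unfolding indep_var_distribution_eq N.indep_var_distribution_eq
    by (simp add: distr_distr comp_def)
qed

lemma (in prob_space) indep_vars_distr:
  assumes [measurable]: "\<phi> \<in> measurable M N" "\<And>i. i \<in> I \<Longrightarrow> Y i \<in> measurable N (S i)"
    and ind: "indep_vars S (\<lambda>i \<omega>. Y i (\<phi> \<omega>)) I"
  shows "prob_space.indep_vars (distr M N \<phi>) S Y I"
proof (cases "I = {}")
  case True
  interpret N: prob_space "distr M N \<phi>" by (rule prob_space_distr) measurable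
  show ?thesis using True by (simp add: N.indep_vars_def2 N.indep_sets_def)
next
  case False
  interpret N: prob_space "distr M N \<phi>" by (rule prob_space_distr) measurable
  have Y: "(\<lambda>x. \<lambda>i\<in>I. Y i x) \<in> measurable N (PiM I S)"
    by (intro measurable_restrict) (use assms in auto)
  have "distr (distr M N \<phi>) (PiM I S) (\<lambda>x. \<lambda>i\<in>I. Y i x) = distr M (PiM I S) (\<lambda>\<omega>. \<lambda>i\<in>I. Y i (\<phi> \<omega>))"
    using distr_distr[OF Y, of \<phi> M] by (simp add: comp_def)
  also have "\<dots> = PiM I (\<lambda>i. distr M (S i) (\<lambda>\<omega>. Y i (\<phi> \<omega>)))"
    using ind by (subst indep_vars_iff_distr_eq_PiM'[symmetric]) (use False assms in auto)
  also have "\<dots> = PiM I (\<lambda>i. distr (distr M N \<phi>) (S i) (Y i))"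
    by (intro PiM_cong refl) (use assms in \<open>auto simp: distr_distr comp_def\<close>)
  finally show ?thesis
    by (subst N.indep_vars_iff_distr_eq_PiM') (use False assms in auto)
qed

lemma entry_variable_distr:
  assumes M: "prob_space M" and \<phi>[measurable]: "\<phi> \<in> measurable M N" and Y[measurable]: "Y \<in> borel_measurable N"
    and entry: "entry_variable C\<psi> \<gamma> M (\<lambda>\<omega>. Y (\<phi> \<omega>))"
  shows "entry_variable C\<psi> \<gamma> (distr M N \<phi>) Y"
proof -
  interpret prob_space M by fact
  obtain \<xi>1 \<xi>2 where "(\<lambda>\<omega>. Y (\<phi> \<omega>)) = (\<lambda>\<omega>. Complex (\<xi>1 \<omega>) (\<xi>2 \<omega>))"
    and \<xi>: "sub_gaussian M \<xi>1" "sub_gaussian M \<xi>2" "distr M borel \<xi>1 = distr M borel \<xi>2"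
      "indep_var borel \<xi>1 borel \<xi>2"
    using entry unfolding entry_variable_def by blast
  then have eq: "\<xi>1 = (\<lambda>\<omega>. Re (Y (\<phi> \<omega>)))" "\<xi>2 = (\<lambda>\<omega>. Im (Y (\<phi> \<omega>)))"
    by (metis complex.sel(1), metis complex.sel(2))
  define Y1 where "Y1 x = Re (Y x)" for x
  define Y2 where "Y2 x = Im (Y x)" for x
  have m[measurable]: "Y1 \<in> borel_measurable N" "Y2 \<in> borel_measurable N"
    unfolding Y1_def[abs_def] Y2_def[abs_def] by measurable
  have eq': "\<xi>1 = (\<lambda>\<omega>. Y1 (\<phi> \<omega>))" "\<xi>2 = (\<lambda>\<omega>. Y2 (\<phi> \<omega>))"
    by (simp_all add: eq Y1_def Y2_def)
  have "Y = (\<lambda>x. Complex (Y1 x) (Y2 x))" by (simp add: Y1_def Y2_def)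
  moreover have "sub_gaussian (distr M N \<phi>) Y1" "sub_gaussian (distr M N \<phi>) Y2"
    using \<xi>(1,2) by (simp_all add: sub_gaussian_distr eq')
  moreover have "distr (distr M N \<phi>) borel Y1 = distr (distr M N \<phi>) borel Y2"
    using \<xi>(3) by (simp add: distr_distr comp_def eq')
  moreover have "prob_space.indep_var (distr M N \<phi>) borel Y1 borel Y2"
    using \<xi>(4) unfolding eq' by (intro indep_var_distr) auto
  moreover have "sub_gaussian (distr M N \<phi>) Y \<and> psi2_norm (distr M N \<phi>) Y \<le> C\<psi> \<and>
     (\<integral>x. Y x \<partial>distr M N \<phi>) = 0 \<and> (\<integral>x. (Y x)\<^sup>2 \<partial>distr M N \<phi>) = 0 \<and>
     (\<integral>x. (cmod (Y x))\<^sup>2 \<partial>distr M N \<phi>) = 1 \<and> (\<integral>x. cmod (Y x) ^ 4 \<partial>distr M N \<phi>) = \<gamma>"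
    using entry by (simp add: entry_variable_def sub_gaussian_distr psi2_norm_distr integral_distr)
  ultimately show ?thesis
    unfolding entry_variable_def by blast
qed

lemma l1_solution_cong:
  assumes "\<And>j l. j < m \<Longrightarrow> l < d \<Longrightarrow> A j l = A' j l" and "\<And>j. j < m \<Longrightarrow> b j = b' j"
  shows "l1_solution m d A b \<epsilon> x \<longleftrightarrow> l1_solution m d A' b' \<epsilon> x"
proof -
  have "norm_2 m (\<lambda>j. cmod (cip d (A j) y) - b j) = norm_2 m (\<lambda>j. cmod (cip d (A' j) y) - b' j)" for y
    unfolding norm_2_def cip_def by (intro L2_set_cong refl) (use assms in simp)
  then show ?thesis by (simp add: l1_solution_def)
qed

text \<open>
  The new sample space carries the joint law of the entries and of \<open>\<xi>\<close>. Coordinates outside the matrix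
  all repeat \<open>\<xi>\<close>, so that \<open>(m, d)\<close> is an index at which \<open>\<xi>\<close> is found. The event on the original space is
  the preimage of the event on the new one.
\<close>
lemma recovery_constants_transfer:
  assumes rc: "recovery_constants TYPE(nat \<times> nat \<Rightarrow> complex) C\<psi> \<gamma> C C' c\<^sub>0"
  shows "recovery_constants TYPE('a) C\<psi> \<gamma> C C' c\<^sub>0"
  unfolding recovery_constants_def
proof (intro conjI allI impI)
  show "C > 0" "C' > 0" "c\<^sub>0 > 0" using rc by (auto simp: recovery_constants_def)
  fix M :: "'a measure" and \<xi> a and m d k :: nat and \<epsilon> :: real
  assume M: "prob_space M" and \<xi>: "entry_variable C\<psi> \<gamma> M \<xi>" and a: "iid_entries M m d \<xi> a"
    and k: "1 \<le> k" "k \<le> d" and \<epsilon>: "0 \<le> \<epsilon>"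
    and m_ge: "C * real k * ln (exp 1 * real d / real k) \<le> real m"
  interpret prob_space M by fact
  define I where "I = {..<m} \<times> {..<d}"
  define N where "N = (PiM UNIV (\<lambda>_. borel) :: (nat \<times> nat \<Rightarrow> complex) measure)"
  define \<phi> where "\<phi> \<omega> p = (if p \<in> I then a (fst p) (snd p) \<omega> else \<xi> \<omega>)" for \<omega> p
  have ind: "indep_vars (\<lambda>_. borel) (\<lambda>(j, l). a j l) I"
    and law: "\<And>j l. j < m \<Longrightarrow> l < d \<Longrightarrow> distr M borel (a j l) = distr M borel \<xi>"
    using a by (auto simp: iid_entries_def I_def)
  have \<xi>_meas: "\<xi> \<in> borel_measurable M"
    using \<xi> by (auto simp: entry_variable_def sub_gaussian_def)
  have a_meas: "a j l \<in> borel_measurable M" if "(j, l) \<in> I" for j l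
    using ind that unfolding indep_vars_def by fastforce
  have \<phi>[measurable]: "\<phi> \<in> measurable M N"
    unfolding N_def
  proof (rule measurable_PiM_single')
    show "(\<lambda>\<omega>. \<phi> \<omega> p) \<in> borel_measurable M" for p
      using \<xi>_meas a_meas[of "fst p" "snd p"] by (cases "p \<in> I") (auto simp: \<phi>_def)
  qed auto
  have proj[measurable]: "(\<lambda>x. x p) \<in> borel_measurable N" for p
    unfolding N_def by (rule measurable_component_singleton) simp
  define M' where "M' = distr M N \<phi>"
  define \<xi>' where "\<xi>' x = x (m, d)" for x :: "nat \<times> nat \<Rightarrow> complex"
  define a' where "a' j l x = x (j, l)" for j l and x :: "nat \<times> nat \<Rightarrow> complex"
  have [measurable]: "\<xi>' \<in> borel_measurable N" "a' j l \<in> borel_measurable N" for j l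
    unfolding \<xi>'_def[abs_def] a'_def[abs_def] by measurable
  have \<xi>'_eq: "\<xi>' (\<phi> \<omega>) = \<xi> \<omega>" for \<omega>
    by (simp add: \<xi>'_def \<phi>_def I_def)
  have a'_eq: "a' j l (\<phi> \<omega>) = a j l \<omega>" if "j < m" "l < d" for j l \<omega>
    using that by (simp add: a'_def \<phi>_def I_def)
  have M': "prob_space M'" unfolding M'_def by (rule prob_space_distr) measurable
  have ev: "entry_variable C\<psi> \<gamma> M' \<xi>'"
    unfolding M'_def using \<xi> by (intro entry_variable_distr M) (simp_all add: \<xi>'_eq)
  have iid: "iid_entries M' m d \<xi>' a'"
    unfolding iid_entries_def
  proof (intro conjI allI impI)
    show "prob_space.indep_vars M' (\<lambda>_. borel) (\<lambda>(j, l). a' j l) ({..<m} \<times> {..<d})"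
      unfolding M'_def
    proof (rule indep_vars_distr)
      have "indep_vars (\<lambda>_. borel) (\<lambda>i \<omega>. (case i of (j, l) \<Rightarrow> a' j l) (\<phi> \<omega>)) I \<longleftrightarrow> indep_vars (\<lambda>_. borel) (\<lambda>(j, l). a j l) I"
        by (rule indep_vars_cong) (auto simp: I_def a'_eq)
      then show "indep_vars (\<lambda>_. borel) (\<lambda>i \<omega>. (case i of (j, l) \<Rightarrow> a' j l) (\<phi> \<omega>)) ({..<m} \<times> {..<d})"
        using ind by (simp add: I_def)
    qed auto
    show "distr M' borel (a' j l) = distr M' borel \<xi>'" if "j < m" "l < d" for j l
    proof -
      have "distr M' borel (a' j l) = distr M borel (a j l)"
        unfolding M'_def using that by (simp add: distr_distr comp_def a'_eq)
      also have "\<dots> = distr M' borel \<xi>'"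
        unfolding M'_def using law[OF that] by (simp add: distr_distr comp_def \<xi>'_eq)
      finally show ?thesis .
    qed
  qed
  note rc' = rc[unfolded recovery_constants_def, THEN conjunct2, THEN conjunct2, THEN conjunct2, rule_format,
      OF M' ev iid k \<epsilon> m_ge]
  then obtain E where E: "E \<in> sets M'" "measure M' E \<ge> 1 - 2 * exp (- c\<^sub>0 * real m / 4)"
    and rec: "\<forall>x\<in>E. \<forall>x\<^sub>0 \<eta> b x'. sparse d k x\<^sub>0 \<longrightarrow> norm_2 m \<eta> \<le> \<epsilon> \<longrightarrow>
      b = (\<lambda>j. cmod (cip d (\<lambda>l. a' j l x) x\<^sub>0) + \<eta> j) \<longrightarrow>
      l1_solution m d (\<lambda>j l. a' j l x) b \<epsilon> x' \<longrightarrow> phase_dist d x' x\<^sub>0 \<le> C' * (\<epsilon> / sqrt (real m))"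
    by (elim bexE conjE)
  have EN: "E \<in> sets N" using E(1) by (simp add: M'_def)
  show "\<exists>E\<in>sets M. prob E \<ge> 1 - 2 * exp (- c\<^sub>0 * real m / 4) \<and>
         (\<forall>\<omega>\<in>E. \<forall>x\<^sub>0 \<eta> b x'.
            sparse d k x\<^sub>0 \<longrightarrow> norm_2 m \<eta> \<le> \<epsilon> \<longrightarrow>
            b = (\<lambda>j. cmod (cip d (\<lambda>l. a j l \<omega>) x\<^sub>0) + \<eta> j) \<longrightarrow>
            l1_solution m d (\<lambda>j l. a j l \<omega>) b \<epsilon> x' \<longrightarrow>
            phase_dist d x' x\<^sub>0 \<le> C' * (\<epsilon> / sqrt (real m)))"
  proof (intro bexI[of _ "\<phi> -` E \<inter> space M"] conjI ballI allI impI)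
    show "\<phi> -` E \<inter> space M \<in> sets M" using EN by (rule measurable_sets[OF \<phi>])
    show "prob (\<phi> -` E \<inter> space M) \<ge> 1 - 2 * exp (- c\<^sub>0 * real m / 4)"
      using E(2) EN by (simp add: M'_def measure_distr)
    fix \<omega> x0 \<eta> b x
    assume \<omega>: "\<omega> \<in> \<phi> -` E \<inter> space M" and sp: "sparse d k x0" and \<eta>: "norm_2 m \<eta> \<le> \<epsilon>"
      and b: "b = (\<lambda>j. cmod (cip d (\<lambda>l. a j l \<omega>) x0) + \<eta> j)"
      and sol: "l1_solution m d (\<lambda>j l. a j l \<omega>) b \<epsilon> x"
    have "l1_solution m d (\<lambda>j l. a' j l (\<phi> \<omega>)) (\<lambda>j. cmod (cip d (\<lambda>l. a' j l (\<phi> \<omega>)) x0) + \<eta> j) \<epsilon> x"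
      using sol by (rule iffD1[OF l1_solution_cong, rotated -1]) (simp_all add: a'_eq b cip_def)
    then show "phase_dist d x x0 \<le> C' * (\<epsilon> / sqrt (real m))"
      using \<omega> sp \<eta> by (intro rec[rule_format, of "\<phi> \<omega>"]) auto
  qed
qed

section \<open>Recovery of sparse complex signals from phaseless measurements\<close>

theorem theorem1p8:
  fixes C\<psi> \<gamma> :: real
  assumes "C\<psi> > 0" and "\<gamma> > 1"
  shows "(\<exists>C C' c\<^sub>0. recovery_constants TYPE(nat \<times> nat \<Rightarrow> complex) C\<psi> \<gamma> C C' c\<^sub>0) \<and>
    (\<forall>C C' c\<^sub>0. recovery_constants TYPE(nat \<times> nat \<Rightarrow> complex) C\<psi> \<gamma> C C' c\<^sub>0 \<longrightarrow>
       recovery_constants TYPE('a) C\<psi> \<gamma> C C' c\<^sub>0)"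
  using recovery_constants_exist[OF assms] recovery_constants_transfer by blast

end
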